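(* Let $k\ge 1$ be an integer, $N\ge 2$ an even integer, and let $\alpha_m,\beta_m,\gamma_m>0$ ($m=1,\dots,k$). Consider the point process on $\{0,\dots,2kN\}\times\mathbb Z$ associated with the doubly periodic weighting $(\alpha_m,\beta_m,\gamma_m)$ of the Aztec diamond of size $kN$, i.e. the probability measure $\frac1{Z_{n,N}}\prod_{m=1}^{2kN}\det\big(T_{\phi_m}(u_{m-1}^j,u_m^{l})\big)_{j,l=1}^{2n}$ described in the context, with $n\ge \frac{kN}{2}$. This process is determinantal (in the shifted coordinates $u=2(\xi+n)+i$ explained in the context) and, for integers $-\frac{kN}{2}\le \xi,\xi'\le -1$ and $0<m,m'<N$, its correlation kernel is given by \[ \begin{aligned} \big[K(2km,2\xi+i;2km',2\xi'+j)\big]_{i,j=0}^1 ={}& -\frac{\mathbf 1_{m>m'}}{2\pi \mathrm i}\oint_{\gamma_{0,1}}\Phi(z)^{m-m'}z^{\xi'-\xi}\frac{dz}{z}\\ &+\frac{1}{(2\pi \mathrm i)^2}\oint_{\gamma_1}\oint_{\gamma_{0,1}}\frac{w^{\xi'}}{z^{\xi+1}}\frac{(1-z^{-1})^{\frac{kN}{2}}}{(1-w^{-1})^{\frac{kN}{2}}}\,\rho_1(w)^{\frac N2-m'}E(w)\begin{pmatrix}1&0\\0&0\end{pmatrix}E(w)^{-1}\Phi(z)^{m-\frac N2}\frac{dz\,dw}{z-w}. \end{aligned} \] Here $\gamma_1$ is a simple closed curve around $1$ with $0$ in its exterior, $\gamma_{0,1}$ is a simple closed curve around $0$ and $\gamma_1$,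 both curves intersect the real line exactly at two points and are positively (counterclockwise) oriented; the $w$-integral is over $\gamma_1$ and the $z$-integral over $\gamma_{0,1}$.
   Context: Extend the weights periodically: $\alpha_{m+k}=\alpha_m$, $\beta_{m+k}=\beta_m$, $\gamma_{m+k}=\gamma_m$. For $m=1,\dots,kN$ set \[ \phi_{2m-1}(z)=\begin{pmatrix}\gamma_m&\alpha_m z^{-1}\\ \alpha_m^{-1}&\gamma_m^{-1}\end{pmatrix},\qquad \phi_{2m}(z)=\frac1{1-z^{-1}}\begin{pmatrix}1&\beta_m z^{-1}\\ \beta_m^{-1}&1\end{pmatrix}. \] For each $m$, the transition matrix $T_{\phi_m}$ is the block Toeplitz matrix $T_{\phi_m}(2x+r,2y+s)=\big(\hat\phi_m(y-x)\big)_{r+1,s+1}$, $r,s\in\{0,1\}$, $x,y\in\mathbb Z$, where $\hat\phi_m(j)$ is the coefficient of $z^j$ in the Laurent expansion of $\phi_m$ for $|z|>1$ (i.e. in powers of $z^{-1}$). The measure: fix an integer $n\ge kN/2$. It is the probability measure on collections of points $(m,u_m^j)$, $m=0,\dots,2kN$, $j=1,\dots,2n$, $u_m^j\in\mathbb Z$, proportional to $\prod_{m=1}^{2kN}\det\big(T_{\phi_m}(u_{m-1}^j,u_m^l)\big)_{j,l=1}^{2n}$, with fixed $u_0^j=j-1$ and $u_{2kN}^j=-kN+j-1$ for $j=1,\dots,2n$; $Z_{n,N}$ is the normalizing constant. (It encodes the $2n$ non-intersecting paths whose top part, $u\ge 2n-kN$, is in bijection with domino tilings of the Aztec diamond of size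 $kN$; that top part does not depend on $n$.) Determinantal property: write $u=2(\xi+n)+i$ with $i\in\{0,1\}$, and say there is a point at $(m,2\xi+i)$ if there is a point of the process at $(m,u)$. A correlation kernel is a function $K$ such that for distinct positions \[ \mathbb P\big(\text{points at }(m_1,2\xi_1+i_1),\dots,(m_d,2\xi_d+i_d)\big)=\det\big(K(m_j,2\xi_j+i_j;m_\ell,2\xi_\ell+i_\ell)\big)_{j,\ell=1}^d . \] In $[\,\cdot\,]_{i,j=0}^1$, $i$ is the row index and $j$ the column index. Matrix symbol (ordered product, $m=1$ leftmost): \[ \Phi(z)=\frac1{(1-z^{-1})^k}\prod_{m=1}^k\begin{pmatrix}\gamma_m&\alpha_m z^{-1}\\ \alpha_m^{-1}&\gamma_m^{-1}\end{pmatrix}\begin{pmatrix}1&\beta_m z^{-1}\\ \beta_m^{-1}&1\end{pmatrix}. \] $\rho_1(z),\rho_2(z)$ are the eigenvalues of $\Phi(z)$, determined for $z\in\mathbb C\setminus(-\infty,0]$ by $|\rho_2(z)|<|\rho_1(z)|$ and by continuity from the upper half plane for $z\in(-\infty,0]$. $E(z)$ is a matrix with $\Phi(z)=E(z)\,\mathrm{diag}(\rho_1(z),\rho_2(z))\,E(z)^{-1}$, which exists for all but finitely many $z$. $\mathbf 1_B$ is the indicator of $B$.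
   Formalization: The kernel block is read as [K(2km,2ξ+j; 2km',2ξ'+i)] with row i and column j, i.e. the parities i and j in the two arguments are interchanged; with the indexing as printed the formula is false (e.g. k=1, N=4, all weights 1, m=m'=1). *)

theory Defs
  imports
    "HOL-Complex_Analysis.Complex_Analysis"
    "HOL-Probability.Probability_Measure"
    "Jordan_Normal_Form.Gauss_Jordan_Elimination"
    "Jordan_Normal_Form.Char_Poly"
begin

abbreviation mat2 :: "complex \<Rightarrow> complex \<Rightarrow> complex \<Rightarrow> complex \<Rightarrow> complex mat" where
  "mat2 a b c d \<equiv> mat_of_rows_list 2 [[a, b], [c, d]]"

definition mat_inv :: "complex mat \<Rightarrow> complex mat" where
  "mat_inv A = the (mat_inverse A)"

definition mat_powi :: "complex mat \<Rightarrow> int \<Rightarrow> complex mat" where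
  "mat_powi A j = (if 0 \<le> j then A ^\<^sub>m nat j else mat_inv A ^\<^sub>m nat (- j))"

definition contour_integral_mat2 :: "(real \<Rightarrow> complex) \<Rightarrow> (complex \<Rightarrow> complex mat) \<Rightarrow> complex mat" where
  "contour_integral_mat2 g F = Matrix.mat 2 2 (\<lambda>(i, j). contour_integral g (\<lambda>z. F z $$ (i, j)))"

definition pos_simple_loop :: "(real \<Rightarrow> complex) \<Rightarrow> bool" where
  "pos_simple_loop g \<longleftrightarrow> valid_path g \<and> simple_path g \<and> pathfinish g = pathstart g \<and>
     (\<forall>z \<in> inside (path_image g). winding_number g z = 1)"


section \<open>Symbols\<close>

text \<open>The \<open>k\<close>-periodic extension to indices \<open>m \<ge> 1\<close> of weights given for \<open>m = 1, \<dots>, k\<close>.\<close>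

definition periodic_ext :: "nat \<Rightarrow> (nat \<Rightarrow> real) \<Rightarrow> nat \<Rightarrow> real" where
  "periodic_ext k a m = a ((m - 1) mod k + 1)"

definition bernoulli_mat :: "real \<Rightarrow> real \<Rightarrow> complex \<Rightarrow> complex mat" where
  "bernoulli_mat a c z = mat2 (of_real c) (of_real a / z) (1 / of_real a) (1 / of_real c)"

definition geometric_mat :: "real \<Rightarrow> complex \<Rightarrow> complex mat" where
  "geometric_mat b z = mat2 1 (of_real b / z) (1 / of_real b) 1"

definition step_symbol ::
  "nat \<Rightarrow> (nat \<Rightarrow> real) \<Rightarrow> (nat \<Rightarrow> real) \<Rightarrow> (nat \<Rightarrow> real) \<Rightarrow> nat \<Rightarrow> complex \<Rightarrow> complex mat" where
  "step_symbol k \<alpha> \<beta> \<gamma> p z =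
     (let m = (p + 1) div 2 in
      if odd p then bernoulli_mat (periodic_ext k \<alpha> m) (periodic_ext k \<gamma> m) z
      else (1 / (1 - 1 / z)) \<cdot>\<^sub>m geometric_mat (periodic_ext k \<beta> m) z)"

definition Phi ::
  "nat \<Rightarrow> (nat \<Rightarrow> real) \<Rightarrow> (nat \<Rightarrow> real) \<Rightarrow> (nat \<Rightarrow> real) \<Rightarrow> complex \<Rightarrow> complex mat" where
  "Phi k \<alpha> \<beta> \<gamma> z = (1 / (1 - 1 / z) ^ k) \<cdot>\<^sub>m
     foldr (*) (map (\<lambda>m. bernoulli_mat (\<alpha> m) (\<gamma> m) z * geometric_mat (\<beta> m) z) [1..<Suc k]) (1\<^sub>m 2)"

text \<open>
  \<open>F\<close> has poles at \<open>0\<close> and \<open>1\<close>, which are therefore excluded. On the cut \<open>z < 0\<close> the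
  labelling is fixed by the boundary values from the upper half plane.
\<close>

definition eigenvalue_branches ::
  "(complex \<Rightarrow> complex mat) \<Rightarrow> (complex \<Rightarrow> complex) \<Rightarrow> (complex \<Rightarrow> complex) \<Rightarrow> bool" where
  "eigenvalue_branches F \<rho>1 \<rho>2 \<longleftrightarrow>
     (\<forall>z. z \<notin> {0, 1} \<longrightarrow> char_poly (F z) = [:- \<rho>1 z, 1:] * [:- \<rho>2 z, 1:]) \<and>
     (\<forall>z. z \<notin> \<real>\<^sub>\<le>\<^sub>0 \<and> z \<noteq> 1 \<longrightarrow> cmod (\<rho>2 z) < cmod (\<rho>1 z)) \<and>
     (\<forall>x::real. x < 0 \<longrightarrow>
        (\<rho>1 \<longlongrightarrow> \<rho>1 (of_real x)) (at (of_real x) within {z. Im z > 0}) \<and>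
        (\<rho>2 \<longlongrightarrow> \<rho>2 (of_real x)) (at (of_real x) within {z. Im z > 0}))"

definition eigenvector_matrix ::
  "(complex \<Rightarrow> complex mat) \<Rightarrow> (complex \<Rightarrow> complex) \<Rightarrow> (complex \<Rightarrow> complex) \<Rightarrow> (complex \<Rightarrow> complex mat) \<Rightarrow> bool"
  where
  "eigenvector_matrix F \<rho>1 \<rho>2 E \<longleftrightarrow>
     finite {z. \<not> similar_mat_wit (F z) (mat2 (\<rho>1 z) 0 0 (\<rho>2 z)) (E z) (mat_inv (E z))}"


section \<open>The point process\<close>

text \<open>
  The block Toeplitz matrix entry at \<open>u = 2x + r\<close>, \<open>v = 2y + s\<close> is the coefficient of
  \<open>z\<^bsup>y - x\<^esup>\<close> in the expansion at infinity, i.e. of \<open>t\<^bsup>x - y\<^esup>\<close> in the expansion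
  at \<open>0\<close> in the variable \<open>t = 1/z\<close>.
\<close>

definition transition ::
  "nat \<Rightarrow> (nat \<Rightarrow> real) \<Rightarrow> (nat \<Rightarrow> real) \<Rightarrow> (nat \<Rightarrow> real) \<Rightarrow> nat \<Rightarrow> int \<Rightarrow> int \<Rightarrow> complex" where
  "transition k \<alpha> \<beta> \<gamma> p u v =
     fls_nth (laurent_expansion
       (\<lambda>t. step_symbol k \<alpha> \<beta> \<gamma> p (1 / t) $$ (nat (u mod 2), nat (v mod 2))) 0)
       (u div 2 - v div 2)"

text \<open>
  A collection of points is represented by its increasing enumeration on every level; the product
  of determinants below is invariant under relabelling at the inner levels and vanishes if two
  points of a level coincide.
\<close>

definition configurations :: "nat \<Rightarrow> nat \<Rightarrow> nat \<Rightarrow> (nat \<Rightarrow> nat \<Rightarrow> int) set" where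
  "configurations k N n =
     {u \<in> {0..2*k*N} \<rightarrow>\<^sub>E ({1..2*n} \<rightarrow>\<^sub>E UNIV).
        (\<forall>p \<in> {0..2*k*N}. strict_mono_on {1..2*n} (u p)) \<and>
        (\<forall>j \<in> {1..2*n}. u 0 j = int j - 1 \<and> u (2*k*N) j = - int (k*N) + int j - 1)}"

definition config_weight ::
  "nat \<Rightarrow> (nat \<Rightarrow> real) \<Rightarrow> (nat \<Rightarrow> real) \<Rightarrow> (nat \<Rightarrow> real) \<Rightarrow> nat \<Rightarrow> nat \<Rightarrow> (nat \<Rightarrow> nat \<Rightarrow> int) \<Rightarrow> complex"
  where
  "config_weight k \<alpha> \<beta> \<gamma> N n u =
     (\<Prod>p = 1..2*k*N. Determinant.det (Matrix.mat (2*n) (2*n)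
        (\<lambda>(j, l). transition k \<alpha> \<beta> \<gamma> p (u (p - 1) (j + 1)) (u p (l + 1)))))"

text \<open>Only finitely many configurations have nonzero weight, since all steps go downwards.\<close>

definition partition_function ::
  "nat \<Rightarrow> (nat \<Rightarrow> real) \<Rightarrow> (nat \<Rightarrow> real) \<Rightarrow> (nat \<Rightarrow> real) \<Rightarrow> nat \<Rightarrow> nat \<Rightarrow> complex" where
  "partition_function k \<alpha> \<beta> \<gamma> N n =
     (\<Sum>\<^sub>\<infinity>u \<in> configurations k N n. config_weight k \<alpha> \<beta> \<gamma> N n u)"

text \<open>The weights are real (and nonnegative); the real part only converts the type.\<close>

definition aztec_process ::
  "nat \<Rightarrow> (nat \<Rightarrow> real) \<Rightarrow> (nat \<Rightarrow> real) \<Rightarrow> (nat \<Rightarrow> real) \<Rightarrow> nat \<Rightarrow> nat \<Rightarrow> (nat \<Rightarrow> nat \<Rightarrow> int) measure"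
  where
  "aztec_process k \<alpha> \<beta> \<gamma> N n =
     density (count_space (configurations k N n))
       (\<lambda>u. ennreal (Re (config_weight k \<alpha> \<beta> \<gamma> N n u / partition_function k \<alpha> \<beta> \<gamma> N n)))"

text \<open>The points in the shifted coordinate \<open>x = 2\<xi> + i\<close>, where \<open>u = 2(\<xi> + n) + i = x + 2n\<close>.\<close>

definition shifted_points :: "nat \<Rightarrow> nat \<Rightarrow> nat \<Rightarrow> (nat \<Rightarrow> nat \<Rightarrow> int) \<Rightarrow> (nat \<times> int) set" where
  "shifted_points k N n u = {(p, x). p \<le> 2*k*N \<and> (\<exists>j \<in> {1..2*n}. u p j = x + 2 * int n)}"

definition correlation_kernel ::
  "'c measure \<Rightarrow> ('c \<Rightarrow> 'p set) \<Rightarrow> 'p set \<Rightarrow> ('p \<Rightarrow> 'p \<Rightarrow> complex) \<Rightarrow> bool" where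
  "correlation_kernel M pts X K \<longleftrightarrow>
     (\<forall>ps. distinct ps \<and> set ps \<subseteq> X \<longrightarrow>
        complex_of_real (measure M {\<omega> \<in> space M. set ps \<subseteq> pts \<omega>}) =
        Determinant.det (Matrix.mat (length ps) (length ps) (\<lambda>(a, b). K (ps ! a) (ps ! b))))"

text \<open>
  The row index \<open>i\<close> is the parity of the second position and the column index \<open>j\<close> that of the
  first: the first term of the kernel is minus the transition matrix from \<open>(p', 2\<xi>' + i)\<close> to
  \<open>(p, 2\<xi> + j)\<close>, whose rows are indexed by the starting point.
\<close>

definition kernel_block ::
  "(nat \<times> int \<Rightarrow> nat \<times> int \<Rightarrow> complex) \<Rightarrow> nat \<Rightarrow> int \<Rightarrow> nat \<Rightarrow> int \<Rightarrow> complex mat" where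
  "kernel_block K p \<xi> p' \<xi>' =
     Matrix.mat 2 2 (\<lambda>(i, j). K (p, 2 * \<xi> + int j) (p', 2 * \<xi>' + int i))"

end

theory Submission
  imports Defs "HOL-Real_Asymp.Real_Asymp"
begin

text \<open>
  The process is a weighted ensemble of nonintersecting paths, so the Eynard--Mehta theorem gives
  the kernel \<open>\<delta> - U + \<Sum> U G\<^sup>-\<^sup>1 U\<close> with \<open>U\<close> the propagator and \<open>G\<close> its restriction to start and end
  points; here \<open>G\<close> is a finite block Toeplitz matrix with symbol \<open>z\<^bsup>kN/2\<^esup> \<Phi>(z)\<^sup>N\<close>. Since all steps go
  down and \<open>\<xi>' \<ge> -kN/2\<close> lies above the end points, only one row \<open>x\<close> with \<open>x G = b\<close> is needed for each \<open>\<xi>'\<close>.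
  With \<open>t = 1/z\<close>, \<open>L = kN/2\<close> and \<open>\<pi>\<close> the spectral projection for \<open>\<rho>\<^sub>1\<close>, it is
  \<open>x = g (1 - t)\<^sup>L \<Phi>\<^bsup>-N/2\<^esup>\<close>, where \<open>g\<close> is the principal part at \<open>1\<close> of
  \<open>w\<^bsup>\<xi>'\<^esup> (1 - 1/w)\<^bsup>-L\<^esup> \<rho>\<^sub>1\<^bsup>N/2 - m'\<^esup> \<pi>\<close>. Because \<open>det \<Phi> = 1\<close>, the factors \<open>(1 - t)\<^sup>L \<Phi>\<^bsup>\<plusminus>N/2\<^esup>\<close> are
  polynomials in \<open>t\<close> of degree at most \<open>L\<close>, and \<open>\<rho>\<^sub>2\<^sup>q \<pi>\<close>, \<open>\<rho>\<^sub>2\<^sup>q (1 - \<pi>)\<close> have removable singularities at \<open>1\<close>;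
  by Cauchy's theorem, \<open>x\<close> is then a polynomial of degree at most \<open>L\<close> and solves the system.
  Expanding the \<open>z\<close>-integral of the statement at infinity identifies it with \<open>x \<Phi>\<^sup>m\<close>.
\<close>


section \<open>Determinants over index lists\<close>

text \<open>The determinantal structure is derived from gap probabilities. Forbidding a point
  changes the propagator by a rank-one term, which is one step of Gaussian elimination, so the
  probability of avoiding a finite set is a Schur complement; correlations follow by
  inclusion-exclusion. The inverse of \<open>G\<close> is only known to exist. This needs
  \<open>Z\<close> nonzero, which is why the step determinants are shown to be nonnegative and one
  configuration of nonzero weight is exhibited. The state space is infinite, but nonzero weights
  live in the window \<open>S\<close>, whose ends are even; since all steps go down, products of
  block Toeplitz matrices cut to such a window are exact. The algebra therefore takes place with
  formal power series in \<open>t\<close>, and analysis only evaluates coefficients: over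
  \<open>c01\<close> they are read off at infinity, over \<open>c1\<close> they vanish when the
  integrand is bounded at 1. For this \<open>c1\<close> has to lie in the plane slit along the
  nonpositive axis, where \<rho>1 and \<rho>2 are holomorphic; this is what the two real crossings
  give. The row has degrees 1 to \<open>L\<close> and fits into the \<open>n\<close> blocks of start
  points since \<open>n \<ge> L\<close>.\<close>

definition det_on :: "'i list \<Rightarrow> 'j list \<Rightarrow> ('i \<Rightarrow> 'j \<Rightarrow> 'a) \<Rightarrow> 'a :: comm_ring_1" where
  "det_on rs cs A =
     Determinant.det (Matrix.mat (length rs) (length cs) (\<lambda>(a, b). A (rs ! a) (cs ! b)))"

lemma det_on_transpose:
  assumes "length rs = length cs"
  shows "det_on cs rs (\<lambda>x y. A y x) = det_on rs cs A"
proof -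
  have "Matrix.mat (length cs) (length rs) (\<lambda>(a, b). A (rs ! b) (cs ! a)) =
     Matrix.transpose_mat (Matrix.mat (length rs) (length cs) (\<lambda>(a, b). A (rs ! a) (cs ! b)))"
    by (intro eq_matI) auto
  then show ?thesis
    unfolding det_on_def using assms
    by (simp add: Determinant.det_transpose[of _ "length cs"])
qed

lemma det_on_cong:
  assumes "\<And>x y. x \<in> set rs \<Longrightarrow> y \<in> set cs \<Longrightarrow> A x y = B x y"
  shows "det_on rs cs A = det_on rs cs B"
  unfolding det_on_def using assms by (intro arg_cong[where f = Determinant.det] eq_matI) auto

text \<open>One step of Gaussian elimination. The matrix factors into a unit lower block triangular
  matrix carrying the pivot column and an upper block triangular one whose corner block is the Schur
  complement, so the pivot 1 contributes nothing to the determinant.\<close>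

lemma det_on_pivot:
  fixes A :: "'i \<Rightarrow> 'j \<Rightarrow> 'a :: field"
  assumes len: "length rs = length cs" and piv: "A c c' = 1"
  shows "det_on (c # rs) (c' # cs) A = det_on rs cs (\<lambda>x y. A x y - A x c' * A c y)"
proof -
  define n where "n = length rs"
  have lc: "length cs = n" "length rs = n" using len by (auto simp: n_def)
  define R where "R = Matrix.mat 1 n (\<lambda>(i, b). A c (cs ! b))"
  define C where "C = Matrix.mat n 1 (\<lambda>(a, j). A (rs ! a) c')"
  define B where "B = Matrix.mat n n (\<lambda>(a, b). A (rs ! a) (cs ! b) - A (rs ! a) c' * A c (cs ! b))"
  let ?X = "four_block_mat (1\<^sub>m 1) (0\<^sub>m 1 n) C (1\<^sub>m n)"
  let ?Y = "four_block_mat (1\<^sub>m 1) R (0\<^sub>m n 1) B"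
  have carr: "R \<in> carrier_mat 1 n" "C \<in> carrier_mat n 1" "B \<in> carrier_mat n n"
    by (auto simp: R_def C_def B_def)
  have "Matrix.mat (Suc n) (Suc n) (\<lambda>(a, b). A ((c # rs) ! a) ((c' # cs) ! b)) =
      four_block_mat (1\<^sub>m 1) R C (C * R + B)"
    using piv by (intro eq_matI)
      (auto simp: R_def C_def B_def lc nth_Cons' scalar_prod_def four_block_mat_def)
  also have "\<dots> = ?X * ?Y"
  proof -
    have e: "?X * ?Y = four_block_mat (1\<^sub>m 1 * 1\<^sub>m 1 + 0\<^sub>m 1 n * 0\<^sub>m n 1) (1\<^sub>m 1 * R + 0\<^sub>m 1 n * B) (C * 1\<^sub>m 1 + 1\<^sub>m n * 0\<^sub>m n 1) (C * R + 1\<^sub>m n * B)"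
      by (rule mult_four_block_mat[OF one_carrier_mat zero_carrier_mat carr(2) one_carrier_mat
        one_carrier_mat carr(1) zero_carrier_mat carr(3)])
    show ?thesis unfolding e using carr by simp
  qed
  finally have eq: "Matrix.mat (Suc n) (Suc n) (\<lambda>(a, b). A ((c # rs) ! a) ((c' # cs) ! b)) = ?X * ?Y" .
  have 1: "det_on (c # rs) (c' # cs) A = Determinant.det (?X * ?Y)"
    using eq by (simp add: det_on_def lc)
  have 2: "Determinant.det (?X * ?Y) = Determinant.det ?X * Determinant.det ?Y"
    using carr by (intro Determinant.det_mult[of _ "1 + n"] four_block_carrier_mat) auto
  have 3: "Determinant.det ?X = 1"
    using carr by (subst det_four_block_mat_upper_right_zero[of _ 1 _ n]) auto
  have 4: "Determinant.det ?Y = Determinant.det B"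
    using carr by (subst det_four_block_mat_lower_left_zero[of _ 1 _ n]) auto
  have 5: "det_on rs cs (\<lambda>x y. A x y - A x c' * A c y) = Determinant.det B"
    by (simp add: det_on_def B_def lc)
  show ?thesis unfolding 1 2 3 4 5 by (rule mult_1_left)
qed

text \<open>Schur complement with respect to the trailing block, whose inverse is \<open>H\<close>.
  The labels in \<open>rs'\<close> and \<open>cs'\<close> will be the start and end points, so the
  factor \<open>det_on rs' cs' A\<close> becomes the partition function.\<close>

lemma det_on_append_schur:
  fixes A :: "'i \<Rightarrow> 'j \<Rightarrow> 'a :: field"
  assumes len: "length rs = length cs" "length rs' = r" "length cs' = r"
    and H: "\<And>a b. a < r \<Longrightarrow> b < r \<Longrightarrow> (\<Sum>l<r. A (rs' ! a) (cs' ! l) * H l b) = (if a = b then 1 else 0)"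
    and H': "\<And>a b. a < r \<Longrightarrow> b < r \<Longrightarrow> (\<Sum>l<r. H a l * A (rs' ! l) (cs' ! b)) = (if a = b then 1 else 0)"
  shows "det_on (rs @ rs') (cs @ cs') A = det_on rs' cs' A *
    det_on rs cs (\<lambda>x y. A x y - (\<Sum>l<r. \<Sum>j<r. A x (cs' ! l) * H l j * A (rs' ! j) y))"
proof -
  define n where "n = length rs"
  have lc: "length cs = n" "length rs = n" using len by (auto simp: n_def)
  define S where "S = Matrix.mat n n (\<lambda>(a, b). A (rs ! a) (cs ! b) -
     (\<Sum>l<r. \<Sum>j<r. A (rs ! a) (cs' ! l) * H l j * A (rs' ! j) (cs ! b)))"
  define P where "P = Matrix.mat n r (\<lambda>(a, b). A (rs ! a) (cs' ! b))"
  define G where "G = Matrix.mat r r (\<lambda>(a, b). A (rs' ! a) (cs' ! b))"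
  define Q where "Q = Matrix.mat r n (\<lambda>(a, b). \<Sum>j<r. H a j * A (rs' ! j) (cs ! b))"
  have carr: "S \<in> carrier_mat n n" "P \<in> carrier_mat n r" "G \<in> carrier_mat r r" "Q \<in> carrier_mat r n"
    by (auto simp: S_def P_def G_def Q_def)
  let ?X = "four_block_mat S P (0\<^sub>m r n) G"
  let ?Y = "four_block_mat (1\<^sub>m n) (0\<^sub>m n r) Q (1\<^sub>m r)"
  have PQ: "(P * Q) $$ (a, b) = (\<Sum>l<r. \<Sum>j<r. A (rs ! a) (cs' ! l) * H l j * A (rs' ! j) (cs ! b))"
    if "a < n" "b < n" for a b
    using that by (simp add: P_def Q_def scalar_prod_def sum_distrib_left mult.assoc atLeast0LessThan)
  have GQ: "(G * Q) $$ (a, b) = A (rs' ! a) (cs ! b)" if "a < r" "b < n" for a b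
  proof -
    have "(G * Q) $$ (a, b) = (\<Sum>l<r. A (rs' ! a) (cs' ! l) * (\<Sum>j<r. H l j * A (rs' ! j) (cs ! b)))"
      using that by (simp add: G_def Q_def scalar_prod_def atLeast0LessThan)
    also have "\<dots> = (\<Sum>j<r. (\<Sum>l<r. A (rs' ! a) (cs' ! l) * H l j) * A (rs' ! j) (cs ! b))"
      unfolding sum_distrib_left sum_distrib_right by (subst sum.swap) (simp add: mult.assoc)
    also have "\<dots> = (\<Sum>j<r. if a = j then A (rs' ! j) (cs ! b) else 0)"
      using that by (intro sum.cong) (auto simp: H)
    finally show ?thesis using that by simp
  qed
  have "Matrix.mat (n + r) (n + r) (\<lambda>(a, b). A ((rs @ rs') ! a) ((cs @ cs') ! b)) =
      four_block_mat (S + P * Q) P (G * Q) G"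
    using carr PQ GQ by (intro eq_matI)
      (auto simp: four_block_mat_def nth_append lc simp del: index_mult_mat(1), auto simp: P_def G_def S_def)
  also have "\<dots> = ?X * ?Y"
  proof -
    have e: "?X * ?Y = four_block_mat (S * 1\<^sub>m n + P * Q) (S * 0\<^sub>m n r + P * 1\<^sub>m r)
        (0\<^sub>m r n * 1\<^sub>m n + G * Q) (0\<^sub>m r n * 0\<^sub>m n r + G * 1\<^sub>m r)"
      by (rule mult_four_block_mat[OF carr(1,2) zero_carrier_mat carr(3)
        one_carrier_mat zero_carrier_mat carr(4) one_carrier_mat])
    show ?thesis unfolding e using carr by simp
  qed
  finally have eq: "Matrix.mat (n + r) (n + r) (\<lambda>(a, b). A ((rs @ rs') ! a) ((cs @ cs') ! b)) = ?X * ?Y" .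
  have 1: "det_on (rs @ rs') (cs @ cs') A = Determinant.det (?X * ?Y)"
    using eq by (simp add: det_on_def lc len)
  have 2: "Determinant.det (?X * ?Y) = Determinant.det ?X * Determinant.det ?Y"
    using carr by (intro Determinant.det_mult[of _ "n + r"] four_block_carrier_mat) auto
  have 3: "Determinant.det ?Y = 1"
    using carr by (subst det_four_block_mat_upper_right_zero[of _ n _ r]) auto
  have 4: "Determinant.det ?X = Determinant.det S * Determinant.det G"
    using carr by (subst det_four_block_mat_lower_left_zero[of _ n _ r]) auto
  have 5: "det_on rs cs (\<lambda>x y. A x y - (\<Sum>l<r. \<Sum>j<r. A x (cs' ! l) * H l j * A (rs' ! j) y)) = Determinant.det S"
    by (simp add: det_on_def S_def lc)
  have 6: "det_on rs' cs' A = Determinant.det G"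
    by (simp add: det_on_def G_def len)
  show ?thesis unfolding 1 2 3 4 5 6 by (simp add: mult.commute)
qed

text \<open>Expanding both determinants along row \<open>b\<close> uses the same cofactors, because
  all other rows agree, and the two rows \<open>b\<close> add up to a unit row. Only one principal
  minor is left. This is the determinant form of the alternative between a present and an absent
  point.\<close>

lemma det_on_complement_row:
  fixes A :: "'i \<Rightarrow> 'i \<Rightarrow> 'a :: comm_ring_1"
  assumes dist: "distinct (xs @ b # ys)"
    and rows: "\<And>x y. x \<noteq> b \<Longrightarrow> A x y = A' x y"
    and rowb: "\<And>y. A b y = (if y = b then 1 else 0) - A' b y"
  shows "det_on (xs @ b # ys) (xs @ b # ys) A =
    det_on (xs @ ys) (xs @ ys) A - det_on (xs @ b # ys) (xs @ b # ys) A'"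
proof -
  define zs where "zs = xs @ b # ys"
  define n where "n = length zs"
  define i where "i = length xs"
  have i: "i < n" "zs ! i = b" by (auto simp: i_def n_def zs_def)
  have inj: "zs ! a = b \<longleftrightarrow> a = i" if "a < n" for a
    using that i dist nth_eq_iff_index_eq[of zs a i] by (auto simp: zs_def[symmetric] n_def)
  define mm where "mm F = Matrix.mat n n (\<lambda>(a, c). F (zs ! a) (zs ! c))" for F :: "'i \<Rightarrow> 'i \<Rightarrow> 'a"
  have dm: "det_on zs zs F = Determinant.det (mm F)" for F by (simp add: det_on_def mm_def n_def)
  have carr: "mm F \<in> carrier_mat n n" for F by (simp add: mm_def)
  have del: "mat_delete (mm A) i c = mat_delete (mm A') i c" for c
    using i inj by (intro eq_matI) (auto simp: mat_delete_def mm_def rows)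
  have cof: "cofactor (mm A) i c = cofactor (mm A') i c" for c
    by (simp add: cofactor_def del)
  have row: "mm A $$ (i, c) + mm A' $$ (i, c) = (if c = i then 1 else 0)" if "c < n" for c
    using that i(1) inj[OF that] by (simp add: mm_def i(2) rowb)
  have "Determinant.det (mm A) + Determinant.det (mm A') =
      (\<Sum>c<n. (mm A $$ (i, c) + mm A' $$ (i, c)) * cofactor (mm A) i c)"
    by (simp add: laplace_expansion_row[OF carr i(1)] cof sum.distrib algebra_simps)
  also have "\<dots> = (\<Sum>c<n. if c = i then cofactor (mm A) i c else 0)"
    using i by (intro sum.cong) (auto simp: row)
  also have "\<dots> = cofactor (mm A) i i" using i by simp
  also have "\<dots> = Determinant.det (mat_delete (mm A) i i)" by (simp add: cofactor_def)
  also have "mat_delete (mm A) i i =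
      Matrix.mat (length (xs @ ys)) (length (xs @ ys)) (\<lambda>(a, c). A ((xs @ ys) ! a) ((xs @ ys) ! c))"
    by (intro eq_matI) (auto simp: mat_delete_def mm_def n_def zs_def i_def nth_append nth_Cons')
  finally have "Determinant.det (mm A) + Determinant.det (mm A') = det_on (xs @ ys) (xs @ ys) A"
    by (simp add: det_on_def)
  then show ?thesis unfolding zs_def[symmetric] dm by (simp add: algebra_simps)
qed

section \<open>The Cauchy--Binet formula\<close>

text \<open>A set of \<open>r\<close> elements of \<open>S\<close> is represented by its increasing
  enumeration; extensionality makes the representation unique, so sums over
  \<open>incr_maps r S\<close> are sums over \<open>r\<close>-subsets.\<close>

definition incr_maps :: "nat \<Rightarrow> 'b set \<Rightarrow> (nat \<Rightarrow> 'b :: linorder) set" where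
  "incr_maps r S = {u \<in> {1..r} \<rightarrow>\<^sub>E S. strict_mono_on {1..r} u}"

lemma finite_incr_maps: "finite S \<Longrightarrow> finite (incr_maps r S)"
  unfolding incr_maps_def by (rule finite_subset[OF _ finite_PiE[of "{1..r}" "\<lambda>_. S"]]) auto

lemma strict_mono_on_image_eq:
  fixes u v :: "nat \<Rightarrow> 'b :: linorder"
  assumes "strict_mono_on {1..r} u" "strict_mono_on {1..r} v" "u ` {1..r} = v ` {1..r}" "i \<in> {1..r}"
  shows "u i = v i"
proof -
  have *: "sorted_wrt (<) (map w [1..<Suc r])" if "strict_mono_on {1..r} w" for w :: "nat \<Rightarrow> 'b"
    unfolding sorted_wrt_map by (rule sorted_wrt_mono_rel[OF _ sorted_wrt_upt[of 1 "Suc r"]])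
      (use that in \<open>auto simp: strict_mono_on_def\<close>)
  have st: "set (map w [1..<Suc r]) = w ` {1..r}" for w :: "nat \<Rightarrow> 'b"
    by (simp only: set_map set_upt atLeastLessThanSuc_atLeastAtMost)
  have "map u [1..<Suc r] = map v [1..<Suc r]"
    by (rule strict_sorted_equal[OF *[OF assms(2)] *[OF assms(1)]]) (simp only: st assms(3))
  then show ?thesis using assms(4) by (simp only: map_eq_conv set_upt) auto
qed

text \<open>An injective choice of \<open>r\<close> elements is its sorted range together with the
  order in which the elements are taken. \<open>Suc\<close> reconciles enumerations starting at 1
  with matrix indices starting at 0.\<close>

lemma incr_maps_perm_bij:
  fixes S :: "'b :: linorder set"
  assumes "finite S"
  shows "bij_betw (\<lambda>(u, \<sigma>). \<lambda>j\<in>{0..<r}. u (Suc (\<sigma> j)))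
     (incr_maps r S \<times> {\<sigma>. \<sigma> permutes {0..<r}}) {f \<in> {0..<r} \<rightarrow>\<^sub>E S. inj_on f {0..<r}}"
    (is "bij_betw ?h ?D ?R")
proof (rule bij_betw_imageI)
  have im: "(\<lambda>j. u (Suc (\<sigma> j))) ` {0..<r} = u ` {1..r}" if "\<sigma> permutes {0..<r}" for u \<sigma>
  proof -
    have "(\<lambda>j. u (Suc (\<sigma> j))) ` {0..<r} = u ` Suc ` (\<sigma> ` {0..<r})" by (simp add: image_image)
    also have "\<dots> = u ` {1..r}"
      by (simp add: permutes_image[OF that] image_Suc_atLeastLessThan atLeastLessThanSuc_atLeastAtMost)
    finally show ?thesis .
  qed
  have inj1: "inj_on u {1..r}" if "u \<in> incr_maps r S" for u
    using that by (auto simp: incr_maps_def intro: strict_mono_on_imp_inj_on)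
  have lt: "Suc (\<sigma> j) \<in> {1..r}" if "\<sigma> permutes {0..<r}" "j < r" for \<sigma> j
    using permutes_in_image[OF that(1), of j] that(2) by auto
  show "inj_on ?h ?D"
  proof (rule inj_onI, clarsimp)
    fix u \<sigma> v \<tau>
    assume u: "u \<in> incr_maps r S" and v: "v \<in> incr_maps r S"
      and p: "\<sigma> permutes {0..<r}" "\<tau> permutes {0..<r}"
      and eq: "(\<lambda>j\<in>{0..<r}. u (Suc (\<sigma> j))) = (\<lambda>j\<in>{0..<r}. v (Suc (\<tau> j)))"
    have eqj: "u (Suc (\<sigma> j)) = v (Suc (\<tau> j))" if "j < r" for j
      using fun_cong[OF eq, of j] that by simp
    have ii: "u ` {1..r} = v ` {1..r}"
      using im[OF p(1), of u] im[OF p(2), of v] eqj by (metis (no_types, lifting) atLeastLessThan_iff image_cong)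
    have "u = v"
    proof
      fix i show "u i = v i"
        using strict_mono_on_image_eq[OF _ _ ii, of i] u v
        by (cases "i \<in> {1..r}") (auto simp: incr_maps_def PiE_def extensional_def)
    qed
    moreover have "\<sigma> = \<tau>"
    proof
      fix j show "\<sigma> j = \<tau> j"
      proof (cases "j < r")
        case True
        then show ?thesis using eqj[OF True] inj_onD[OF inj1[OF u], of "Suc (\<sigma> j)" "Suc (\<tau> j)"]
          lt[OF p(1) True] lt[OF p(2) True] \<open>u = v\<close> by auto
      next
        case False
        then show ?thesis using p by (auto simp: permutes_def)
      qed
    qed
    ultimately show "u = v \<and> \<sigma> = \<tau>" by simp
  qed
  show "?h ` ?D = ?R"
  proof (intro equalityI subsetI)
    fix f assume "f \<in> ?h ` ?D"
    then obtain u \<sigma> where u: "u \<in> incr_maps r S" and p: "\<sigma> permutes {0..<r}"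
      and f: "f = (\<lambda>j\<in>{0..<r}. u (Suc (\<sigma> j)))" by auto
    have "f \<in> {0..<r} \<rightarrow>\<^sub>E S"
      using u lt[OF p] by (auto simp: f incr_maps_def)
    moreover have "inj_on f {0..<r}"
    proof (rule inj_onI)
      fix i j assume ij: "i \<in> {0..<r}" "j \<in> {0..<r}" "f i = f j"
      then have "Suc (\<sigma> i) = Suc (\<sigma> j)"
        using inj_onD[OF inj1[OF u], of "Suc (\<sigma> i)" "Suc (\<sigma> j)"] lt[OF p] by (auto simp: f)
      then show "i = j" using permutes_inj[OF p] by (auto dest: injD)
    qed
    ultimately show "f \<in> ?R" by simp
  next
    fix f assume f: "f \<in> ?R"
    define xs where "xs = sorted_list_of_set (f ` {0..<r})"
    have len: "length xs = r" using f by (simp add: xs_def card_image)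
    have setxs: "set xs = f ` {0..<r}" by (simp add: xs_def)
    define u where "u = (\<lambda>i\<in>{1..r}. xs ! (i - 1))"
    have sm: "strict_mono_on {1..r} u"
    proof (rule strict_mono_onI)
      fix i j assume "i \<in> {1..r}" "j \<in> {1..r}" "i < j"
      then show "u i < u j"
        using sorted_wrt_nth_less[of "(<)" xs "i - 1" "j - 1"] len by (auto simp: u_def xs_def)
    qed
    have uim: "u ` {1..r} = f ` {0..<r}"
    proof -
      have "u ` {1..r} = u ` Suc ` {0..<r}"
        by (simp only: image_Suc_atLeastLessThan One_nat_def atLeastLessThanSuc_atLeastAtMost)
      also have "\<dots> = (\<lambda>i. xs ! i) ` {0..<r}"
        unfolding image_image by (rule image_cong) (auto simp: u_def)
      also have "\<dots> = set xs" using nth_image[of r xs] len by simp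
      finally show ?thesis using setxs by simp
    qed
    have uS: "u \<in> incr_maps r S"
    proof -
      have "u i \<in> S" if "i \<in> {1..r}" for i
      proof -
        have "u i \<in> f ` {0..<r}" using imageI[OF that, of u] by (simp only: uim)
        then show ?thesis using f by auto
      qed
      moreover have "u \<in> extensional {1..r}" by (simp add: u_def)
      ultimately show ?thesis using sm by (auto simp: incr_maps_def PiE_def)
    qed
    have bu: "bij_betw u {1..r} (f ` {0..<r})"
      using inj1[OF uS] uim by (simp add: bij_betw_def)
    define g where "g j = inv_into {1..r} u (f j) - 1" for j
    have g: "g j < r" "u (Suc (g j)) = f j" if "j < r" for j
    proof -
      have "f j \<in> u ` {1..r}" using uim that by auto
      then have *: "inv_into {1..r} u (f j) \<in> {1..r}" "u (inv_into {1..r} u (f j)) = f j"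
        by (auto intro: inv_into_into f_inv_into_f simp del: atLeastAtMost_iff)
      then show "g j < r" "u (Suc (g j)) = f j" by (auto simp: g_def)
    qed
    define \<sigma> where "\<sigma> j = (if j < r then g j else j)" for j
    have "inj_on \<sigma> {0..<r}"
    proof (rule inj_onI)
      fix i j assume ij: "i \<in> {0..<r}" "j \<in> {0..<r}" "\<sigma> i = \<sigma> j"
      then have "g i = g j" by (simp add: \<sigma>_def)
      then have "f i = f j" using g(2)[of i] g(2)[of j] ij by simp
      then show "i = j" using f ij by (auto dest: inj_onD)
    qed
    moreover have "\<sigma> ` {0..<r} \<subseteq> {0..<r}" using g by (auto simp: \<sigma>_def)
    ultimately have "bij_betw \<sigma> {0..<r} {0..<r}"
      by (simp add: bij_betw_def endo_inj_surj)
    then have p: "\<sigma> permutes {0..<r}"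
      by (rule bij_imp_permutes) (simp add: \<sigma>_def)
    have "f = ?h (u, \<sigma>)"
    proof
      fix j show "f j = ?h (u, \<sigma>) j"
        using g f by (cases "j < r") (auto simp: \<sigma>_def PiE_def extensional_def)
    qed
    then show "f \<in> ?h ` ?D" using uS p by (intro image_eqI[of _ _ "(u, \<sigma>)"]) auto
  qed
qed

lemma permutes_less:
  assumes "\<sigma> permutes {0..<r::nat}" "j < r"
  shows "\<sigma> j < r"
  using permutes_in_image[OF assms(1), of j] assms(2) by simp

text \<open>The determinant of the product is expanded by multilinearity into a sum over all maps
  \<open>f\<close> into \<open>S\<close>. A map that is not injective gives a second determinant
  with two equal rows; the others are split into a subset and a permutation, and the sum over
  permutations rebuilds the first determinant.\<close>

lemma cauchy_binet:
  fixes A :: "nat \<Rightarrow> 'b :: linorder \<Rightarrow> 'a :: comm_ring_1"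
  assumes S: "finite S"
  shows "(\<Sum>u\<in>incr_maps r S. Determinant.det (Matrix.mat r r (\<lambda>(j, i). A j (u (i + 1)))) *
      Determinant.det (Matrix.mat r r (\<lambda>(i, l). B (u (i + 1)) l))) =
    Determinant.det (Matrix.mat r r (\<lambda>(j, l). \<Sum>x\<in>S. A j x * B x l))"
proof -
  let ?P = "{\<sigma>. \<sigma> permutes {0..<r}}"
  let ?F = "{0..<r} \<rightarrow>\<^sub>E S"
  define dB where "dB f = Determinant.det (Matrix.mat r r (\<lambda>(j, l). B (f j) l))" for f :: "nat \<Rightarrow> 'b"
  define AB where "AB f = (\<Prod>j\<in>{0..<r}. A j (f j)) * dB f" for f
  define h where "h = (\<lambda>(u, \<sigma>). \<lambda>j\<in>{0..<r}. (u (Suc (\<sigma> j)) :: 'b))"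
  define T where "T u \<sigma> = (\<Prod>j\<in>{0..<r}. A j (u (Suc (\<sigma> j)))) * (of_int (sign \<sigma>) * dB (\<lambda>j. u (Suc j)))"
    for u \<sigma>
  have key: "AB (h x) = (T (fst x) (snd x))" if "x \<in> incr_maps r S \<times> ?P" for x
  proof -
    obtain u \<sigma> where x: "x = (u, \<sigma>)" "\<sigma> permutes {0..<r}" using \<open>x \<in> _\<close> by auto
    define M where "M = Matrix.mat r r (\<lambda>(j, l). B (u (Suc j)) l)"
    have "Matrix.mat r r (\<lambda>(j, l). B (h x j) l) = Matrix.mat r r (\<lambda>(i, j). M $$ (\<sigma> i, j))"
      using x by (intro eq_matI) (auto simp: permutes_less M_def h_def)
    then have "dB (h x) = Determinant.det (Matrix.mat r r (\<lambda>(i, j). M $$ (\<sigma> i, j)))"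
      unfolding dB_def by (rule arg_cong)
    also have "\<dots> = of_int (sign \<sigma>) * Determinant.det M"
      by (rule det_permute_rows) (use x in \<open>auto simp: M_def\<close>)
    finally have "dB (h x) = of_int (sign \<sigma>) * Determinant.det M" .
    then show ?thesis by (simp add: AB_def x(1) T_def h_def dB_def M_def)
  qed
  have fin: "finite ?F" using S by (intro finite_PiE) auto
  have s1: "Determinant.det (Matrix.mat r r (\<lambda>(j, l). \<Sum>x\<in>S. A j x * B x l)) =
      (\<Sum>\<pi>\<in>?P. of_int (sign \<pi>) * (\<Prod>j\<in>{0..<r}. \<Sum>x\<in>S. A j x * B x (\<pi> j)))"
    unfolding Determinant.det_def using permutes_in_image
    by (auto intro!: sum.cong prod.cong arg_cong2[where f = "(*)"] simp: permutes_less)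
  have s2: "(\<Sum>\<pi>\<in>?P. of_int (sign \<pi>) * (\<Prod>j\<in>{0..<r}. \<Sum>x\<in>S. A j x * B x (\<pi> j))) =
      (\<Sum>\<pi>\<in>?P. \<Sum>f\<in>?F. of_int (sign \<pi>) * (\<Prod>j\<in>{0..<r}. A j (f j) * B (f j) (\<pi> j)))"
    using S by (subst prod_sum_PiE) (auto simp: sum_distrib_left)
  have s3: "(\<Sum>\<pi>\<in>?P. \<Sum>f\<in>?F. of_int (sign \<pi>) * (\<Prod>j\<in>{0..<r}. A j (f j) * B (f j) (\<pi> j))) =
      (\<Sum>f\<in>?F. \<Sum>\<pi>\<in>?P. of_int (sign \<pi>) * (\<Prod>j\<in>{0..<r}. A j (f j) * B (f j) (\<pi> j)))"
    by (rule sum.swap)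
  have s4: "(\<Sum>f\<in>?F. \<Sum>\<pi>\<in>?P. of_int (sign \<pi>) * (\<Prod>j\<in>{0..<r}. A j (f j) * B (f j) (\<pi> j))) =
      (\<Sum>f\<in>?F. (\<Prod>j\<in>{0..<r}. A j (f j)) * dB f)"
    by (intro sum.cong refl)
      (auto simp: dB_def Determinant.det_def prod.distrib sum_distrib_left permutes_less mult_ac intro!: sum.cong)
  have s5: "(\<Sum>f\<in>?F. (\<Prod>j\<in>{0..<r}. A j (f j)) * dB f) =
      (\<Sum>f\<in>{f \<in> ?F. inj_on f {0..<r}}. (\<Prod>j\<in>{0..<r}. A j (f j)) * dB f)"
  proof (rule sum.mono_neutral_right[OF fin])
    show "\<forall>f\<in>?F - {f \<in> ?F. inj_on f {0..<r}}. (\<Prod>j\<in>{0..<r}. A j (f j)) * dB f = 0"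
    proof
      fix f assume "f \<in> ?F - {f \<in> ?F. inj_on f {0..<r}}"
      then obtain i j where "i < r" "j < r" "i \<noteq> j" "f i = f j" by (auto simp: inj_on_def)
      then have "dB f = 0" unfolding dB_def
        by (intro det_identical_rows[of _ r i j]) (auto intro!: eq_vecI)
      then show "(\<Prod>j\<in>{0..<r}. A j (f j)) * dB f = 0" by simp
    qed
  qed auto
  have s6: "(\<Sum>f\<in>{f \<in> ?F. inj_on f {0..<r}}. (\<Prod>j\<in>{0..<r}. A j (f j)) * dB f) =
      (\<Sum>x\<in>incr_maps r S \<times> ?P. AB (h x))"
    using sum.reindex_bij_betw[OF incr_maps_perm_bij[OF S], of AB r]
    by (simp only: AB_def[abs_def] h_def)
  have s7: "(\<Sum>x\<in>incr_maps r S \<times> ?P. AB (h x)) =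
      (\<Sum>x\<in>incr_maps r S \<times> ?P. T (fst x) (snd x))"
    by (rule sum.cong[OF refl key])
  have s8: "(\<Sum>x\<in>incr_maps r S \<times> ?P. T (fst x) (snd x)) =
      (\<Sum>u\<in>incr_maps r S. \<Sum>\<sigma>\<in>?P. T u \<sigma>)"
    by (simp only: sum.cartesian_product split_def)
  have s9: "(\<Sum>u\<in>incr_maps r S. \<Sum>\<sigma>\<in>?P. T u \<sigma>) =
      (\<Sum>u\<in>incr_maps r S. Determinant.det (Matrix.mat r r (\<lambda>(j, i). A j (u (i + 1)))) *
      Determinant.det (Matrix.mat r r (\<lambda>(i, l). B (u (i + 1)) l)))"
  proof (rule sum.cong[OF refl])
    fix u
    have "Determinant.det (Matrix.mat r r (\<lambda>(j, i). A j (u (i + 1)))) =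
        (\<Sum>\<sigma>\<in>?P. of_int (sign \<sigma>) * (\<Prod>j\<in>{0..<r}. A j (u (Suc (\<sigma> j)))))"
      by (auto simp: Determinant.det_def permutes_less intro!: sum.cong)
    then show "(\<Sum>\<sigma>\<in>?P. T u \<sigma>) = Determinant.det (Matrix.mat r r (\<lambda>(j, i). A j (u (i + 1)))) *
      Determinant.det (Matrix.mat r r (\<lambda>(i, l). B (u (i + 1)) l))"
      by (simp add: T_def dB_def sum_distrib_left sum_distrib_right mult_ac)
  qed
  show ?thesis by (rule trans[OF s1 trans[OF s2 trans[OF s3 trans[OF s4 trans[OF s5 trans[OF s6 trans[OF s7 trans[OF s8 s9]]]]]]], symmetric])
qed

section \<open>Path ensembles\<close>

lemma det_mat_scale:
  fixes A :: "nat \<Rightarrow> nat \<Rightarrow> 'a :: comm_ring_1"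
  shows "Determinant.det (Matrix.mat n n (\<lambda>(i, j). a i * A i j * b j)) =
    (\<Prod>i<n. a i) * (\<Prod>i<n. b i) * Determinant.det (Matrix.mat n n (\<lambda>(i, j). A i j))"
proof -
  have *: "(\<Prod>i = 0..<n. a i * A i (p i) * b (p i)) = (\<Prod>i<n. a i) * (\<Prod>i<n. b i) * (\<Prod>i = 0..<n. A i (p i))"
    if "p permutes {0..<n}" for p
  proof -
    have "(\<Prod>i = 0..<n. b (p i)) = (\<Prod>i = 0..<n. b i)"
      using prod.permute[OF that, of b] by (simp add: o_def)
    then show ?thesis by (simp add: prod.distrib atLeast0LessThan mult_ac)
  qed
  have "Determinant.det (Matrix.mat n n (\<lambda>(i, j). a i * A i j * b j)) =
      (\<Sum>p | p permutes {0..<n}. of_int (sign p) * (\<Prod>i = 0..<n. a i * A i (p i) * b (p i)))"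
    by (auto simp: Determinant.det_def permutes_less intro!: sum.cong)
  also have "\<dots> = (\<Sum>p | p permutes {0..<n}. of_int (sign p) *
      ((\<Prod>i<n. a i) * (\<Prod>i<n. b i) * (\<Prod>i = 0..<n. A i (p i))))"
    by (intro sum.cong refl) (simp add: *)
  also have "\<dots> = (\<Prod>i<n. a i) * (\<Prod>i<n. b i) * Determinant.det (Matrix.mat n n (\<lambda>(i, j). A i j))"
    by (auto simp: Determinant.det_def permutes_less sum_distrib_left mult_ac intro!: sum.cong)
  finally show ?thesis .
qed

text \<open>Passes from gap probabilities to correlations, replacing one row of the identity minus
  \<open>K\<close> after the other by a row of \<open>K\<close>.\<close>

lemma inclusion_exclusion_det:
  fixes W :: "'c \<Rightarrow> 'a :: comm_ring_1" and pts :: "'c \<Rightarrow> 'p set" and K :: "'p \<Rightarrow> 'p \<Rightarrow> 'a"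
  assumes fin: "finite \<Omega>"
    and gap: "\<And>C. distinct C \<Longrightarrow> set C \<subseteq> X \<Longrightarrow>
      (\<Sum>u | u \<in> \<Omega> \<and> pts u \<inter> set C = {}. W u) = det_on C C (\<lambda>x y. (if x = y then 1 else 0) - K x y)"
    and B: "distinct B" "set B \<subseteq> X"
  shows "(\<Sum>u | u \<in> \<Omega> \<and> set B \<subseteq> pts u. W u) = det_on B B K"
proof -
  \<comment> \<open>Mixed matrix: rows of points required to be present carry \<open>K\<close>, rows
    of points required to be absent carry the identity minus \<open>K\<close>. The induction moves
    the points of \<open>B\<close> from the second kind to the first, for all \<open>C\<close> at
    once.\<close>
  define R where "R Y x y = (if x \<in> Y then K x y else (if x = y then 1 else 0) - K x y)" for Y :: "'p set" and x y
  have "(\<Sum>u | u \<in> \<Omega> \<and> set B \<subseteq> pts u \<and> pts u \<inter> set C = {}. W u) = det_on (B @ C) (B @ C) (R (set B))"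
    if "distinct (B @ C)" "set (B @ C) \<subseteq> X" for C
    using that
  proof (induction B arbitrary: C rule: rev_induct)
    case Nil
    then show ?case using gap[of C] by (simp add: R_def)
  next
    case (snoc b B)
    let ?E = "\<lambda>C. {u. u \<in> \<Omega> \<and> set B \<subseteq> pts u \<and> pts u \<inter> set C = {}}"
    have "?E C = {u. u \<in> \<Omega> \<and> set (B @ [b]) \<subseteq> pts u \<and> pts u \<inter> set C = {}} \<union> ?E (b # C)" by auto
    then have "(\<Sum>u\<in>?E C. W u) =
        (\<Sum>u | u \<in> \<Omega> \<and> set (B @ [b]) \<subseteq> pts u \<and> pts u \<inter> set C = {}. W u) + (\<Sum>u\<in>?E (b # C). W u)"
      using fin by (subst sum.union_disjoint[symmetric]) (auto intro: sum.cong)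
    moreover have "(\<Sum>u\<in>?E C. W u) = det_on (B @ C) (B @ C) (R (set B))"
      using snoc.prems by (intro snoc.IH) auto
    moreover have "(\<Sum>u\<in>?E (b # C). W u) = det_on (B @ b # C) (B @ b # C) (R (set B))"
      using snoc.prems by (intro snoc.IH) auto
    moreover have "det_on (B @ b # C) (B @ b # C) (R (set (B @ [b]))) =
       det_on (B @ C) (B @ C) (R (set (B @ [b]))) - det_on (B @ b # C) (B @ b # C) (R (set B))"
      using snoc.prems by (intro det_on_complement_row) (auto simp: R_def)
    moreover have "det_on (B @ C) (B @ C) (R (set (B @ [b]))) = det_on (B @ C) (B @ C) (R (set B))"
      using snoc.prems by (intro det_on_cong) (auto simp: R_def)
    ultimately show ?case by (simp add: algebra_simps)
  qed
  from this[of "[]"] have "(\<Sum>u | u \<in> \<Omega> \<and> set B \<subseteq> pts u. W u) = det_on B B (R (set B))"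
    using B by simp
  also have "\<dots> = det_on B B K" by (intro det_on_cong) (auto simp: R_def)
  finally show ?thesis .
qed

text \<open>Transfer-matrix sum over paths from \<open>x\<close> to \<open>(q, v)\<close>, with a
  factor \<open>f\<close> at every visited point, both ends included. The value 0 of
  \<open>f\<close> at a point forbids it.\<close>

primrec path_sum :: "(nat \<Rightarrow> 'b \<Rightarrow> 'b \<Rightarrow> 'a :: comm_ring_1) \<Rightarrow> 'b set \<Rightarrow> (nat \<times> 'b \<Rightarrow> 'a) \<Rightarrow>
    nat \<times> 'b \<Rightarrow> nat \<Rightarrow> 'b \<Rightarrow> 'a" where
  "path_sum T S f x 0 v = (if x = (0, v) then f x else 0)"
| "path_sum T S f x (Suc q) v = (if x = (Suc q, v) then f x else
     (\<Sum>w\<in>S. path_sum T S f x q w * T (Suc q) w v) * f (Suc q, v))"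

lemma path_sum_backwards: "q < fst x \<Longrightarrow> path_sum T S f x q v = 0"
  by (induction q arbitrary: v) auto

lemma path_sum_same_level:
  "path_sum T S f (p, u) p v = (if u = v then f (p, u) else 0)"
  by (cases p) (auto simp: path_sum_backwards)

lemma path_sum_Suc:
  "p \<le> q \<Longrightarrow> path_sum T S f (p, u) (Suc q) v =
     (\<Sum>w\<in>S. path_sum T S f (p, u) q w * T (Suc q) w v) * f (Suc q, v)"
  by auto

lemma path_sum_cong:
  assumes "\<And>p v. p \<le> q \<Longrightarrow> f (p, v) = g (p, v)"
  shows "path_sum T S f x q v = path_sum T S g x q v"
  using assms
proof (induction q arbitrary: v)
  case (Suc q)
  then have "path_sum T S f x q w = path_sum T S g x q w" for w by simp
  then show ?case using Suc.prems by auto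
qed auto

text \<open>Paths that avoid a point are all paths minus those through it, and the latter factor
  there. Both factors contain the weight of the point, which does no harm since it is 1.\<close>

lemma path_sum_delete_point:
  assumes c: "f (p, y) = 1"
  shows "path_sum T S (f((p, y) := 0)) x q v =
    path_sum T S f x q v - path_sum T S f x p y * path_sum T S f (p, y) q v"
proof -
  define f' where "f' = f((p, y) := 0)"
  have f': "f' (p, y) = 0" "\<And>z. z \<noteq> (p, y) \<Longrightarrow> f' z = f z" by (auto simp: f'_def)
  have "path_sum T S f' x q v =
    path_sum T S f x q v - path_sum T S f x p y * path_sum T S f (p, y) q v"
  proof (induction q arbitrary: v)
    case 0
    then show ?case using c f' by (cases "p = 0") (auto simp: path_sum_backwards)
  next
    case (Suc q)
    consider "q < p" "p \<noteq> Suc q" | "p = Suc q" | "p \<le> q" by linarith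
    then show ?case
    proof cases
      case 1
      have "path_sum T S f' x (Suc q) v = path_sum T S f x (Suc q) v"
        using 1 by (intro path_sum_cong f'(2)) auto
      then show ?thesis using 1 by (simp add: path_sum_backwards del: path_sum.simps)
    next
      case 2
      have eq: "path_sum T S f' x q w = path_sum T S f x q w" for w
        using 2 by (intro path_sum_cong f'(2)) auto
      show ?thesis
      proof (cases "v = y")
        case True
        then show ?thesis using 2 c f' by (auto simp: path_sum_same_level simp del: path_sum.simps) (auto simp: path_sum_same_level)
      next
        case False
        then show ?thesis using 2 c by (auto simp: eq f' path_sum_same_level path_sum_backwards)
      qed
    next
      case 3
      show ?thesis
      proof (cases "x = (Suc q, v)")
        case True
        then show ?thesis using 3 f' by (auto simp: path_sum_backwards)
      next
        case False
        have "(\<Sum>w\<in>S. path_sum T S f' x q w * T (Suc q) w v) =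
            (\<Sum>w\<in>S. path_sum T S f x q w * T (Suc q) w v) -
            path_sum T S f x p y * (\<Sum>w\<in>S. path_sum T S f (p, y) q w * T (Suc q) w v)"
          by (simp add: Suc.IH algebra_simps sum_subtractf sum_distrib_left)
        then show ?thesis using False 3 f' by (simp add: left_diff_distrib mult.assoc)
      qed
    qed
  qed
  then show ?thesis by (simp only: f'_def)
qed

definition path_configs :: "nat \<Rightarrow> 'b :: linorder set \<Rightarrow> nat \<Rightarrow> (nat \<Rightarrow> 'b) \<Rightarrow> (nat \<Rightarrow> 'b) \<Rightarrow> (nat \<Rightarrow> nat \<Rightarrow> 'b) set" where
  "path_configs r S q s v = {u \<in> {0..q} \<rightarrow>\<^sub>E incr_maps r S. u 0 = s \<and> u q = v}"

definition path_weight :: "(nat \<Rightarrow> 'b \<Rightarrow> 'b \<Rightarrow> 'a :: comm_ring_1) \<Rightarrow> nat \<Rightarrow> nat \<Rightarrow> (nat \<Rightarrow> nat \<Rightarrow> 'b) \<Rightarrow> 'a" where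
  "path_weight T r q u = (\<Prod>p = 1..q. Determinant.det (Matrix.mat r r
     (\<lambda>(j, l). T p (u (p - 1) (j + 1)) (u p (l + 1)))))"

lemma finite_path_configs: "finite S \<Longrightarrow> finite (path_configs r S q s v)"
  unfolding path_configs_def
  by (rule finite_subset[OF _ finite_PiE[of "{0..q}" "\<lambda>_. incr_maps r S"]]) (auto intro: finite_incr_maps)

lemma sum_path_configs_Suc:
  fixes G :: "(nat \<Rightarrow> nat \<Rightarrow> 'b :: linorder) \<Rightarrow> 'a :: comm_ring_1"
  assumes S: "finite S" and v: "v \<in> incr_maps r S"
  shows "(\<Sum>u\<in>path_configs r S (Suc q) s v. G u) =
    (\<Sum>x\<in>incr_maps r S. \<Sum>u\<in>path_configs r S q s x. G (u(Suc q := v)))"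
proof -
  let ?B = "SIGMA x:incr_maps r S. path_configs r S q s x"
  have "(\<Sum>u\<in>path_configs r S (Suc q) s v. G u) = (\<Sum>z\<in>?B. G ((snd z)(Suc q := v)))"
  proof (rule sum.reindex_bij_witness[where i = "\<lambda>z. (snd z)(Suc q := v)"
        and j = "\<lambda>u. (u q, restrict u {0..q})"])
    fix u assume u: "u \<in> path_configs r S (Suc q) s v"
    then show "(snd (u q, restrict u {0..q}))(Suc q := v) = u"
      by (auto simp: path_configs_def PiE_def extensional_def fun_eq_iff restrict_def)
    show "(u q, restrict u {0..q}) \<in> ?B" using u by (auto simp: path_configs_def PiE_def Pi_def)
    then show "G ((snd (u q, restrict u {0..q}))(Suc q := v)) = G u"
      using \<open>(snd (u q, restrict u {0..q}))(Suc q := v) = u\<close> by simp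
  next
    fix z assume z: "z \<in> ?B"
    then show "(((snd z)(Suc q := v)) q, restrict ((snd z)(Suc q := v)) {0..q}) = z"
      by (auto simp: path_configs_def PiE_def extensional_def fun_eq_iff restrict_def prod_eq_iff)
    show "(snd z)(Suc q := v) \<in> path_configs r S (Suc q) s v"
      using z v by (auto simp: path_configs_def PiE_def Pi_def extensional_def)
  qed
  also have "\<dots> = (\<Sum>x\<in>incr_maps r S. \<Sum>u\<in>path_configs r S q s x. G (u(Suc q := v)))"
    using S by (subst sum.Sigma) (auto simp: finite_incr_maps finite_path_configs split_def)
  finally show ?thesis .
qed

text \<open>Base case of the path expansion. Two equal increasing sequences give a diagonal matrix;
  if they differ, some value of \<open>s\<close> is not taken by \<open>v\<close>, and its row is
  zero.\<close>

lemma det_delta_incr_maps: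
  assumes s: "s \<in> incr_maps r S" and v: "v \<in> incr_maps r S"
  shows "Determinant.det (Matrix.mat r r (\<lambda>(j, l). if s (j + 1) = v (l + 1) then g (s (j + 1)) else 0)) =
    (if s = v then \<Prod>j=1..r. g (s j) else (0 :: 'a :: comm_ring_1))"
proof (cases "s = v")
  case True
  have inj: "inj_on s {1..r}" using s by (auto simp: incr_maps_def intro: strict_mono_on_imp_inj_on)
  have "Matrix.mat r r (\<lambda>(j, l). if s (j + 1) = s (l + 1) then g (s (j + 1)) else 0) =
     Matrix.mat r r (\<lambda>(j, l). if j = l then g (s (j + 1)) else 0)"
    by (intro eq_matI) (auto dest: inj_onD[OF inj])
  also have "Determinant.det \<dots> = prod_list (map (\<lambda>j. g (s (j + 1))) [0..<r])"
    by (subst det_upper_triangular[of _ r]) (auto intro!: arg_cong[where f = prod_list] nth_equalityI simp: diag_mat_def)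
  also have "\<dots> = (\<Prod>j=0..<r. g (s (Suc j)))"
    by (simp add: prod.distinct_set_conv_list[symmetric])
  also have "\<dots> = (\<Prod>j=1..r. g (s j))"
    by (simp only: One_nat_def prod.atLeast_Suc_atMost_Suc_shift atLeastLessThanSuc_atLeastAtMost[symmetric] prod.atLeast_Suc_lessThan_Suc_shift o_def)
  finally show ?thesis using True by simp
next
  case False
  have inj: "inj_on s {1..r}" "inj_on v {1..r}"
    using s v by (auto simp: incr_maps_def intro: strict_mono_on_imp_inj_on)
  have "\<not> s ` {1..r} \<subseteq> v ` {1..r}"
  proof
    assume "s ` {1..r} \<subseteq> v ` {1..r}"
    then have "s ` {1..r} = v ` {1..r}"
      using card_image[OF inj(1)] card_image[OF inj(2)] by (intro card_subset_eq) auto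
    then have "s i = v i" for i
      using strict_mono_on_image_eq[of r s v i] s v
      by (cases "i \<in> {1..r}") (auto simp: incr_maps_def PiE_def extensional_def)
    with False show False by auto
  qed
  then obtain j where j: "j \<in> {1..r}" "s j \<notin> v ` {1..r}" by blast
  have "(\<Prod>i = 0..<r. Matrix.mat r r (\<lambda>(j, l). if s (j + 1) = v (l + 1) then g (s (j + 1)) else 0) $$ (i, p i)) = 0"
    if p: "p permutes {0..<r}" for p
  proof (rule prod_zero)
    show "\<exists>i\<in>{0..<r}. Matrix.mat r r (\<lambda>(j, l). if s (j + 1) = v (l + 1) then g (s (j + 1)) else 0) $$ (i, p i) = 0"
    proof (rule bexI)
      have "p (j - 1) < r" using j by (intro permutes_less[OF p]) auto
      then have "s j \<noteq> v (p (j - 1) + 1)" using j by force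
      then show "Matrix.mat r r (\<lambda>(j, l). if s (j + 1) = v (l + 1) then g (s (j + 1)) else 0) $$ (j - 1, p (j - 1)) = 0"
        using j \<open>p (j - 1) < r\<close> by auto
    qed (use j in auto)
  qed auto
  then have "Determinant.det (Matrix.mat r r (\<lambda>(j, l). if s (j + 1) = v (l + 1) then g (s (j + 1)) else 0)) = 0"
    by (simp add: Determinant.det_def)
  then show ?thesis using False by simp
qed

text \<open>Each additional level is one application of the Cauchy--Binet formula. Keeping the
  vertex weights \<open>f\<close> general lets the same formula serve the total mass and the gap
  probabilities.\<close>

lemma sum_path_weight:
  fixes T :: "nat \<Rightarrow> 'b :: linorder \<Rightarrow> 'b \<Rightarrow> 'a :: comm_ring_1"
  assumes S: "finite S" and s: "s \<in> incr_maps r S" and v: "v \<in> incr_maps r S"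
  shows "(\<Sum>u\<in>path_configs r S q s v. path_weight T r q u * (\<Prod>p\<le>q. \<Prod>j=1..r. f (p, u p j))) =
    Determinant.det (Matrix.mat r r (\<lambda>(j, l). path_sum T S f (0, s (j + 1)) q (v (l + 1))))"
  using v
proof (induction q arbitrary: v)
  case 0
  have "path_configs r S 0 s v = (if s = v then {\<lambda>p\<in>{0..0}. s} else {})"
    using s 0 by (auto simp: path_configs_def PiE_def extensional_def fun_eq_iff)
  moreover have "Matrix.mat r r (\<lambda>(j, l). path_sum T S f (0, s (j + 1)) 0 (v (l + 1))) =
     Matrix.mat r r (\<lambda>(j, l). if s (j + 1) = v (l + 1) then (\<lambda>x. f (0, x)) (s (j + 1)) else 0)"
    by (intro eq_matI) auto
  ultimately show ?case
    using det_delta_incr_maps[OF s 0, of "\<lambda>x. f (0, x)"] by (simp add: path_weight_def)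
next
  case (Suc q)
  let ?F = "\<Prod>j=1..r. f (Suc q, v j)"
  let ?W = "\<lambda>q u. path_weight T r q u * (\<Prod>p\<le>q. \<Prod>j=1..r. f (p, u p j))"
  let ?D = "\<lambda>x. Determinant.det (Matrix.mat r r (\<lambda>(i, l). T (Suc q) (x (i + 1)) (v (l + 1)) * f (Suc q, v (l + 1))))"
  \<comment> \<open>The vertex factors of the new level scale the columns of the last determinant,
    so they can be moved into its entries.\<close>
  have scale: "?D x = Determinant.det (Matrix.mat r r (\<lambda>(j, l). T (Suc q) (x (j + 1)) (v (l + 1)))) * ?F" for x
  proof -
    have "?F = (\<Prod>i<r. f (Suc q, v (i + 1)))"
      by (rule prod.reindex_bij_witness[of _ Suc "\<lambda>j. j - 1"]) auto
    then show ?thesis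
      using det_mat_scale[of r "\<lambda>_. 1" "\<lambda>i l. T (Suc q) (x (i + 1)) (v (l + 1))" "\<lambda>l. f (Suc q, v (l + 1))"]
      by simp
  qed
  have step: "?W (Suc q) (u(Suc q := v)) = ?W q u * ?D x" if u: "u \<in> path_configs r S q s x" for u x
  proof -
    have "path_weight T r (Suc q) (u(Suc q := v)) = path_weight T r q u *
        Determinant.det (Matrix.mat r r (\<lambda>(j, l). T (Suc q) (x (j + 1)) (v (l + 1))))"
    proof -
      have "(\<Prod>p = 1..q. Determinant.det (Matrix.mat r r (\<lambda>(j, l). T p ((u(Suc q := v)) (p - 1) (j + 1)) ((u(Suc q := v)) p (l + 1)))))
          = path_weight T r q u"
        unfolding path_weight_def by (intro prod.cong) auto
      then show ?thesis using u by (simp add: path_weight_def path_configs_def)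
    qed
    then show ?thesis unfolding scale by simp
  qed
  have 1: "(\<Sum>u\<in>path_configs r S (Suc q) s v. ?W (Suc q) u) =
     (\<Sum>x\<in>incr_maps r S. \<Sum>u\<in>path_configs r S q s x. ?W (Suc q) (u(Suc q := v)))"
    by (rule sum_path_configs_Suc[OF S Suc.prems])
  have 2: "(\<Sum>x\<in>incr_maps r S. \<Sum>u\<in>path_configs r S q s x. ?W (Suc q) (u(Suc q := v))) =
     (\<Sum>x\<in>incr_maps r S. Determinant.det (Matrix.mat r r (\<lambda>(j, l). path_sum T S f (0, s (j + 1)) q (x (l + 1)))) * ?D x)"
    by (intro sum.cong refl) (simp only: step cong: sum.cong, simp only: sum_distrib_right[symmetric] Suc.IH)
  have 3: "(\<Sum>x\<in>incr_maps r S. Determinant.det (Matrix.mat r r (\<lambda>(j, l). path_sum T S f (0, s (j + 1)) q (x (l + 1)))) * ?D x) =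
     Determinant.det (Matrix.mat r r (\<lambda>(j, l). \<Sum>w\<in>S. path_sum T S f (0, s (j + 1)) q w *
        (T (Suc q) w (v (l + 1)) * f (Suc q, v (l + 1)))))"
    by (rule cauchy_binet[OF S])
  have 4: "Matrix.mat r r (\<lambda>(j, l). \<Sum>w\<in>S. path_sum T S f (0, s (j + 1)) q w *
        (T (Suc q) w (v (l + 1)) * f (Suc q, v (l + 1)))) =
      Matrix.mat r r (\<lambda>(j, l). path_sum T S f (0, s (j + 1)) (Suc q) (v (l + 1)))"
    by (intro eq_matI) (auto simp: sum_distrib_right mult.assoc)
  show ?case unfolding 1 2 3 4 ..
qed

section \<open>The Eynard--Mehta theorem\<close>

definition propagator :: "(nat \<Rightarrow> 'b \<Rightarrow> 'b \<Rightarrow> 'a :: comm_ring_1) \<Rightarrow> 'b set \<Rightarrow> (nat \<times> 'b \<Rightarrow> 'a) \<Rightarrow>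
    nat \<times> 'b \<Rightarrow> nat \<times> 'b \<Rightarrow> 'a" where
  "propagator T S f x y = path_sum T S f x (fst y) (snd y)"

lemma propagator_same: "propagator T S f x x = f x"
  by (cases x) (simp add: propagator_def path_sum_same_level)

text \<open>Forbidding the paths to visit a point is one elimination step with that point as pivot.\<close>

lemma det_on_propagator_delete:
  fixes T :: "nat \<Rightarrow> 'b \<Rightarrow> 'b \<Rightarrow> 'a :: field"
  assumes "distinct C" "length rs = length cs" "\<And>c. c \<in> set C \<Longrightarrow> f c = 1"
  shows "det_on (C @ rs) (C @ cs) (propagator T S f) =
    det_on rs cs (propagator T S (\<lambda>x. if x \<in> set C then 0 else f x))"
  using assms
proof (induction C arbitrary: f)
  case (Cons c C)
  have "det_on ((c # C) @ rs) ((c # C) @ cs) (propagator T S f) =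
      det_on (C @ rs) (C @ cs) (\<lambda>x y. propagator T S f x y - propagator T S f x c * propagator T S f c y)"
    using Cons.prems by (simp add: det_on_pivot propagator_same)
  also have "(\<lambda>x y. propagator T S f x y - propagator T S f x c * propagator T S f c y) =
      propagator T S (f(c := 0))"
    using Cons.prems(3)[of c] path_sum_delete_point[of f "fst c" "snd c"]
    by (simp add: propagator_def fun_eq_iff del: fun_upd_apply)
  also have "det_on (C @ rs) (C @ cs) (propagator T S (f(c := 0))) =
      det_on rs cs (propagator T S (\<lambda>x. if x \<in> set C then 0 else (f(c := 0)) x))"
    using Cons.prems by (intro Cons.IH) auto
  also have "(\<lambda>x. if x \<in> set C then 0 else (f(c := 0)) x) = (\<lambda>x. if x \<in> set (c # C) then 0 else f x)"
    by auto
  finally show ?case .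
qed simp

definition path_points :: "nat \<Rightarrow> nat \<Rightarrow> (nat \<Rightarrow> nat \<Rightarrow> 'b) \<Rightarrow> (nat \<times> 'b) set" where
  "path_points r q u = {(p, y). p \<le> q \<and> (\<exists>j\<in>{1..r}. u p j = y)}"

text \<open>The propagators run from the second argument \<open>y\<close> to the first argument
  \<open>x\<close>, the transposed order that \<open>kernel_block\<close> expects. As the propagator
  is 1 from a point to itself, identity minus propagator vanishes on the diagonal.\<close>

definition path_kernel :: "(nat \<Rightarrow> 'b \<Rightarrow> 'b \<Rightarrow> 'a :: comm_ring_1) \<Rightarrow> 'b set \<Rightarrow> nat \<Rightarrow> (nat \<Rightarrow> 'b) \<Rightarrow>
    nat \<Rightarrow> (nat \<Rightarrow> 'b) \<Rightarrow> (nat \<Rightarrow> nat \<Rightarrow> 'a) \<Rightarrow> nat \<times> 'b \<Rightarrow> nat \<times> 'b \<Rightarrow> 'a" where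
  "path_kernel T S r s q v H x y = (if x = y then 1 else 0) - propagator T S (\<lambda>_. 1) y x +
     (\<Sum>l<r. \<Sum>j<r. propagator T S (\<lambda>_. 1) y (q, v (l + 1)) * H l j * propagator T S (\<lambda>_. 1) (0, s (j + 1)) x)"

text \<open>The determinant with rows \<open>C\<close> and start points, columns \<open>C\<close>
  and end points, is evaluated twice. Eliminating \<open>C\<close> forbids its points and gives the
  weight of the gap event; eliminating the start and end points gives the partition function times a
  determinant of size \<open>length C\<close>.\<close>

lemma eynard_mehta:
  fixes T :: "nat \<Rightarrow> 'b :: linorder \<Rightarrow> 'b \<Rightarrow> 'a :: field" and S :: "'b set" and s v :: "nat \<Rightarrow> 'b"
    and q :: nat
  defines "G \<equiv> \<lambda>j l. propagator T S (\<lambda>_. 1) (0, s (j + 1)) (q, v (l + 1))"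
  assumes S: "finite S" and s: "s \<in> incr_maps r S" and v: "v \<in> incr_maps r S"
    and H: "\<And>a b. a < r \<Longrightarrow> b < r \<Longrightarrow> (\<Sum>l<r. G a l * H l b) = (if a = b then 1 else 0)"
    and H': "\<And>a b. a < r \<Longrightarrow> b < r \<Longrightarrow> (\<Sum>l<r. H a l * G l b) = (if a = b then 1 else 0)"
    and G0: "Determinant.det (Matrix.mat r r (\<lambda>(j, l). G j l)) \<noteq> 0"
    and B: "distinct B"
  shows "(\<Sum>u | u \<in> path_configs r S q s v \<and> set B \<subseteq> path_points r q u. path_weight T r q u) =
    Determinant.det (Matrix.mat r r (\<lambda>(j, l). G j l)) * det_on B B (path_kernel T S r s q v H)"
proof -
  define Z where "Z = Determinant.det (Matrix.mat r r (\<lambda>(j, l). G j l))"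
  define ss where "ss = map (\<lambda>j. (0::nat, s (j + 1))) [0..<r]"
  define es where "es = map (\<lambda>j. (q, v (j + 1))) [0..<r]"
  let ?\<Omega> = "path_configs r S q s v"
  let ?U = "propagator T S (\<lambda>_. 1)"
  have len: "length ss = r" "length es = r" by (auto simp: ss_def es_def)
  have det: "det_on ss es (propagator T S f) =
      Determinant.det (Matrix.mat r r (\<lambda>(j, l). path_sum T S f (0, s (j + 1)) q (v (l + 1))))" for f
    unfolding det_on_def len by (intro arg_cong[where f = Determinant.det] eq_matI)
      (auto simp: ss_def es_def propagator_def)
  have Z: "det_on ss es ?U = Z"
    unfolding det by (simp add: Z_def G_def propagator_def)
  define wt where "wt u = path_weight T r q u / Z" for u
  have gap: "(\<Sum>u | u \<in> ?\<Omega> \<and> path_points r q u \<inter> set C = {}. wt u) =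
      det_on C C (\<lambda>x y. (if x = y then 1 else 0) - path_kernel T S r s q v H x y)"
    if C: "distinct C" for C
  proof -
    define f :: "nat \<times> 'b \<Rightarrow> 'a" where "f = (\<lambda>x. if x \<in> set C then 0 else 1)"
    have prodf: "(\<Prod>p\<le>q. \<Prod>j=1..r. f (p, u p j)) = (if path_points r q u \<inter> set C = {} then 1 else 0)" for u
    proof (cases "path_points r q u \<inter> set C = {}")
      case True
      then have "f (p, u p j) = 1" if "p \<le> q" "j \<in> {1..r}" for p j
      proof -
        have "(p, u p j) \<in> path_points r q u" using that unfolding path_points_def by blast
        then show ?thesis using True by (auto simp: f_def)
      qed
      then show ?thesis using True by simp
    next
      case False
      then obtain x where "x \<in> path_points r q u" "x \<in> set C" by blast
      then obtain p j where pj: "p \<le> q" "j \<in> {1..r}" "f (p, u p j) = 0"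
        unfolding path_points_def f_def by auto
      then have "(\<Prod>j=1..r. f (p, u p j)) = 0" by (intro prod_zero) auto
      then have "(\<Prod>p\<le>q. \<Prod>j=1..r. f (p, u p j)) = 0"
        by (rule prod_zero[OF finite_atMost bexI[of _ p]]) (use pj in auto)
      then show ?thesis using False by simp
    qed
    have 1: "(\<Sum>u | u \<in> ?\<Omega> \<and> path_points r q u \<inter> set C = {}. path_weight T r q u) =
        (\<Sum>u\<in>?\<Omega>. path_weight T r q u * (\<Prod>p\<le>q. \<Prod>j=1..r. f (p, u p j)))"
      unfolding prodf using finite_path_configs[OF S]
      by (intro sum.mono_neutral_cong_left) auto
    have 2: "(\<Sum>u\<in>?\<Omega>. path_weight T r q u * (\<Prod>p\<le>q. \<Prod>j=1..r. f (p, u p j))) = det_on ss es (propagator T S f)"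
      unfolding det by (rule sum_path_weight[OF S s v])
    have 3: "det_on (C @ ss) (C @ es) ?U = det_on ss es (propagator T S f)"
      unfolding f_def by (rule det_on_propagator_delete) (use C len in auto)
    have 4: "det_on (C @ ss) (C @ es) ?U = det_on ss es ?U *
        det_on C C (\<lambda>x y. ?U x y - (\<Sum>l<r. \<Sum>j<r. ?U x (es ! l) * H l j * ?U (ss ! j) y))"
      by (rule det_on_append_schur) (use H H' len in \<open>auto simp: ss_def es_def G_def\<close>)
    \<comment> \<open>Transposition puts the propagators in the order used by
      \<open>path_kernel\<close>.\<close>
    have 5: "det_on C C (\<lambda>x y. ?U x y - (\<Sum>l<r. \<Sum>j<r. ?U x (es ! l) * H l j * ?U (ss ! j) y)) =
        det_on C C (\<lambda>x y. ?U y x - (\<Sum>l<r. \<Sum>j<r. ?U y (es ! l) * H l j * ?U (ss ! j) x))"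
      by (rule det_on_transpose[OF refl, symmetric])
    have 6: "det_on C C (\<lambda>x y. ?U y x - (\<Sum>l<r. \<Sum>j<r. ?U y (es ! l) * H l j * ?U (ss ! j) x)) =
        det_on C C (\<lambda>x y. (if x = y then 1 else 0) - path_kernel T S r s q v H x y)"
      by (rule det_on_cong) (auto simp: path_kernel_def ss_def es_def)
    have "(\<Sum>u | u \<in> ?\<Omega> \<and> path_points r q u \<inter> set C = {}. path_weight T r q u) =
        Z * det_on C C (\<lambda>x y. (if x = y then 1 else 0) - path_kernel T S r s q v H x y)"
      unfolding 1 2 3[symmetric] 4 Z 5 6 ..
    then show ?thesis using G0 unfolding wt_def sum_divide_distrib[symmetric] Z_def by simp
  qed
  have "(\<Sum>u | u \<in> ?\<Omega> \<and> set B \<subseteq> path_points r q u. wt u) = det_on B B (path_kernel T S r s q v H)"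
    by (rule inclusion_exclusion_det[where X = UNIV, OF finite_path_configs[OF S] gap]) (use B in auto)
  then show ?thesis using G0 unfolding wt_def sum_divide_distrib[symmetric] Z_def[symmetric]
    by (simp add: field_simps)
qed

section \<open>Block Toeplitz transition matrices\<close>

text \<open>The Toeplitz matrix of a power series in \<open>t = 1/z\<close>: moving down by
  \<open>d\<close> blocks picks the coefficient of \<open>t^d\<close>.\<close>

definition block_toeplitz :: "'a :: zero fps mat \<Rightarrow> int \<Rightarrow> int \<Rightarrow> 'a" where
  "block_toeplitz F u v = (if v div 2 \<le> u div 2
     then F $$ (nat (u mod 2), nat (v mod 2)) $ nat (u div 2 - v div 2) else 0)"

lemma int_parity_cases:
  obtains x :: int where "u = 2 * x" | x where "u = 2 * x + 1"
  by (metis evenE oddE)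

lemma int_double_Suc [simp]:
  "(2 * x + 1) div 2 = (x :: int)" "(2 * x + 1) mod 2 = (1 :: int)"
  by presburger+

lemma block_toeplitz_one:
  "block_toeplitz (1\<^sub>m 2 :: 'a :: comm_ring_1 fps mat) u v = (if u = v then 1 else 0)"
proof (cases u rule: int_parity_cases; cases v rule: int_parity_cases)
qed (auto simp: block_toeplitz_def fps_one_nth; presburger?)+

lemma sum_even_interval:
  fixes f :: "int \<Rightarrow> 'a :: comm_monoid_add"
  shows "(\<Sum>w\<in>{2 * a..<2 * b}. f w) = (\<Sum>y\<in>{a..<b}. \<Sum>t<2::nat. f (2 * y + int t))"
proof -
  have "(\<Sum>w\<in>{2 * a..<2 * b}. f w) = (\<Sum>z\<in>{a..<b} \<times> {..<2::nat}. f (2 * fst z + int (snd z)))"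
    by (rule sum.reindex_bij_witness[of _ "\<lambda>z. 2 * fst z + int (snd z)" "\<lambda>w. (w div 2, nat (w mod 2))"])
      auto
  then show ?thesis by (simp add: sum.cartesian_product split_def)
qed

text \<open>Cutting to the window loses nothing: a nonzero term has its intermediate block between
  those of \<open>v\<close> and \<open>u\<close>, which both lie in the window, and the even ends
  keep blocks intact. What remains is the Cauchy product.\<close>

lemma block_toeplitz_mult:
  fixes A B :: "'a :: comm_ring_1 fps mat"
  assumes carr: "A \<in> carrier_mat 2 2" "B \<in> carrier_mat 2 2"
    and u: "u \<in> {2 * a..<2 * b}" and v: "v \<in> {2 * a..<2 * b}"
  shows "(\<Sum>w\<in>{2 * a..<2 * b}. block_toeplitz A u w * block_toeplitz B w v) = block_toeplitz (A * B) u v"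
proof -
  define x y i j where "x = u div 2" "y = v div 2" "i = nat (u mod 2)" "j = nat (v mod 2)"
  note defs = this
  have ij: "i < 2" "j < 2" by (auto simp: defs)
  have xy: "a \<le> x" "x < b" "a \<le> y" "y < b" using u v by (auto simp: defs)
  define g where "g z = (if y \<le> z \<and> z \<le> x then \<Sum>t<2. A $$ (i, t) $ nat (x - z) * B $$ (t, j) $ nat (z - y) else 0)" for z
  have AB: "(A * B) $$ (i, j) = (\<Sum>t<2. A $$ (i, t) * B $$ (t, j))"
    using carr ij by (simp add: scalar_prod_def atLeast0LessThan)
  have "(\<Sum>w\<in>{2 * a..<2 * b}. block_toeplitz A u w * block_toeplitz B w v) = (\<Sum>z\<in>{a..<b}. g z)"
    unfolding sum_even_interval
    by (intro sum.cong refl) (auto simp: block_toeplitz_def g_def defs[symmetric])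
  also have "\<dots> = (\<Sum>z\<in>{y..x}. g z)"
    using xy by (intro sum.mono_neutral_right) (auto simp: g_def)
  also have "\<dots> = block_toeplitz (A * B) u v"
  proof (cases "y \<le> x")
    case True
    define n where "n = nat (x - y)"
    have x: "x = y + int n" using True by (simp add: n_def)
    have "(\<Sum>z\<in>{y..x}. g z) = (\<Sum>m\<in>{0..n}. g (x - int m))"
      by (rule sum.reindex_bij_witness[of _ "\<lambda>m. x - int m" "\<lambda>z. nat (x - z)"]) (auto simp: x)
    also have "\<dots> = (\<Sum>m\<in>{0..n}. \<Sum>t<2. A $$ (i, t) $ m * B $$ (t, j) $ (n - m))"
      by (intro sum.cong refl) (auto simp: g_def x of_nat_diff[symmetric] simp del: of_nat_diff)
    also have "\<dots> = (A * B) $$ (i, j) $ n"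
      unfolding AB by (subst sum.swap) (simp add: fps_sum_nth fps_mult_nth)
    finally show ?thesis using True by (simp add: block_toeplitz_def defs[symmetric] n_def)
  next
    case False
    then show ?thesis by (simp add: block_toeplitz_def defs[symmetric])
  qed
  finally show ?thesis .
qed

primrec fps_mat_prod :: "(nat \<Rightarrow> 'a :: comm_ring_1 fps mat) \<Rightarrow> nat \<Rightarrow> nat \<Rightarrow> 'a fps mat" where
  "fps_mat_prod F p 0 = 1\<^sub>m 2"
| "fps_mat_prod F p (Suc d) = fps_mat_prod F p d * F (Suc (p + d))"

lemma fps_mat_prod_carrier:
  assumes "\<And>p. F p \<in> carrier_mat 2 2"
  shows "fps_mat_prod F p d \<in> carrier_mat 2 2"
  by (induction d) (use assms in auto)

lemma path_sum_block_toeplitz: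
  fixes F :: "nat \<Rightarrow> 'a :: comm_ring_1 fps mat"
  assumes carr: "\<And>p. F p \<in> carrier_mat 2 2" and T: "\<And>p u v. T p u v = block_toeplitz (F p) u v"
    and u: "u \<in> {2 * a..<2 * b}" and v: "v \<in> {2 * a..<2 * b}"
  shows "path_sum T {2 * a..<2 * b} (\<lambda>_. 1) (p, u) (p + d) v = block_toeplitz (fps_mat_prod F p d) u v"
  using v
proof (induction d arbitrary: v)
  case 0
  then show ?case by (simp add: path_sum_same_level block_toeplitz_one)
next
  case (Suc d)
  have "path_sum T {2 * a..<2 * b} (\<lambda>_. 1) (p, u) (Suc (p + d)) v =
     (\<Sum>w\<in>{2 * a..<2 * b}. block_toeplitz (fps_mat_prod F p d) u w * block_toeplitz (F (Suc (p + d))) w v)"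
    unfolding path_sum_Suc[OF le_add1] mult_1_right
    by (intro sum.cong refl) (simp only: Suc.IH T)
  also have "\<dots> = block_toeplitz (fps_mat_prod F p (Suc d)) u v"
    by (simp add: block_toeplitz_mult[OF fps_mat_prod_carrier[OF carr] carr u Suc.prems])
  finally show ?case by simp
qed

section \<open>Power series and explicit entries of the one-step transition matrices\<close>

definition step_fps :: "nat \<Rightarrow> (nat \<Rightarrow> real) \<Rightarrow> (nat \<Rightarrow> real) \<Rightarrow> (nat \<Rightarrow> real) \<Rightarrow> nat \<Rightarrow> complex fps mat" where
  "step_fps k \<alpha> \<beta> \<gamma> p =
     (let m = (p + 1) div 2; a = of_real (periodic_ext k \<alpha> m); b = of_real (periodic_ext k \<beta> m);
          c = of_real (periodic_ext k \<gamma> m) in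
      if odd p then mat_of_rows_list 2 [[fps_const c, fps_const a * fps_X], [fps_const (1 / a), fps_const (1 / c)]]
      else mat_of_rows_list 2 [[inverse (1 - fps_X), fps_const b * fps_X * inverse (1 - fps_X)],
             [fps_const (1 / b) * inverse (1 - fps_X), inverse (1 - fps_X)]])"

lemma mat_of_rows_list_2_carrier: "mat_of_rows_list 2 [[a, b], [c, d]] \<in> carrier_mat 2 2"
  by (simp add: mat_of_rows_list_def numeral_2_eq_2)

lemma mat_of_rows_list_2_index [simp]:
  "mat_of_rows_list 2 [[a, b], [c, d]] $$ (0, 0) = a"
  "mat_of_rows_list 2 [[a, b], [c, d]] $$ (0, Suc 0) = b"
  "mat_of_rows_list 2 [[a, b], [c, d]] $$ (Suc 0, 0) = c"
  "mat_of_rows_list 2 [[a, b], [c, d]] $$ (Suc 0, Suc 0) = d"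
  by (simp_all add: mat_of_rows_list_def)

lemma step_fps_carrier: "step_fps k \<alpha> \<beta> \<gamma> p \<in> carrier_mat 2 2"
  by (simp add: step_fps_def Let_def mat_of_rows_list_2_carrier)

lemma step_symbol_expansion:
  assumes "i < 2" "j < 2"
  shows "(\<lambda>t. step_symbol k \<alpha> \<beta> \<gamma> p (1 / t) $$ (i, j)) has_fps_expansion (step_fps k \<alpha> \<beta> \<gamma> p $$ (i, j))"
proof -
  have ij: "(i = 0 \<or> i = Suc 0) \<and> (j = 0 \<or> j = Suc 0)" using assms by auto
  have geo: "(\<lambda>t. c / (1 - t) :: complex) has_fps_expansion fps_const c * inverse (1 - fps_X)" for c
    unfolding divide_inverse by (intro fps_expansion_intros) auto
  have geo1: "(\<lambda>t. 1 / (1 - t) :: complex) has_fps_expansion inverse (1 - fps_X)"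
    using geo[of 1] by simp
  have geob: "(\<lambda>t. 1 / ((1 - t) * c) :: complex) has_fps_expansion fps_const (1 / c) * inverse (1 - fps_X)" for c
    using geo[of "1 / c"] by (simp add: mult.commute)
  have geot: "(\<lambda>t. c * t / (1 - t) :: complex) has_fps_expansion fps_const c * fps_X * inverse (1 - fps_X)" for c
    unfolding divide_inverse by (intro fps_expansion_intros) auto
  have lin: "(\<lambda>t. c * t :: complex) has_fps_expansion fps_const c * fps_X" for c
    by (intro fps_expansion_intros)
  show ?thesis
    using ij geo geo1 geot lin geob by (auto simp: step_symbol_def step_fps_def Let_def bernoulli_mat_def geometric_mat_def
        mat_of_rows_list_2_carrier[THEN carrier_matD(1)] mat_of_rows_list_2_carrier[THEN carrier_matD(2)]
        has_fps_expansion_const)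
qed

lemma transition_eq_block_toeplitz:
  "transition k \<alpha> \<beta> \<gamma> p u v = block_toeplitz (step_fps k \<alpha> \<beta> \<gamma> p) u v"
proof -
  let ?i = "nat (u mod 2)" and ?j = "nat (v mod 2)"
  have "?i < 2" "?j < 2" by auto
  from step_symbol_expansion[OF this, of k \<alpha> \<beta> \<gamma> p]
  have "laurent_expansion (\<lambda>t. step_symbol k \<alpha> \<beta> \<gamma> p (1 / t) $$ (?i, ?j)) 0 =
     fps_to_fls (step_fps k \<alpha> \<beta> \<gamma> p $$ (?i, ?j))"
    unfolding has_fps_expansion_to_laurent by (intro laurent_expansion_0_eqI) simp
  then show ?thesis by (simp add: transition_def block_toeplitz_def)
qed

text \<open>Gauge factor: the geometric step weight from \<open>u\<close> to \<open>v\<close> is a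
  ratio of two such factors times the indicator of \<open>v \<le> u\<close>.\<close>

definition parity_weight :: "'a :: one \<Rightarrow> int \<Rightarrow> 'a" where
  "parity_weight b u = (if even u then 1 else b)"

lemma transition_bernoulli:
  assumes p: "odd p"
  shows "transition k \<alpha> \<beta> \<gamma> p u v =
    (let m = (p + 1) div 2; a = of_real (periodic_ext k \<alpha> m); c = of_real (periodic_ext k \<gamma> m) in
     if v = u then (if even u then c else 1 / c) else if v = u - 1 then (if even u then a else 1 / a) else 0)"
proof -
  define a c :: complex where "a = of_real (periodic_ext k \<alpha> ((p + 1) div 2))"
    and "c = of_real (periodic_ext k \<gamma> ((p + 1) div 2))"
  have F: "step_fps k \<alpha> \<beta> \<gamma> p =
      mat_of_rows_list 2 [[fps_const c, fps_const a * fps_X], [fps_const (1 / a), fps_const (1 / c)]]"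
    using p by (simp add: step_fps_def Let_def a_def c_def)
  have X: "(fps_const a * fps_X) $ n = (if n = 1 then a else 0)" for n
    by (simp add: fps_X_def)
  have "block_toeplitz (step_fps k \<alpha> \<beta> \<gamma> p) u v =
     (if v = u then (if even u then c else 1 / c) else if v = u - 1 then (if even u then a else 1 / a) else 0)"
  proof (cases u rule: int_parity_cases)
    case (1 x)
    show ?thesis
      by (cases v rule: int_parity_cases) (auto simp: 1 block_toeplitz_def F X nat_eq_iff)
  next
    case (2 x)
    show ?thesis
      by (cases v rule: int_parity_cases) (auto simp: 2 block_toeplitz_def F X nat_eq_iff)
  qed
  then show ?thesis by (simp add: transition_eq_block_toeplitz Let_def a_def c_def)
qed

lemma transition_geometric:
  assumes p: "even p" and pos: "periodic_ext k \<beta> ((p + 1) div 2) > 0"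
  shows "transition k \<alpha> \<beta> \<gamma> p u v =
    (let b = of_real (periodic_ext k \<beta> ((p + 1) div 2)) in
     if v \<le> u then parity_weight b v / parity_weight b u else 0)"
proof -
  define b :: complex where "b = of_real (periodic_ext k \<beta> ((p + 1) div 2))"
  have b: "b \<noteq> 0" using pos by (simp add: b_def)
  have inv: "inverse (1 - fps_X) = Abs_fps (\<lambda>_. 1 :: complex)"
    by (rule fps_inverse_gp'[symmetric, THEN arg_cong[where f = inverse], simplified]) 
  have F: "step_fps k \<alpha> \<beta> \<gamma> p = mat_of_rows_list 2 [[Abs_fps (\<lambda>_. 1), fps_const b * fps_X * Abs_fps (\<lambda>_. 1)],
             [fps_const (1 / b) * Abs_fps (\<lambda>_. 1), Abs_fps (\<lambda>_. 1)]]"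
    using p by (simp only: step_fps_def Let_def b_def inv not_True_eq_False if_False)
  have X: "(fps_const b * fps_X * Abs_fps (\<lambda>_. 1)) $ n = (if n = 0 then 0 else b)" for n
    by (simp add: mult.assoc)
  have "block_toeplitz (step_fps k \<alpha> \<beta> \<gamma> p) u v =
     (if v \<le> u then parity_weight b v / parity_weight b u else 0)"
  proof (cases u rule: int_parity_cases)
    case (1 x)
    show ?thesis using b
      by (cases v rule: int_parity_cases) (auto simp: 1 block_toeplitz_def F X parity_weight_def)
  next
    case (2 x)
    show ?thesis using b
      by (cases v rule: int_parity_cases) (auto simp: 2 block_toeplitz_def F X parity_weight_def)
  qed
  then show ?thesis by (simp add: transition_eq_block_toeplitz Let_def b_def)
qed

section \<open>Total nonnegativity\<close>

lemma prod_nonneg_Reals: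
  fixes f :: "'b \<Rightarrow> complex"
  shows "(\<And>x. x \<in> A \<Longrightarrow> f x \<in> \<real>\<^sub>\<ge>\<^sub>0) \<Longrightarrow> prod f A \<in> \<real>\<^sub>\<ge>\<^sub>0"
  by (induction A rule: infinite_finite_induct) auto

lemma nonneg_Reals_cases:
  fixes z :: complex
  assumes "z \<in> \<real>\<^sub>\<ge>\<^sub>0"
  shows "0 \<le> Re z" "z = of_real (Re z)"
  using assms by (auto elim: nonneg_Reals_cases)

text \<open>If a permutation meets only nonzero entries, then \<open>v (\<sigma> i + 1) \<le> u (i +
  1) \<le> u (j + 1) - 1 \<le> v (\<sigma> j + 1)\<close> for \<open>i < j\<close>, so it is
  increasing and hence the identity. Only the diagonal product survives.\<close>

lemma det_two_band:
  fixes T :: "int \<Rightarrow> int \<Rightarrow> 'a :: comm_ring_1"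
  assumes T: "\<And>x y. T x y \<noteq> 0 \<Longrightarrow> y = x \<or> y = x - 1"
    and u: "strict_mono_on {1..r} u" and v: "strict_mono_on {1..r} v"
  shows "Determinant.det (Matrix.mat r r (\<lambda>(j, l). T (u (j + 1)) (v (l + 1)))) =
    (\<Prod>j<r. T (u (j + 1)) (v (j + 1)))"
proof -
  let ?M = "Matrix.mat r r (\<lambda>(j, l). T (u (j + 1)) (v (l + 1)))"
  let ?t = "\<lambda>\<sigma>. of_int (sign \<sigma>) * (\<Prod>i = 0..<r. T (u (i + 1)) (v (\<sigma> i + 1)))"
  have "Determinant.det ?M = (\<Sum>\<sigma> | \<sigma> permutes {0..<r}. ?t \<sigma>)"
    by (auto simp: Determinant.det_def permutes_less intro!: sum.cong)
  also have "\<dots> = (\<Sum>\<sigma>\<in>{id}. ?t \<sigma>)"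
  proof (rule sum.mono_neutral_right)
    show "finite {\<sigma>. \<sigma> permutes {0..<r}}" by (simp add: finite_permutations)
    show "{id} \<subseteq> {\<sigma>. \<sigma> permutes {0..<r}}" by (simp add: permutes_id)
    show "\<forall>\<sigma>\<in>{\<sigma>. \<sigma> permutes {0..<r}} - {id}. ?t \<sigma> = 0"
    proof (rule ccontr)
      assume "\<not> ?thesis"
      then obtain \<sigma> where \<sigma>: "\<sigma> permutes {0..<r}" "\<sigma> \<noteq> id" "?t \<sigma> \<noteq> 0"
        by blast
      have nz: "T (u (i + 1)) (v (\<sigma> i + 1)) \<noteq> 0" if "i < r" for i
      proof
        assume "T (u (i + 1)) (v (\<sigma> i + 1)) = 0"
        then have "(\<Prod>i = 0..<r. T (u (i + 1)) (v (\<sigma> i + 1))) = 0"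
          by (intro prod_zero) (use that in auto)
        with \<sigma>(3) show False by simp
      qed
      have mono: "\<sigma> i < \<sigma> j" if ij: "i < j" "j < r" for i j
      proof -
        have "u (i + 1) < u (j + 1)" by (rule strict_mono_onD[OF u]) (use ij in auto)
        then have "v (\<sigma> i + 1) \<le> v (\<sigma> j + 1)" using T[OF nz[of i]] T[OF nz[of j]] ij by auto
        moreover have "\<sigma> i < r" "\<sigma> j < r" using permutes_less[OF \<sigma>(1)] ij by auto
        ultimately have "\<not> \<sigma> j < \<sigma> i"
          using strict_mono_onD[OF v, of "\<sigma> j + 1" "\<sigma> i + 1"] by auto
        moreover have "\<sigma> i \<noteq> \<sigma> j" using permutes_inj[OF \<sigma>(1)] ij by (auto dest: injD)
        ultimately show ?thesis by simp
      qed
      have "i \<le> \<sigma> i" if "i < r" for i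
        using that
      proof (induction i)
        case (Suc i)
        then show ?case using mono[of i "Suc i"] by simp
      qed simp
      then have "\<sigma> = id"
        by (intro permutes_natset_ge[OF \<sigma>(1)]) auto
      with \<sigma>(2) show False by simp
    qed
  qed
  finally show ?thesis by (simp add: atLeast0LessThan)
qed

lemma down_closed_eq_lessThan:
  fixes A :: "nat set"
  assumes fin: "finite A" and down: "\<And>x y. y \<in> A \<Longrightarrow> x \<le> y \<Longrightarrow> x \<in> A"
  shows "A = {..<card A}"
proof (cases "A = {}")
  case False
  have "A = {..Max A}" using down[OF Max_in[OF fin False]] Max_ge[OF fin] by auto
  then show ?thesis by (metis card_atMost lessThan_Suc_atMost)
qed simp

text \<open>Each row is the indicator of an initial segment of columns, and the segments grow with
  the row. Two equal segments or an empty one give 0; otherwise their sizes increase strictly from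
  at least 1 to at most \<open>r\<close>, so row \<open>j\<close> is the segment up to
  \<open>j\<close> and the matrix is unitriangular.\<close>

lemma det_threshold:
  fixes u v :: "nat \<Rightarrow> 'b :: linorder"
  assumes u: "strict_mono_on {1..r} u" and v: "strict_mono_on {1..r} v"
  shows "Determinant.det (Matrix.mat r r (\<lambda>(j, l). if v (l + 1) \<le> u (j + 1) then 1 else 0)) \<in> {0, 1 :: 'a :: idom}"
proof -
  define M where "M = Matrix.mat r r (\<lambda>(j, l). if v (l + 1) \<le> u (j + 1) then 1 else 0 :: 'a)"
  have carr: "M \<in> carrier_mat r r" by (simp add: M_def)
  define R where "R j = {l. l < r \<and> v (l + 1) \<le> u (j + 1)}" for j
  have nth: "M $$ (j, l) = (if l \<in> R j then 1 else 0)" if "j < r" "l < r" for j l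
    using that by (simp add: M_def R_def)
  have finR: "finite (R j)" for j by (simp add: R_def)
  have down: "x \<in> R j" if "y \<in> R j" "x \<le> y" for x y j
  proof -
    have "v (x + 1) \<le> v (y + 1)"
      using that strict_mono_onD[OF v, of "x + 1" "y + 1"] by (cases "x = y") (auto simp: R_def)
    then show ?thesis using that by (auto simp: R_def)
  qed
  consider i j where "i < r" "j < r" "i \<noteq> j" "R i = R j" | j where "j < r" "R j = {}"
    | "\<forall>i<r. \<forall>j<r. i \<noteq> j \<longrightarrow> R i \<noteq> R j" "\<forall>j<r. R j \<noteq> {}"
    by (metis (no_types))
  then have "Determinant.det M \<in> {0, 1}"
  proof cases
    case (1 i j)
    have "Determinant.det M = 0"
    proof (rule det_identical_rows[of _ r i j])
      show "Matrix.row M i = Matrix.row M j"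
      proof (rule eq_vecI)
        fix l assume "l < dim_vec (Matrix.row M j)"
        then have "l < r" using carr by simp
        then show "Matrix.vec_index (Matrix.row M i) l = Matrix.vec_index (Matrix.row M j) l"
          using 1 carr by (simp add: nth)
      qed (use carr in simp)
    qed (use 1 carr in simp_all)
    then show ?thesis by simp
  next
    case (2 j)
    have "Determinant.det M = (\<Sum>l<r. M $$ (j, l) * cofactor M j l)"
      by (rule laplace_expansion_row) (use 2 carr in auto)
    also have "\<dots> = 0"
      by (rule sum.neutral) (simp add: nth 2)
    finally show ?thesis by simp
  next
    case 3
    have less: "card (R i) < card (R j)" if "i < j" "j < r" for i j
    proof (rule psubset_card_mono[OF finR])
      have "u (i + 1) < u (j + 1)" by (rule strict_mono_onD[OF u]) (use that in auto)
      then have "R i \<subseteq> R j" by (auto simp: R_def)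
      moreover have "R i \<noteq> R j" using 3(1) that by (metis less_trans nat_neq_iff)
      ultimately show "R i \<subset> R j" by blast
    qed
    have lower: "i + 1 \<le> card (R i)" if "i < r" for i
      using that
    proof (induction i)
      case 0
      then show ?case using 3(2)[rule_format, of 0] finR[of 0] by (simp add: Suc_le_eq card_gt_0_iff)
    next
      case (Suc i)
      then show ?case using less[of i "Suc i"] by simp
    qed
    have upper: "card (R j) + m \<le> card (R (j + m))" if "j + m < r" for j m
      using that
    proof (induction m)
      case (Suc m)
      then show ?case using less[of "j + m" "j + Suc m"] by simp
    qed simp
    have card_le: "card (R j) \<le> r" for j
      using card_mono[of "{..<r}" "R j"] by (auto simp: R_def)
    have Reg: "R j = {..j}" if "j < r" for j
    proof -
      \<comment> \<open>Comparison with the last row, whose segment has at most \<open>r\<close>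
        columns, gives the upper bound.\<close>
      have "card (R j) = j + 1"
        using lower[OF that] upper[of j "r - 1 - j"] card_le[of "r - 1"] that by simp
      then show ?thesis
        using down_closed_eq_lessThan[OF finR down, of j] by (simp add: lessThan_Suc_atMost)
    qed
    have "Determinant.det M = prod_list (diag_mat M)"
      by (rule det_lower_triangular[of r]) (use carr in \<open>simp_all add: nth Reg\<close>)
    also have "diag_mat M = map (\<lambda>_. 1) [0..<r]"
      unfolding diag_mat_def by (rule map_cong) (use carr in \<open>simp_all add: nth Reg\<close>)
    finally show ?thesis by (simp add: map_replicate_const)
  qed
  then show ?thesis by (simp only: M_def)
qed

lemma det_threshold_same:
  fixes u :: "nat \<Rightarrow> 'b :: linorder"
  assumes u: "strict_mono_on {1..r} u"
  shows "Determinant.det (Matrix.mat r r (\<lambda>(j, l). if u (l + 1) \<le> u (j + 1) then 1 else 0)) = (1 :: 'a :: idom)"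
proof -
  let ?M = "Matrix.mat r r (\<lambda>(j, l). if u (l + 1) \<le> u (j + 1) then 1 else 0 :: 'a)"
  have "?M $$ (i, j) = 0" if "i < j" "j < r" for i j
    using that strict_mono_onD[OF u, of "i + 1" "j + 1"] by auto
  then have "Determinant.det ?M = prod_list (diag_mat ?M)"
    by (intro det_lower_triangular[of r]) simp_all
  also have "diag_mat ?M = map (\<lambda>_. 1) [0..<r]"
    unfolding diag_mat_def by (rule map_cong) simp_all
  finally show ?thesis by (simp add: map_replicate_const)
qed

lemma periodic_ext_pos:
  assumes "k \<ge> 1" "\<And>m. m \<in> {1..k} \<Longrightarrow> a m > 0"
  shows "periodic_ext k a m > 0"
proof -
  have "(m - 1) mod k < k" using assms(1) by (intro mod_less_divisor) auto
  then show ?thesis unfolding periodic_ext_def by (intro assms(2)) auto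
qed

locale positive_weights =
  fixes k :: nat and \<alpha> \<beta> \<gamma> :: "nat \<Rightarrow> real"
  assumes k: "k \<ge> 1"
    and pos: "\<And>m. m \<in> {1..k} \<Longrightarrow> \<alpha> m > 0" "\<And>m. m \<in> {1..k} \<Longrightarrow> \<beta> m > 0" "\<And>m. m \<in> {1..k} \<Longrightarrow> \<gamma> m > 0"
begin

abbreviation "tr \<equiv> transition k \<alpha> \<beta> \<gamma>"

lemma ext_pos: "periodic_ext k \<alpha> m > 0" "periodic_ext k \<beta> m > 0" "periodic_ext k \<gamma> m > 0"
  by (rule periodic_ext_pos[OF k]; rule pos; assumption)+

definition step_det :: "nat \<Rightarrow> nat \<Rightarrow> (nat \<Rightarrow> int) \<Rightarrow> (nat \<Rightarrow> int) \<Rightarrow> complex" where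
  "step_det r p u v = Determinant.det (Matrix.mat r r (\<lambda>(j, l). tr p (u (j + 1)) (v (l + 1))))"

lemma transition_down: "tr p u v \<noteq> 0 \<Longrightarrow> v \<le> u"
  using transition_geometric[of p k \<beta> \<alpha> \<gamma> u v] transition_bernoulli[of p k \<alpha> \<beta> \<gamma> u v] ext_pos
  by (cases "even p") (auto simp: Let_def split: if_splits)

lemma transition_nonneg: "tr p u v \<in> \<real>\<^sub>\<ge>\<^sub>0"
proof (cases "even p")
  case True
  then show ?thesis using ext_pos(2)[of "(p + 1) div 2"]
    by (auto simp: transition_geometric Let_def parity_weight_def nonneg_Reals_divide_I less_imp_le)
next
  case False
  then show ?thesis using ext_pos(1,3)[of "(p + 1) div 2"]
    by (auto simp: transition_bernoulli Let_def nonneg_Reals_divide_I less_imp_le)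
qed

lemma step_det_bernoulli:
  assumes "odd p" "strict_mono_on {1..r} u" "strict_mono_on {1..r} v"
  shows "step_det r p u v = (\<Prod>j<r. tr p (u (j + 1)) (v (j + 1)))"
  unfolding step_det_def
  by (rule det_two_band) (use assms in \<open>auto simp: transition_bernoulli Let_def split: if_splits\<close>)

lemma step_det_geometric:
  fixes p defines "b \<equiv> complex_of_real (periodic_ext k \<beta> ((p + 1) div 2))"
  assumes "even p"
  shows "step_det r p u v = (\<Prod>j<r. 1 / parity_weight b (u (j + 1))) * (\<Prod>j<r. parity_weight b (v (j + 1))) *
    Determinant.det (Matrix.mat r r (\<lambda>(j, l). if v (l + 1) \<le> u (j + 1) then 1 else 0))"
proof -
  have "Matrix.mat r r (\<lambda>(j, l). tr p (u (j + 1)) (v (l + 1))) =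
     Matrix.mat r r (\<lambda>(j, l). 1 / parity_weight b (u (j + 1)) * (if v (l + 1) \<le> u (j + 1) then 1 else 0) *
        parity_weight b (v (l + 1)))"
    using assms ext_pos(2) by (intro eq_matI) (auto simp: transition_geometric Let_def)
  then show ?thesis unfolding step_det_def by (simp only: det_mat_scale)
qed

lemma step_det_nonneg:
  assumes "strict_mono_on {1..r} u" "strict_mono_on {1..r} v"
  shows "step_det r p u v \<in> \<real>\<^sub>\<ge>\<^sub>0"
proof (cases "even p")
  case True
  define b where "b = complex_of_real (periodic_ext k \<beta> ((p + 1) div 2))"
  have b: "b \<in> \<real>\<^sub>\<ge>\<^sub>0" using ext_pos(2)[of "(p + 1) div 2"] by (simp add: b_def less_imp_le)
  have "(\<Prod>j<r. 1 / parity_weight b (u (j + 1))) \<in> \<real>\<^sub>\<ge>\<^sub>0" "(\<Prod>j<r. parity_weight b (v (j + 1))) \<in> \<real>\<^sub>\<ge>\<^sub>0"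
    by (rule prod_nonneg_Reals; use b in \<open>simp add: parity_weight_def nonneg_Reals_divide_I\<close>)+
  moreover have "Determinant.det (Matrix.mat r r (\<lambda>(j, l). if v (l + 1) \<le> u (j + 1) then 1 else 0)) \<in> (\<real>\<^sub>\<ge>\<^sub>0 :: complex set)"
    using det_threshold[OF assms, where 'a = complex] by auto
  ultimately show ?thesis
    unfolding step_det_geometric[OF True] b_def[symmetric] by (intro nonneg_Reals_mult_I)
next
  case False
  then show ?thesis
    unfolding step_det_bernoulli[OF False assms] by (intro prod_nonneg_Reals transition_nonneg)
qed

text \<open>This move and the one in \<open>step_det_stay_nonzero\<close> are those of the
  configuration \<open>ground\<close>.\<close>

lemma step_det_shift_nonzero:
  assumes "odd p" "strict_mono_on {1..r} u"
  shows "step_det r p u (\<lambda>j. u j - 1) \<noteq> 0"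
proof -
  have "strict_mono_on {1..r} (\<lambda>j. u j - 1)"
    using assms(2) by (auto simp: strict_mono_on_def)
  moreover have "tr p (u j) (u j - 1) \<noteq> 0" for j
    using ext_pos(1)[of "(p + 1) div 2"] by (simp add: transition_bernoulli assms Let_def)
  ultimately show ?thesis unfolding step_det_bernoulli[OF assms(1,2) \<open>strict_mono_on {1..r} (\<lambda>j. u j - 1)\<close>] by simp
qed

lemma step_det_stay_nonzero:
  assumes "even p" "strict_mono_on {1..r} u"
  shows "step_det r p u u \<noteq> 0"
  using ext_pos(2)[of "(p + 1) div 2"]
  unfolding step_det_geometric[OF assms(1)] det_threshold_same[OF assms(2)] by (simp add: parity_weight_def)

text \<open>A nonzero determinant has a permutation without zero factors; it matches the points of
  the two levels so that every point moves down or stays. This confines the configurations of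
  nonzero weight.\<close>

lemma step_det_support:
  assumes "step_det r p u v \<noteq> 0"
  shows "j \<in> {1..r} \<Longrightarrow> \<exists>l\<in>{1..r}. v l \<le> u j" "l \<in> {1..r} \<Longrightarrow> \<exists>j\<in>{1..r}. v l \<le> u j"
proof -
  let ?t = "\<lambda>\<sigma>. of_int (sign \<sigma>) * (\<Prod>i = 0..<r. tr p (u (i + 1)) (v (\<sigma> i + 1)))"
  have "step_det r p u v = (\<Sum>\<sigma> | \<sigma> permutes {0..<r}. ?t \<sigma>)"
    by (auto simp: step_det_def Determinant.det_def permutes_less intro!: sum.cong)
  then obtain \<sigma> where \<sigma>: "\<sigma> permutes {0..<r}" "?t \<sigma> \<noteq> 0"
    using assms by (metis (mono_tags, lifting) mem_Collect_eq sum.neutral)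
  have le: "v (\<sigma> i + 1) \<le> u (i + 1)" if "i < r" for i
  proof (rule transition_down, rule notI)
    assume "tr p (u (i + 1)) (v (\<sigma> i + 1)) = 0"
    then have "(\<Prod>i = 0..<r. tr p (u (i + 1)) (v (\<sigma> i + 1))) = 0"
      by (intro prod_zero) (use that in auto)
    with \<sigma>(2) show False by simp
  qed
  show "\<exists>l\<in>{1..r}. v l \<le> u j" if "j \<in> {1..r}"
  proof -
    have "j - 1 < r" using that by auto
    then show ?thesis
      using le[of "j - 1"] permutes_less[OF \<sigma>(1), of "j - 1"] that by (intro bexI[of _ "\<sigma> (j - 1) + 1"]) auto
  qed
  show "\<exists>j\<in>{1..r}. v l \<le> u j" if "l \<in> {1..r}"
  proof -
    have "l - 1 \<in> \<sigma> ` {0..<r}" using that by (auto simp: permutes_image[OF \<sigma>(1)])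
    then obtain i where i: "i < r" "\<sigma> i = l - 1" by auto
    then show ?thesis using le[of i] that by (intro bexI[of _ "i + 1"]) auto
  qed
qed

end

section \<open>The Aztec process\<close>

locale aztec = positive_weights +
  fixes N n :: nat
  assumes N: "even N" and n: "n \<ge> k * N div 2"
begin

abbreviation "L \<equiv> k * N div 2"
abbreviation "M \<equiv> 2 * k * N"
abbreviation "r \<equiv> 2 * n"
text \<open>From the lowest end point, \<open>- kN = - 2 L\<close>, to just above the highest start
  point; both ends are even, so the window consists of whole blocks.\<close>

abbreviation "S \<equiv> {2 * (- int L)..<2 * int n}"
abbreviation "cfgs \<equiv> configurations k N n"

lemma twice_L: "2 * L = k * N"
  using N by simp

definition start :: "nat \<Rightarrow> int" where "start = (\<lambda>j\<in>{1..r}. int j - 1)"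
definition final :: "nat \<Rightarrow> int" where "final = (\<lambda>j\<in>{1..r}. - int (k * N) + int j - 1)"

abbreviation "paths \<equiv> path_configs r S M start final"
abbreviation "pw \<equiv> path_weight tr r M"

lemma start_final: "start \<in> incr_maps r S" "final \<in> incr_maps r S"
proof -
  have "int (k * N) = 2 * int L" using twice_L by (metis of_nat_mult of_nat_numeral)
  then show "start \<in> incr_maps r S" "final \<in> incr_maps r S"
    using n by (auto simp: start_def final_def incr_maps_def strict_mono_on_def)
qed

lemma config_weight_eq: "config_weight k \<alpha> \<beta> \<gamma> N n = pw"
  by (simp add: fun_eq_iff config_weight_def path_weight_def)

lemma path_weight_step_det: "path_weight tr r q u = (\<Prod>p = 1..q. step_det r p (u (p - 1)) (u p))"
  by (simp add: path_weight_def step_det_def)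

lemma step_det_cong:
  assumes "\<And>j. j \<in> {1..q} \<Longrightarrow> u j = u' j" "\<And>j. j \<in> {1..q} \<Longrightarrow> v j = v' j"
  shows "step_det q p u v = step_det q p u' v'"
  unfolding step_det_def using assms
  by (intro arg_cong[where f = Determinant.det] eq_matI) auto

lemma paths_subset: "paths \<subseteq> cfgs"
proof
  fix u assume u: "u \<in> paths"
  then have "u p \<in> incr_maps r S" if "p \<in> {0..M}" for p
    using that by (auto simp: path_configs_def PiE_def Pi_def)
  then have inc: "u p \<in> {1..r} \<rightarrow>\<^sub>E UNIV" "strict_mono_on {1..r} (u p)" if "p \<in> {0..M}" for p
    using that by (auto simp: incr_maps_def PiE_def)
  have "u 0 j = int j - 1 \<and> u M j = - int (k * N) + int j - 1" if "j \<in> {1..r}" for j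
    using u that by (simp add: path_configs_def start_def final_def)
  moreover have "u \<in> {0..M} \<rightarrow>\<^sub>E ({1..r} \<rightarrow>\<^sub>E UNIV)"
    using u inc(1) by (auto simp: path_configs_def PiE_def Pi_def)
  ultimately show "u \<in> cfgs" using inc(2) by (simp add: configurations_def)
qed

text \<open>The upper bound of the start points is carried forward level by level, the lower bound
  of the end points backward. The infinite sum defining the partition function thereby becomes
  finite.\<close>

lemma nonzero_config_in_paths:
  assumes u: "u \<in> cfgs" and nz: "pw u \<noteq> 0"
  shows "u \<in> paths"
proof -
  have int_kN: "int (k * N) = 2 * int L" using twice_L by (metis of_nat_mult of_nat_numeral)
  have nz': "step_det r p (u (p - 1)) (u p) \<noteq> 0" if "p \<in> {1..M}" for p
  proof
    assume "step_det r p (u (p - 1)) (u p) = 0"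
    then have "pw u = 0" unfolding path_weight_step_det by (intro prod_zero) (use that in auto)
    with nz show False by simp
  qed
  have ends: "u 0 j = int j - 1" "u M j = - int (k * N) + int j - 1" if "j \<in> {1..r}" for j
    using u that by (auto simp: configurations_def)
  have upper: "\<forall>l\<in>{1..r}. u p l < 2 * int n" if "p \<le> M" for p
    using that
  proof (induction p)
    case 0
    then show ?case using ends(1) by auto
  next
    case (Suc p)
    show ?case
    proof
      fix l assume l: "l \<in> {1..r}"
      obtain j where j: "j \<in> {1..r}" "u (Suc p) l \<le> u p j"
        using step_det_support(2)[OF nz'[of "Suc p"] l] Suc.prems by auto
      have "u p j < 2 * int n" using Suc j(1) by auto
      then show "u (Suc p) l < 2 * int n" using j(2) by linarith
    qed
  qed
  have lower: "\<forall>l\<in>{1..r}. - int (k * N) \<le> u (M - d) l" if "d \<le> M" for d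
    using that
  proof (induction d)
    case 0
    then show ?case using ends(2) by auto
  next
    case (Suc d)
    show ?case
    proof
      fix j assume j: "j \<in> {1..r}"
      have eq: "M - d - 1 = M - Suc d" by simp
      have "M - d \<in> {1..M}" using Suc.prems by auto
      then obtain l where l: "l \<in> {1..r}" "u (M - d) l \<le> u (M - Suc d) j"
        using step_det_support(1)[OF nz' j, of "M - d"] unfolding eq by blast
      have "- int (k * N) \<le> u (M - d) l" using Suc l(1) by auto
      then show "- int (k * N) \<le> u (M - Suc d) j" using l(2) by linarith
    qed
  qed
  have inS: "u p l \<in> S" if "p \<le> M" "l \<in> {1..r}" for p l
    using upper[of p] lower[of "M - p"] that int_kN by auto
  have inc: "u p \<in> incr_maps r S" if "p \<in> {0..M}" for p
    using u that inS[of p] by (auto simp: configurations_def incr_maps_def PiE_def Pi_def)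
  have ext: "u p \<in> extensional {1..r}" if "p \<in> {0..M}" for p
    using u that by (auto simp: configurations_def PiE_def Pi_def)
  have "u 0 = start"
    using ext[of 0] ends(1) by (auto simp: start_def extensional_def fun_eq_iff restrict_def)
  moreover have "u M = final"
    using ext[of M] ends(2) by (auto simp: final_def extensional_def fun_eq_iff restrict_def)
  moreover have "u \<in> {0..M} \<rightarrow>\<^sub>E incr_maps r S"
    using u inc by (auto simp: configurations_def PiE_def Pi_def)
  ultimately show ?thesis by (simp add: path_configs_def)
qed

lemma pw_nonneg:
  assumes "u \<in> paths"
  shows "pw u \<in> \<real>\<^sub>\<ge>\<^sub>0"
proof -
  have "u p \<in> incr_maps r S" if "p \<le> M" for p
    using that assms by (auto simp: path_configs_def PiE_def Pi_def)
  then have "strict_mono_on {1..r} (u p)" if "p \<le> M" for p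
    using that by (auto simp: incr_maps_def)
  then show ?thesis unfolding path_weight_step_det
    by (intro prod_nonneg_Reals step_det_nonneg) auto
qed

text \<open>The packed configuration that moves down by one at each odd step and rests at each even
  step. The number of odd steps up to level \<open>p\<close> is \<open>(p + 1) div 2\<close>, in
  total \<open>kN\<close>, as the end points demand.\<close>

definition ground :: "nat \<Rightarrow> nat \<Rightarrow> int" where
  "ground = (\<lambda>p\<in>{0..M}. \<lambda>j\<in>{1..r}. int j - 1 - int ((p + 1) div 2))"

lemma ground_in_paths: "ground \<in> paths"
proof -
  have int_kN: "int (k * N) = 2 * int L" using twice_L by (metis of_nat_mult of_nat_numeral)
  have le: "(p + 1) div 2 \<le> k * N" if "p \<le> M" for p using that by auto
  have "ground p \<in> incr_maps r S" if "p \<in> {0..M}" for p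
  proof -
    have "int ((p + 1) div 2) \<le> 2 * int L" using le[of p] that int_kN by (metis atLeastAtMost_iff of_nat_mono)
    then show ?thesis using that by (auto simp: ground_def incr_maps_def strict_mono_on_def)
  qed
  moreover have "ground 0 = start" by (simp add: ground_def start_def)
  moreover have "ground M = final"
  proof -
    have "(M + 1) div 2 = k * N" by simp
    then show ?thesis by (auto simp: ground_def final_def fun_eq_iff restrict_def)
  qed
  ultimately show ?thesis by (auto simp: path_configs_def ground_def PiE_def)
qed

lemma pw_ground: "pw ground \<noteq> 0"
  unfolding path_weight_step_det
proof (subst prod_zero_iff, simp, rule notI, elim bexE)
  fix p assume p: "p \<in> {1..M}" and z: "step_det r p (ground (p - 1)) (ground p) = 0"
  have mono: "strict_mono_on {1..r} (ground (p - 1))"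
    using ground_in_paths p by (auto simp: path_configs_def PiE_def Pi_def incr_maps_def)
  show False
  proof (cases "even p")
    case True
    then have "(p - 1 + 1) div 2 = (p + 1) div 2" using p by auto
    then have "step_det r p (ground (p - 1)) (ground p) = step_det r p (ground (p - 1)) (ground (p - 1))"
      using p by (intro step_det_cong) (auto simp: ground_def)
    then show False using z step_det_stay_nonzero[OF True mono] by simp
  next
    case False
    then have "(p + 1) div 2 = Suc ((p - 1 + 1) div 2)" using p by (auto elim!: oddE)
    then have "step_det r p (ground (p - 1)) (ground p) = step_det r p (ground (p - 1)) (\<lambda>j. ground (p - 1) j - 1)"
      using p by (intro step_det_cong) (auto simp: ground_def)
    then show False using z step_det_shift_nonzero[OF False mono] by simp
  qed
qed

lemma finite_paths: "finite paths"
  by (rule finite_path_configs) simp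

definition Z :: complex where "Z = (\<Sum>u\<in>paths. pw u)"

lemma Re_pw: "u \<in> paths \<Longrightarrow> 0 \<le> Re (pw u)" "u \<in> paths \<Longrightarrow> pw u = of_real (Re (pw u))"
  using nonneg_Reals_cases[OF pw_nonneg] by blast+

text \<open>Nonnegative weights cannot cancel, and \<open>ground\<close> contributes a positive
  term. By \<open>det_G\<close> this also makes \<open>G\<close> invertible.\<close>

lemma Z_pos: "Z = of_real (Re Z)" "Re Z > 0"
proof -
  have "Z = (\<Sum>u\<in>paths. of_real (Re (pw u)))" unfolding Z_def by (intro sum.cong refl Re_pw(2))
  then show *: "Z = of_real (Re Z)" by simp
  have "pw ground = of_real (Re (pw ground))" by (rule Re_pw(2)[OF ground_in_paths])
  then have "Re (pw ground) > 0"
    using pw_ground Re_pw(1)[OF ground_in_paths] by (metis less_eq_real_def of_real_0)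
  moreover have "Re Z = (\<Sum>u\<in>paths. Re (pw u))" by (simp add: Z_def)
  moreover have "Re (pw ground) \<le> (\<Sum>u\<in>paths. Re (pw u))"
    using finite_paths ground_in_paths Re_pw(1) by (intro member_le_sum) auto
  ultimately show "Re Z > 0" by simp
qed

lemma partition_function_eq: "partition_function k \<alpha> \<beta> \<gamma> N n = Z"
proof -
  have "infsum pw cfgs = infsum pw paths"
    by (rule infsum_cong_neutral) (use paths_subset nonzero_config_in_paths in auto)
  then show ?thesis unfolding partition_function_def config_weight_eq Z_def
    using finite_paths by simp
qed

lemma emeasure_process:
  assumes A: "A \<subseteq> cfgs"
  shows "emeasure (aztec_process k \<alpha> \<beta> \<gamma> N n) A = ennreal (\<Sum>u\<in>paths \<inter> A. Re (pw u) / Re Z)"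
proof -
  let ?g = "\<lambda>u. ennreal (Re (pw u / Z))"
  have zero: "?g u = 0" if "u \<in> cfgs" "u \<notin> paths" for u
  proof -
    have "pw u = 0" using nonzero_config_in_paths that by blast
    then show ?thesis by simp
  qed
  have Re: "Re (pw u / Z) = Re (pw u) / Re Z" for u
    by (subst Z_pos(1)) (simp only: Re_divide_of_real)
  have "emeasure (aztec_process k \<alpha> \<beta> \<gamma> N n) A = (\<integral>\<^sup>+ u. ?g u * indicator A u \<partial>count_space cfgs)"
    unfolding aztec_process_def partition_function_eq config_weight_eq
    by (rule emeasure_density) (use A in auto)
  also have "\<dots> = (\<Sum>u\<in>paths. ?g u * indicator A u)"
    by (rule nn_integral_count_space'[OF finite_paths _ paths_subset])
      (simp add: zero)
  also have "\<dots> = (\<Sum>u\<in>paths \<inter> A. ?g u)"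
    using finite_paths by (simp add: sum.inter_restrict indicator_def if_distrib cong: if_cong)
  also have "\<dots> = ennreal (\<Sum>u\<in>paths \<inter> A. Re (pw u) / Re Z)"
    unfolding Re using Re_pw(1) Z_pos(2) by (intro sum_ennreal) auto
  finally show ?thesis .
qed

lemma space_process: "space (aztec_process k \<alpha> \<beta> \<gamma> N n) = cfgs"
  by (simp add: aztec_process_def)

lemma prob_space_process: "prob_space (aztec_process k \<alpha> \<beta> \<gamma> N n)"
proof
  have "(\<Sum>u\<in>paths. Re (pw u) / Re Z) = 1"
    unfolding sum_divide_distrib[symmetric] using Z_pos(2) by (simp add: Z_def)
  moreover have "paths \<inter> cfgs = paths" using paths_subset by auto
  ultimately show "emeasure (aztec_process k \<alpha> \<beta> \<gamma> N n) (space (aztec_process k \<alpha> \<beta> \<gamma> N n)) = 1"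
    using emeasure_process[of cfgs] by (simp add: space_process)
qed

lemma measure_process:
  "complex_of_real (measure (aztec_process k \<alpha> \<beta> \<gamma> N n) {u \<in> cfgs. P u}) = (\<Sum>u | u \<in> paths \<and> P u. pw u) / Z"
proof -
  have eq: "paths \<inter> {u \<in> cfgs. P u} = {u. u \<in> paths \<and> P u}" using paths_subset by auto
  have m: "measure (aztec_process k \<alpha> \<beta> \<gamma> N n) {u \<in> cfgs. P u} = (\<Sum>u | u \<in> paths \<and> P u. Re (pw u) / Re Z)"
  proof -
    have "0 \<le> (\<Sum>u | u \<in> paths \<and> P u. Re (pw u) / Re Z)"
      by (intro sum_nonneg divide_nonneg_nonneg) (use Re_pw(1) Z_pos(2) in auto)
    moreover have "{u \<in> cfgs. P u} \<subseteq> cfgs" by auto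
    ultimately show ?thesis by (simp only: measure_def emeasure_process eq enn2real_ennreal)
  qed
  have "complex_of_real (\<Sum>u | u \<in> paths \<and> P u. Re (pw u) / Re Z) =
      (\<Sum>u | u \<in> paths \<and> P u. of_real (Re (pw u)) / of_real (Re Z))"
    by simp
  also have "\<dots> = (\<Sum>u | u \<in> paths \<and> P u. pw u / Z)"
    using Z_pos(1) Re_pw(2) by (intro sum.cong refl arg_cong2[where f = "(/)"]) auto
  finally show ?thesis unfolding m by (simp only: sum_divide_distrib)
qed

end

section \<open>Existence of a correlation kernel, and its evaluation from one row of the linear
  system\<close>

context aztec
begin

abbreviation "U \<equiv> propagator tr S (\<lambda>_. 1)"

definition G :: "nat \<Rightarrow> nat \<Rightarrow> complex" where
  "G j l = U (0, start (j + 1)) (M, final (l + 1))"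

lemma det_G: "Determinant.det (Matrix.mat r r (\<lambda>(j, l). G j l)) = Z"
  using sum_path_weight[OF _ start_final, of tr M "\<lambda>_. 1"]
  by (simp add: Z_def G_def propagator_def)

lemma Z_nonzero: "Z \<noteq> 0"
  using Z_pos(2) by auto

lemma exists_inverse_G:
  obtains H where "\<And>a b. a < r \<Longrightarrow> b < r \<Longrightarrow> (\<Sum>l<r. G a l * H l b) = (if a = b then 1 else 0)"
    "\<And>a b. a < r \<Longrightarrow> b < r \<Longrightarrow> (\<Sum>l<r. H a l * G l b) = (if a = b then 1 else 0)"
proof -
  define A where "A = Matrix.mat r r (\<lambda>(j, l). G j l)"
  have A: "A \<in> carrier_mat r r" by (simp add: A_def)
  have "Determinant.det A \<noteq> 0" using det_G Z_nonzero by (simp add: A_def)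
  then obtain B where B: "B \<in> carrier_mat r r" "A * B = 1\<^sub>m r" "B * A = 1\<^sub>m r"
    using det_non_zero_imp_unit[OF A, of "()"] by (auto simp: Units_def ring_mat_def)
  show thesis
  proof (rule that[of "\<lambda>i j. B $$ (i, j)"])
    fix a b assume ab: "a < r" "b < r"
    have "(A * B) $$ (a, b) = (\<Sum>l<r. G a l * B $$ (l, b))"
      using ab B(1) by (simp add: A_def scalar_prod_def atLeast0LessThan)
    then show "(\<Sum>l<r. G a l * B $$ (l, b)) = (if a = b then 1 else 0)" using ab B(2) by simp
    have "(B * A) $$ (a, b) = (\<Sum>l<r. B $$ (a, l) * G l b)"
      using ab B(1) by (simp add: A_def scalar_prod_def atLeast0LessThan)
    then show "(\<Sum>l<r. B $$ (a, l) * G l b) = (if a = b then 1 else 0)" using ab B(3) by simp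
  qed
qed

text \<open>The second property avoids any formula for the inverse of \<open>G\<close>: if the row
  \<open>X\<close> solves \<open>X G = b\<close>, with \<open>b\<close> the propagators from the
  second point to the end points, then \<open>b H = X\<close>, and the kernel sees \<open>H\<close>
  only through \<open>b H\<close>.\<close>

lemma exists_correlation_kernel:
  obtains K where
    "correlation_kernel (aztec_process k \<alpha> \<beta> \<gamma> N n) (shifted_points k N n) ({0..M} \<times> UNIV) K"
    "\<And>p p' x x' X. p \<le> M \<Longrightarrow> p' \<le> M \<Longrightarrow> x \<in> S \<Longrightarrow> x' \<in> S \<Longrightarrow>
       (\<And>l. l < r \<Longrightarrow> (\<Sum>j<r. X j * G j l) = U (p', x') (M, final (l + 1))) \<Longrightarrow>
       K (p, x - 2 * int n) (p', x' - 2 * int n) =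
         (if (p, x) = (p', x') then 1 else 0) - U (p', x') (p, x) + (\<Sum>j<r. X j * U (0, start (j + 1)) (p, x))"
proof -
  obtain H where H: "\<And>a b. a < r \<Longrightarrow> b < r \<Longrightarrow> (\<Sum>l<r. G a l * H l b) = (if a = b then 1 else 0)"
    "\<And>a b. a < r \<Longrightarrow> b < r \<Longrightarrow> (\<Sum>l<r. H a l * G l b) = (if a = b then 1 else 0)"
    using exists_inverse_G by blast
  define KK where "KK = path_kernel tr S r start M final H"
  define sh where "sh = (\<lambda>z :: nat \<times> int. (fst z, snd z + 2 * int n))"
  \<comment> \<open>The kernel is set to 0 off the window. No configuration in \<open>paths\<close>
    has points there, and a zero row gives the matching zero determinant.\<close>
  define K where "K a b = (if snd (sh a) \<in> S \<and> snd (sh b) \<in> S then KK (sh a) (sh b) else 0)" for a b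
  have inj: "inj sh" by (auto simp: inj_def sh_def prod_eq_iff)
  show thesis
  proof (rule that[of K])
    show "correlation_kernel (aztec_process k \<alpha> \<beta> \<gamma> N n) (shifted_points k N n) ({0..M} \<times> UNIV) K"
      unfolding correlation_kernel_def
    proof (intro allI impI, elim conjE)
      fix ps assume ps: "distinct ps" "set ps \<subseteq> {0..M} \<times> (UNIV :: int set)"
      have pts: "set ps \<subseteq> shifted_points k N n u \<longleftrightarrow> set (map sh ps) \<subseteq> path_points r M u" for u
      proof -
        have "z \<in> shifted_points k N n u \<longleftrightarrow> sh z \<in> path_points r M u" for z
          by (cases z) (simp add: shifted_points_def path_points_def sh_def)
        then show ?thesis unfolding set_map image_subset_iff by blast
      qed
      have lhs: "complex_of_real (measure (aztec_process k \<alpha> \<beta> \<gamma> N n)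
          {u \<in> space (aztec_process k \<alpha> \<beta> \<gamma> N n). set ps \<subseteq> shifted_points k N n u}) =
          (\<Sum>u | u \<in> paths \<and> set (map sh ps) \<subseteq> path_points r M u. pw u) / Z"
        unfolding space_process measure_process pts ..
      have rhs: "Determinant.det (Matrix.mat (length ps) (length ps) (\<lambda>(a, b). K (ps ! a) (ps ! b))) = det_on ps ps K"
        by (simp add: det_on_def)
      have "(\<Sum>u | u \<in> paths \<and> set (map sh ps) \<subseteq> path_points r M u. pw u) / Z = det_on ps ps K"
      proof (cases "\<forall>z\<in>set ps. snd (sh z) \<in> S")
        case True
        have "(\<Sum>u | u \<in> paths \<and> set (map sh ps) \<subseteq> path_points r M u. pw u) =
            Z * det_on (map sh ps) (map sh ps) KK"
          unfolding KK_def det_G[symmetric] G_def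
          by (rule eynard_mehta[OF _ start_final])
            (use H det_G Z_nonzero ps(1) inj in \<open>auto simp: G_def distinct_map intro: inj_on_subset\<close>)
        also have "det_on (map sh ps) (map sh ps) KK = det_on ps ps (\<lambda>a b. KK (sh a) (sh b))"
          unfolding det_on_def by (intro arg_cong[where f = Determinant.det] eq_matI) auto
        also have "\<dots> = det_on ps ps K"
          by (rule det_on_cong) (use True in \<open>auto simp: K_def\<close>)
        finally show ?thesis using Z_nonzero by simp
      next
        case False
        then obtain a where a: "a < length ps" "snd (sh (ps ! a)) \<notin> S"
          by (metis in_set_conv_nth)
        have "\<not> set (map sh ps) \<subseteq> path_points r M u" if "u \<in> paths" for u
        proof
          assume "set (map sh ps) \<subseteq> path_points r M u"
          moreover have "sh (ps ! a) \<in> set (map sh ps)" using a(1) by auto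
          ultimately have "sh (ps ! a) \<in> path_points r M u" by blast
          then obtain p j where pj: "p \<le> M" "j \<in> {1..r}" "u p j = snd (sh (ps ! a))"
            unfolding path_points_def by auto
          have "u p \<in> incr_maps r S" using that \<open>p \<le> M\<close> by (auto simp: path_configs_def PiE_def Pi_def)
          then have "u p \<in> {1..r} \<rightarrow>\<^sub>E S" by (simp add: incr_maps_def)
          then have "u p j \<in> S" using pj(2) by (rule PiE_mem)
          with a(2) pj(3) show False by simp
        qed
        then have 0: "{u. u \<in> paths \<and> set (map sh ps) \<subseteq> path_points r M u} = {}" by blast
        have Ka: "K (ps ! a) b = 0" for b
          using a(2) unfolding K_def by (intro if_not_P) blast
        let ?A = "Matrix.mat (length ps) (length ps) (\<lambda>(a, b). K (ps ! a) (ps ! b))"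
        have "Determinant.det ?A = (\<Sum>l<length ps. ?A $$ (a, l) * cofactor ?A a l)"
          by (rule laplace_expansion_row) (use a in auto)
        also have "\<dots> = 0"
          by (rule sum.neutral) (use a(1) in \<open>simp add: Ka\<close>)
        finally have "det_on ps ps K = 0" by (simp only: det_on_def)
        then show ?thesis unfolding 0 by simp
      qed
      then show "complex_of_real (measure (aztec_process k \<alpha> \<beta> \<gamma> N n)
          {u \<in> space (aztec_process k \<alpha> \<beta> \<gamma> N n). set ps \<subseteq> shifted_points k N n u}) =
          Determinant.det (Matrix.mat (length ps) (length ps) (\<lambda>(a, b). K (ps ! a) (ps ! b)))"
        unfolding lhs rhs .
    qed
  next
    fix p p' x x' X
    assume p: "p \<le> M" "p' \<le> M" and x: "x \<in> S" "x' \<in> S"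
      and X: "\<And>l. l < r \<Longrightarrow> (\<Sum>j<r. X j * G j l) = U (p', x') (M, final (l + 1))"
    have XH: "(\<Sum>l<r. U (p', x') (M, final (l + 1)) * H l j) = X j" if j: "j < r" for j
    proof -
      have "(\<Sum>l<r. U (p', x') (M, final (l + 1)) * H l j) = (\<Sum>l<r. (\<Sum>i<r. X i * G i l) * H l j)"
        by (intro sum.cong refl) (simp add: X)
      also have "\<dots> = (\<Sum>i<r. X i * (\<Sum>l<r. G i l * H l j))"
        unfolding sum_distrib_left sum_distrib_right by (subst sum.swap) (simp add: mult.assoc)
      also have "\<dots> = (\<Sum>i<r. if i = j then X i else 0)"
        by (intro sum.cong refl) (use j H(1) in auto)
      finally show ?thesis using j by simp
    qed
    have "(\<Sum>l<r. \<Sum>j<r. U (p', x') (M, final (l + 1)) * H l j * U (0, start (j + 1)) (p, x)) =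
        (\<Sum>j<r. (\<Sum>l<r. U (p', x') (M, final (l + 1)) * H l j) * U (0, start (j + 1)) (p, x))"
      unfolding sum_distrib_right by (rule sum.swap)
    also have "\<dots> = (\<Sum>j<r. X j * U (0, start (j + 1)) (p, x))"
      by (intro sum.cong refl) (use XH in auto)
    finally have "(\<Sum>l<r. \<Sum>j<r. U (p', x') (M, final (l + 1)) * H l j * U (0, start (j + 1)) (p, x)) =
      (\<Sum>j<r. X j * U (0, start (j + 1)) (p, x))" .
    moreover have "sh (p, x - 2 * int n) = (p, x)" "sh (p', x' - 2 * int n) = (p', x')" by (auto simp: sh_def)
    ultimately show "K (p, x - 2 * int n) (p', x' - 2 * int n) =
         (if (p, x) = (p', x') then 1 else 0) - U (p', x') (p, x) + (\<Sum>j<r. X j * U (0, start (j + 1)) (p, x))"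
      using x by (simp add: K_def KK_def path_kernel_def)
  qed
qed

end

section \<open>Contour integrals and expansions at infinity\<close>

text \<open>The contour winds once around every point of \<open>K\<close>, so by the residue theorem
  it may be replaced by any large circle, over which the integral is of order
  \<open>1 / R\<close>.\<close>

lemma contour_integral_decay:
  assumes K: "finite K" and f: "f holomorphic_on - K"
    and c: "valid_path c" "pathfinish c = pathstart c" "path_image c \<inter> K = {}"
    and wn: "\<And>z. z \<in> K \<Longrightarrow> winding_number c z = 1"
    and bound: "\<And>z. norm z \<ge> R0 \<Longrightarrow> norm (f z) \<le> B / (norm z)\<^sup>2"
  shows "contour_integral c f = 0"
proof -
  obtain R2 where R2: "\<And>z. z \<in> K \<Longrightarrow> norm z \<le> R2"
    using finite_imp_bounded[OF K] by (auto simp: bounded_iff)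
  define R1 where "R1 = max (max 1 R0) R2 + 1"
  have R1: "R1 > 1" "R1 > R0" "\<And>z. z \<in> K \<Longrightarrow> norm z < R1"
    using R2 by (fastforce simp: R1_def)+
  have res: "contour_integral \<gamma> f = complex_of_real (2 * pi) * \<i> * (\<Sum>p\<in>K. residue f p)"
    if "valid_path \<gamma>" "pathfinish \<gamma> = pathstart \<gamma>" "path_image \<gamma> \<inter> K = {}"
      "\<And>z. z \<in> K \<Longrightarrow> winding_number \<gamma> z = 1" for \<gamma>
  proof -
    have "contour_integral \<gamma> f = complex_of_real (2 * pi) * \<i> * (\<Sum>p\<in>K. winding_number \<gamma> p * residue f p)"
      by (rule Residue_theorem[of UNIV]) (use that K f in \<open>auto simp: Compl_eq_Diff_UNIV\<close>)
    also have "(\<Sum>p\<in>K. winding_number \<gamma> p * residue f p) = (\<Sum>p\<in>K. residue f p)"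
      using that(4) by (intro sum.cong) auto
    finally show ?thesis .
  qed
  have le: "norm (contour_integral c f) \<le> 2 * pi * B / R" if R: "R \<ge> R1" for R
  proof -
    have R0: "R > 0" "R \<ge> R0" using R R1 by auto
    have im: "path_image (circlepath 0 R) \<inter> K = {}"
      using R R0 by (auto simp: path_image_circlepath dest!: R1(3))
    have "contour_integral c f = contour_integral (circlepath 0 R) f"
    proof (subst res[OF c wn], assumption, subst res)
      show "winding_number (circlepath 0 R) z = 1" if "z \<in> K" for z
        using R R1(3)[OF that] by (intro winding_number_circlepath) auto
    qed (use im in auto)
    moreover have "norm (contour_integral (circlepath 0 R) f) \<le> B / R\<^sup>2 * (2 * pi * R)"
    proof (rule has_contour_integral_bound_circlepath)
      have "f contour_integrable_on circlepath 0 R"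
        by (rule contour_integrable_holomorphic_simple[OF f])
          (use im K in \<open>auto simp: open_Compl finite_imp_closed\<close>)
      then show "(f has_contour_integral contour_integral (circlepath 0 R) f) (circlepath 0 R)"
        by (rule has_contour_integral_integral)
      have "norm (f (of_real R)) \<le> B / R\<^sup>2" using bound[of "of_real R"] R0 by auto
      then show "0 \<le> B / R\<^sup>2" using norm_ge_zero order_trans by blast
      show "norm (f x) \<le> B / R\<^sup>2" if "norm (x - 0) = R" for x
        using bound[of x] that R0 by auto
    qed (use R0 in auto)
    ultimately show ?thesis using R0 by (simp add: power2_eq_square field_simps)
  qed
  have "norm (contour_integral c f) \<le> 0"
  proof (rule tendsto_lowerbound)
    show "((\<lambda>R. 2 * pi * B / R) \<longlongrightarrow> 0) at_top" by real_asymp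
    show "\<forall>\<^sub>F R in at_top. norm (contour_integral c f) \<le> 2 * pi * B / R"
      using le by (auto simp: eventually_at_top_linorder)
  qed auto
  then show ?thesis by simp
qed

lemma contour_integral_powi:
  assumes c: "valid_path c" "pathfinish c = pathstart c" "0 \<notin> path_image c" "winding_number c 0 = 1"
  shows "((\<lambda>z. z powi a) has_contour_integral (if a = -1 then 2 * of_real pi * \<i> else 0)) c"
proof (cases "a = -1")
  case True
  have eq: "(\<lambda>z::complex. z powi a) = (\<lambda>z. 1 / (z - 0))"
    using True by (simp add: power_int_minus divide_inverse)
  show ?thesis unfolding eq using has_contour_integral_winding_number[OF c(1,3)] c(4) True by simp
next
  case False
  then have nz: "of_int (a + 1) \<noteq> (0 :: complex)" by (metis add.commute add_eq_0_iff of_int_eq_0_iff)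
  have "((\<lambda>z. z powi a) has_contour_integral 0) c"
  proof (rule Cauchy_theorem_primitive[of "- {0}"])
    fix x :: complex assume "x \<in> - {0}"
    then have "((\<lambda>z. z powi (a + 1) / of_int (a + 1)) has_field_derivative
        of_int (a + 1) * x powi (a + 1 - 1) * 1 / of_int (a + 1)) (at x within - {0})"
      by (intro DERIV_cdivide DERIV_power_int DERIV_ident) auto
    also have "of_int (a + 1) * x powi (a + 1 - 1) * 1 / of_int (a + 1) = x powi a" using nz by simp
    finally show "((\<lambda>z. z powi (a + 1) / of_int (a + 1)) has_field_derivative x powi a) (at x within - {0})" .
  qed (use c in auto)
  then show ?thesis using False by simp
qed

text \<open>Subtracting the terms of the expansion up to order \<open>d\<close> leaves an integrand
  that decays like the inverse square of \<open>z\<close>, whose integral vanishes; among the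
  subtracted powers only \<open>1 / z\<close> has a nonzero integral.\<close>

lemma contour_integral_coeff_at_infinity:
  fixes d :: int and F :: "complex fps"
  assumes K: "finite K" "0 \<in> K" and f: "f holomorphic_on - K"
    and c: "valid_path c" "pathfinish c = pathstart c" "path_image c \<inter> K = {}"
    and wn: "\<And>z. z \<in> K \<Longrightarrow> winding_number c z = 1"
    and g: "g has_fps_expansion F" and fg: "\<forall>\<^sub>F t in at 0. f (1 / t) = g t"
  shows "contour_integral c (\<lambda>z. z powi (d - 1) * f z) = 2 * of_real pi * \<i> * (if d < 0 then 0 else F $ nat d)"
proof -
  \<comment> \<open>Number of subtracted terms, chosen so that \<open>z powi (d - 1)\<close> times
    \<open>t ^ n\<close> has exponent at most -2 in \<open>z\<close>; for negative \<open>d\<close>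
    nothing is subtracted.\<close>
  define n where "n = nat (d + 1)"
  define q where "q z = (\<Sum>i<n. F $ i * z powi (d - 1 - int i))" for z :: complex
  define r where "r z = z powi (d - 1) * f z - q z" for z
  have 0: "0 \<notin> path_image c" "winding_number c 0 = 1" using c K wn by auto
  have sub: "- K \<subseteq> - {0}" using K by auto
  have hol_q: "q holomorphic_on - K" unfolding q_def using K(2)
    by (intro holomorphic_intros) auto
  have hol_z: "(\<lambda>z. z powi (d - 1)) holomorphic_on - K" using K(2) by (intro holomorphic_intros) auto
  have hol_r: "r holomorphic_on - K" unfolding r_def by (intro holomorphic_intros hol_q hol_z f)
  have int_q: "(q has_contour_integral (\<Sum>i<n. F $ i * (if d - 1 - int i = -1 then 2 * of_real pi * \<i> else 0))) c"
    unfolding q_def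
    by (intro has_contour_integral_sum has_contour_integral_lmul contour_integral_powi c 0) auto
  have sum_eq: "(\<Sum>i<n. F $ i * (if d - 1 - int i = -1 then 2 * of_real pi * \<i> else 0)) =
      2 * of_real pi * \<i> * (if d < 0 then 0 else F $ nat d)"
  proof (cases "d < 0")
    case False
    then have "(\<Sum>i<n. F $ i * (if d - 1 - int i = -1 then 2 * of_real pi * \<i> else 0)) =
        (\<Sum>i<n. if i = nat d then F $ i * (2 * of_real pi * \<i>) else 0)"
      by (intro sum.cong) auto
    also have "\<dots> = F $ nat d * (2 * of_real pi * \<i>)" using False by (auto simp: n_def)
    finally show ?thesis using False by simp
  qed (simp add: n_def)
  obtain h where h: "h has_fps_expansion fps_shift n F" "\<forall>\<^sub>F t in at 0. f (1 / t) = (\<Sum>i<n. F $ i * t ^ i) + t ^ n * h t"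
  proof -
    define h where "h = eval_fps (fps_shift n F)"
    have rad: "fps_conv_radius F > 0" using g by (simp add: has_fps_expansion_def)
    have h: "h has_fps_expansion fps_shift n F"
      unfolding h_def using rad by (intro eval_fps_has_fps_expansion) simp
    have "\<forall>\<^sub>F t in nhds 0. eval_fps F t = g t" using g by (simp add: has_fps_expansion_def)
    then have 1: "\<forall>\<^sub>F t in at 0. eval_fps F t = g t" by (rule filter_leD[OF at_within_le_nhds])
    have "\<forall>\<^sub>F t in nhds (0::complex). t \<in> eball 0 (fps_conv_radius F)"
      using rad by (intro eventually_nhds_in_open) (auto simp: zero_ereal_def)
    then have 2: "\<forall>\<^sub>F t in at (0::complex). t \<in> eball 0 (fps_conv_radius F)" by (rule filter_leD[OF at_within_le_nhds])
    have "\<forall>\<^sub>F t in at 0. f (1 / t) = (\<Sum>i<n. F $ i * t ^ i) + t ^ n * h t"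
      using fg 1 2
    proof eventually_elim
      case (elim t)
      then have t: "ereal (norm t) < fps_conv_radius F" by (simp add: in_eball_iff)
      have s: "summable (\<lambda>i. F $ i * t ^ i)" using t by (rule summable_fps)
      have "eval_fps F t = (\<Sum>i. F $ (i + n) * t ^ (i + n)) + (\<Sum>i<n. F $ i * t ^ i)"
        unfolding eval_fps_def by (rule suminf_split_initial_segment[OF s])
      also have "(\<Sum>i. F $ (i + n) * t ^ (i + n)) = (\<Sum>i. t ^ n * (F $ (i + n) * t ^ i))"
        by (simp add: power_add mult_ac)
      also have "\<dots> = t ^ n * h t"
        unfolding h_def eval_fps_def fps_shift_nth
        by (rule suminf_mult) (use t summable_fps[of t "fps_shift n F"] in simp)
      finally show ?case using elim by simp
    qed
    with h show thesis by (rule that)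
  qed
  have "continuous (at 0) h"
    using has_fps_expansion_imp_continuous[OF h(1), of UNIV] by simp
  then have "(h \<longlongrightarrow> h 0) (at 0)" by (simp add: isCont_def)
  then have "\<forall>\<^sub>F t in at 0. norm (h t) < norm (h 0) + 1"
    by (intro order_tendstoD(2)[OF tendsto_norm]) auto
  with h(2) have "\<forall>\<^sub>F t in at 0. norm (h t) < norm (h 0) + 1 \<and> f (1 / t) = (\<Sum>i<n. F $ i * t ^ i) + t ^ n * h t"
    by eventually_elim auto
  then obtain e where e: "e > 0" "\<And>t. t \<noteq> 0 \<Longrightarrow> dist t 0 < e \<Longrightarrow> norm (h t) < norm (h 0) + 1 \<and>
      f (1 / t) = (\<Sum>i<n. F $ i * t ^ i) + t ^ n * h t"
    unfolding eventually_at by auto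
  have bound: "norm (r z) \<le> (norm (h 0) + 1) / (norm z)\<^sup>2" if z: "norm z \<ge> 1 + 1 / e" for z
  proof -
    have z1: "norm z \<ge> 1" "norm z > 1 / e" using z e(1) by (auto intro: order_trans[rotated] less_le_trans[rotated])
    then have z0: "z \<noteq> 0" by auto
    have "norm (1 / z) < e" using z1 e(1) z0 by (simp add: norm_divide field_simps)
    then have t: "norm (h (1 / z)) < norm (h 0) + 1" "f z = (\<Sum>i<n. F $ i * (1 / z) ^ i) + (1 / z) ^ n * h (1 / z)"
      using e(2)[of "1 / z"] z0 by auto
    have p: "z powi (d - 1) * (1 / z) ^ i = z powi (d - 1 - int i)" for i
      using z0 by (simp add: power_int_diff power_inverse divide_inverse)
    have "r z = z powi (d - 1 - int n) * h (1 / z)"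
      unfolding r_def t(2) q_def p[symmetric]
      by (simp add: algebra_simps sum_distrib_left)
    then have "norm (r z) = norm z powi (d - 1 - int n) * norm (h (1 / z))"
      by (simp add: norm_mult norm_power_int)
    also have "\<dots> \<le> norm z powi (-2) * (norm (h 0) + 1)"
      using z1(1) t(1) by (intro mult_mono power_int_increasing) (auto simp: n_def)
    also have "\<dots> = (norm (h 0) + 1) / (norm z)\<^sup>2"
      by (simp add: power_int_minus divide_inverse mult.commute)
    finally show ?thesis .
  qed
  have "contour_integral c r = 0"
    by (rule contour_integral_decay[OF K(1) hol_r c wn bound])
  moreover have "(r has_contour_integral contour_integral c r) c"
    by (rule has_contour_integral_integral, rule contour_integrable_holomorphic_simple[OF hol_r])
      (use c K in \<open>auto simp: open_Compl finite_imp_closed\<close>)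
  ultimately have "(r has_contour_integral 0) c" by simp
  from has_contour_integral_add[OF this int_q] show ?thesis
    unfolding sum_eq by (intro contour_integral_unique) (simp add: r_def)
qed

text \<open>The factor \<open>z / (z - w)\<close> expands at infinity as the geometric series in
  \<open>w t\<close>, so the integral is a coefficient of a Cauchy product.\<close>

lemma contour_integral_coeff_cauchy_kernel:
  fixes F :: "complex fps"
  assumes K: "finite K" "0 \<in> K" and b: "b holomorphic_on - K"
    and c: "valid_path c" "pathfinish c = pathstart c" "path_image c \<inter> K = {}" "w \<notin> path_image c"
    and wn: "\<And>z. z \<in> K \<Longrightarrow> winding_number c z = 1" "winding_number c w = 1"
    and F: "(\<lambda>t. b (1 / t)) has_fps_expansion F"
  shows "contour_integral c (\<lambda>z. z ^ d * b z / (z - w)) = 2 * of_real pi * \<i> * (\<Sum>i\<le>d. F $ i * w ^ (d - i))"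
proof -
  let ?K = "insert w K"
  have geo: "(\<lambda>t. 1 / (1 - w * t)) has_fps_expansion inverse (1 - fps_const w * fps_X)"
  proof -
    have "(\<lambda>t. inverse (1 - w * t)) has_fps_expansion inverse (1 - fps_const w * fps_X)"
      by (intro fps_expansion_intros) auto
    then show ?thesis by (simp add: divide_inverse)
  qed
  have geo_nth: "inverse (1 - fps_const w * fps_X) = Abs_fps (\<lambda>i. w ^ i)"
    using one_minus_const_fps_X_neg_power'[of 1 w] by simp
  have "contour_integral c (\<lambda>z. z powi (int d - 1) * (z * b z / (z - w))) =
     2 * of_real pi * \<i> * (if int d < 0 then 0 else (F * inverse (1 - fps_const w * fps_X)) $ nat (int d))"
  proof (rule contour_integral_coeff_at_infinity[where K = ?K])
    show "(\<lambda>z. z * b z / (z - w)) holomorphic_on - ?K"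
      by (intro holomorphic_intros holomorphic_on_subset[OF b]) auto
    show "(\<lambda>t. b (1 / t) * (1 / (1 - w * t))) has_fps_expansion F * inverse (1 - fps_const w * fps_X)"
      by (rule has_fps_expansion_mult[OF F geo])
    show "\<forall>\<^sub>F t in at 0. 1 / t * b (1 / t) / (1 / t - w) = b (1 / t) * (1 / (1 - w * t))"
      using eventually_neq_at_within[of 0 0 UNIV]
    proof eventually_elim
      case (elim t)
      then have "1 / t - w = (1 - w * t) / t" by (simp add: field_simps)
      then show ?case using elim by simp
    qed
  qed (use K c wn in auto)
  also have "(F * inverse (1 - fps_const w * fps_X)) $ nat (int d) = (\<Sum>i\<le>d. F $ i * w ^ (d - i))"
    unfolding geo_nth by (simp add: fps_mult_nth atLeast0AtMost)
  finally have "contour_integral c (\<lambda>z. z powi (int d - 1) * (z * b z / (z - w))) =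
      2 * of_real pi * \<i> * (\<Sum>i\<le>d. F $ i * w ^ (d - i))" by simp
  moreover have "contour_integral c (\<lambda>z. z powi (int d - 1) * (z * b z / (z - w))) =
      contour_integral c (\<lambda>z. z ^ d * b z / (z - w))"
  proof (rule contour_integral_eq)
    fix z assume "z \<in> path_image c"
    then have "z \<noteq> 0" using c K by auto
    then show "z powi (int d - 1) * (z * b z / (z - w)) = z ^ d * b z / (z - w)"
      by (simp add: power_int_diff)
  qed
  ultimately show ?thesis by simp
qed

section \<open>Moving contours, and the position of the loops in the plane\<close>

lemma contour_integral_same_residue:
  assumes f: "f holomorphic_on - {a}"
    and c: "valid_path c" "pathfinish c = pathstart c" "a \<notin> path_image c" "winding_number c a = 1"
    and c': "valid_path c'" "pathfinish c' = pathstart c'" "a \<notin> path_image c'" "winding_number c' a = 1"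
  shows "contour_integral c f = contour_integral c' f"
proof -
  have "contour_integral \<gamma> f = complex_of_real (2 * pi) * \<i> * residue f a"
    if "valid_path \<gamma>" "pathfinish \<gamma> = pathstart \<gamma>" "a \<notin> path_image \<gamma>" "winding_number \<gamma> a = 1" for \<gamma>
    using Residue_theorem[of UNIV "{a}" f \<gamma>] that f by (auto simp: Compl_eq_Diff_UNIV)
  then show ?thesis using c c' by metis
qed

text \<open>\<open>Q\<close> together with its outside is connected, unbounded and disjoint from
  \<open>P\<close>. If it contained \<open>x\<close>, the component of \<open>x\<close> off
  \<open>P\<close> would be unbounded. In the application this puts the point 1 inside the outer
  loop.\<close>

lemma inside_inside_loop:
  fixes P Q :: "'a :: euclidean_space set"
  assumes Q: "compact Q" "connected Q" and P: "P \<subseteq> inside Q" and x: "x \<in> inside P"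
  shows "x \<in> inside Q"
proof (rule ccontr)
  assume n: "x \<notin> inside Q"
  let ?W = "Q \<union> outside Q"
  have conn: "connected ?W" using Q by (intro connected_with_outside) (auto intro: compact_imp_closed)
  have "x \<in> ?W" using n inside_Un_outside[of Q] by blast
  moreover have "?W \<subseteq> - P" using P inside_no_overlap[of Q] inside_Int_outside[of Q] by blast
  ultimately have "?W \<subseteq> connected_component_set (- P) x" using conn by (intro connected_component_maximal)
  moreover have "bounded (connected_component_set (- P) x)" using x by (simp add: inside_def)
  ultimately have "bounded (outside Q)" by (meson bounded_subset le_sup_iff)
  then show False using unbounded_outside[OF compact_imp_bounded[OF Q(1)]] by contradiction
qed

text \<open>The loop crosses the segment from 0 to 1, which joins its outside to its inside, and
  also the ray from 1 to infinity, because the component of 1 is bounded. These two crossings are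
  positive and use up the two real points allowed.\<close>

lemma loop_avoids_nonpos_Reals:
  fixes P :: "complex set"
  assumes P: "1 \<in> inside P" "0 \<in> outside P" "card (P \<inter> \<real>) = 2"
  shows "P \<inter> \<real>\<^sub>\<le>\<^sub>0 = {}"
proof -
  have ni: "1 \<notin> outside P" using P(1) inside_Int_outside[of P] by blast
  have "\<exists>x\<in>P. x \<in> closed_segment 0 (1 :: complex)"
  proof (rule ccontr)
    assume "\<not> ?thesis"
    then have "closed_segment 0 (1 :: complex) \<subseteq> - P" by auto
    then have "connected_component (- P) 0 1"
      unfolding connected_component_def by (intro exI[of _ "closed_segment 0 1"]) auto
    then show False using outside_same_component P(2) ni by blast
  qed
  then obtain x t where x: "x \<in> P" "x = of_real t" "0 \<le> t" "t \<le> 1"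
    by (auto simp: in_segment scaleR_conv_of_real)
  moreover have "x \<noteq> 0" "x \<noteq> 1" using x(1) P(1,2) outside_no_overlap[of P] inside_no_overlap[of P] by blast+
  ultimately have t: "0 < t" "t < 1" by (auto simp: less_le)
  have "\<exists>y\<in>P. y \<in> complex_of_real ` {1..}"
  proof (rule ccontr)
    assume "\<not> ?thesis"
    then have "complex_of_real ` {1..} \<subseteq> - P" by auto
    moreover have "connected (complex_of_real ` {1..})"
      by (intro connected_continuous_image continuous_intros connected_Ici)
    moreover have "1 \<in> complex_of_real ` {1..}" by (force intro: image_eqI[of _ _ 1])
    ultimately have "complex_of_real ` {1..} \<subseteq> connected_component_set (- P) 1"
      by (intro connected_component_maximal)
    then have "bounded (complex_of_real ` {1..})" using P(1) by (auto simp: inside_def intro: bounded_subset)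
    then obtain B where B: "\<And>r. r \<ge> 1 \<Longrightarrow> norm (complex_of_real r) \<le> B" by (auto simp: bounded_iff)
    show False using B[of "max 1 (B + 1)"] by auto
  qed
  then obtain y s where y: "y \<in> P" "y = of_real s" "1 \<le> s" by auto
  have ne: "x \<noteq> y" using x y t by auto
  have fin: "finite (P \<inter> \<real>)" using P(3) by (metis card.infinite zero_neq_numeral)
  have eq: "{x, y} = P \<inter> \<real>"
    by (rule card_subset_eq[OF fin]) (use x y ne P(3) in auto)
  have np: "x \<notin> \<real>\<^sub>\<le>\<^sub>0" "y \<notin> \<real>\<^sub>\<le>\<^sub>0" using x(2) y(2,3) t by simp_all
  show ?thesis
  proof (rule equals0I)
    fix z assume z: "z \<in> P \<inter> \<real>\<^sub>\<le>\<^sub>0"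
    then have "z \<in> P \<inter> \<real>" by (auto simp: nonpos_Reals_def)
    then have "z = x \<or> z = y" unfolding eq[symmetric] by simp
    with np z show False by blast
  qed
qed

text \<open>A bounded singularity at 1 is removable and the slit plane is simply connected, so the
  loop may wind around 1 and still give 0.\<close>

lemma contour_integral_slit_bounded:
  assumes f: "f holomorphic_on - \<real>\<^sub>\<le>\<^sub>0 - {1}" and bd: "f \<in> O[at 1](\<lambda>_. 1)"
    and c: "valid_path c" "pathfinish c = pathstart c" "path_image c \<subseteq> - \<real>\<^sub>\<le>\<^sub>0 - {1}"
  shows "contour_integral c f = 0"
proof -
  have eq: "- \<real>\<^sub>\<le>\<^sub>0 = - (complex_of_real ` {..0})" by (auto simp: nonpos_Reals_def)
  have op: "open (- \<real>\<^sub>\<le>\<^sub>0 :: complex set)" by (simp add: open_Compl)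
  have "(1 :: complex) \<in> interior (- \<real>\<^sub>\<le>\<^sub>0)" by (simp add: interior_open[OF op])
  from holomorphic_on_extend[OF f this bd] obtain g where
    g: "g holomorphic_on - \<real>\<^sub>\<le>\<^sub>0" "\<And>z. z \<in> - \<real>\<^sub>\<le>\<^sub>0 - {1} \<Longrightarrow> g z = f z" by blast
  have "(g has_contour_integral 0) c"
  proof (rule Cauchy_theorem_simply_connected[OF op _ g(1)])
    show "simply_connected (- \<real>\<^sub>\<le>\<^sub>0 :: complex set)"
      unfolding eq by (rule simply_connected_slotted_complex_plane_left)
  qed (use c in auto)
  moreover have "contour_integral c f = contour_integral c g"
    by (rule contour_integral_eq) (use c(3) g(2) in \<open>metis subsetD\<close>)
  ultimately show ?thesis by (simp add: contour_integral_unique)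
qed

section \<open>Identities for matrices of size two\<close>

lemma det_2x2:
  fixes A :: "'a :: comm_ring_1 mat"
  assumes A: "A \<in> carrier_mat 2 2"
  shows "Determinant.det A = A $$ (0, 0) * A $$ (1, 1) - A $$ (0, 1) * A $$ (1, 0)"
proof -
  have d: "Determinant.det (mat_delete A 0 0) = A $$ (1, 1)" "Determinant.det (mat_delete A 0 1) = A $$ (1, 0)"
    using A by (subst det_single; auto simp: mat_delete_def)+
  have "Determinant.det A = (\<Sum>j<2. A $$ (0, j) * cofactor A 0 j)"
    by (rule laplace_expansion_row[OF A]) simp
  then show ?thesis by (simp add: cofactor_def d numeral_2_eq_2 d[unfolded One_nat_def])
qed

lemma char_poly_2x2:
  fixes A :: "'a :: comm_ring_1 mat"
  assumes A: "A \<in> carrier_mat 2 2"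
  shows "char_poly A = [:Determinant.det A, - (A $$ (0, 0) + A $$ (1, 1)), 1:]"
proof -
  have C: "char_poly_matrix A \<in> carrier_mat 2 2" using A by simp
  have "char_poly A = (char_poly_matrix A) $$ (0, 0) * (char_poly_matrix A) $$ (1, 1) -
      (char_poly_matrix A) $$ (0, 1) * (char_poly_matrix A) $$ (1, 0)"
    unfolding char_poly_def by (rule det_2x2[OF C])
  also have "\<dots> = [:- (A $$ (0, 0)), 1:] * [:- (A $$ (1, 1)), 1:] - [:- (A $$ (0, 1)):] * [:- (A $$ (1, 0)):]"
    using A by (simp add: char_poly_matrix_def)
  also have "\<dots> = [:Determinant.det A, - (A $$ (0, 0) + A $$ (1, 1)), 1:]"
    unfolding det_2x2[OF A] by (simp add: algebra_simps)
  finally show ?thesis .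
qed

lemma index_mult_2x2:
  fixes A B :: "'a :: comm_ring_1 mat"
  assumes "A \<in> carrier_mat 2 2" "B \<in> carrier_mat 2 2" "i < 2" "j < 2"
  shows "(A * B) $$ (i, j) = A $$ (i, 0) * B $$ (0, j) + A $$ (i, 1) * B $$ (1, j)"
  using assms by (simp add: scalar_prod_def numeral_2_eq_2)

lemma mat_eq_2x2:
  assumes "A \<in> carrier_mat 2 2" "B \<in> carrier_mat 2 2"
    "A $$ (0, 0) = B $$ (0, 0)" "A $$ (0, 1) = B $$ (0, 1)" "A $$ (1, 0) = B $$ (1, 0)" "A $$ (1, 1) = B $$ (1, 1)"
  shows "A = B"
proof (rule eq_matI)
  fix i j assume "i < dim_row B" "j < dim_col B"
  then have "i = 0 \<or> i = 1" "j = 0 \<or> j = 1" using assms(2) by auto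
  then show "A $$ (i, j) = B $$ (i, j)" using assms by auto
qed (use assms in auto)

text \<open>The equation \<open>(A - b) (A - a) = 0\<close>, arranged for use with
  \<open>A - b\<close>, which up to the factor \<open>a - b\<close> is the spectral projection for
  \<open>a\<close>.\<close>

lemma cayley_hamilton_2x2:
  fixes A :: "'a :: comm_ring_1 mat"
  assumes A: "A \<in> carrier_mat 2 2" and tr: "A $$ (0, 0) + A $$ (1, 1) = a + b" and det: "Determinant.det A = a * b"
  shows "(A - b \<cdot>\<^sub>m 1\<^sub>m 2) * A = a \<cdot>\<^sub>m (A - b \<cdot>\<^sub>m 1\<^sub>m 2)"
proof -
  have C: "A - b \<cdot>\<^sub>m 1\<^sub>m 2 \<in> carrier_mat 2 2"
    by (intro minus_carrier_mat smult_carrier_mat one_carrier_mat)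
  have ring: "(p - b) * p + q * r = a * (p - b) \<and> (p - b) * q + q * s = a * q \<and>
      r * p + (s - b) * r = a * r \<and> r * q + (s - b) * s = a * (s - b)"
    if "p + s = a + b" "p * s - q * r = a * b" for p q r s :: 'a
  proof -
    have s: "s = a + b - p" using that(1) by (simp add: algebra_simps)
    have "q * r = p * (a + b - p) - a * b" using that(2) by (simp add: s algebra_simps)
    moreover have "r * q = q * r" by (rule mult.commute)
    ultimately show ?thesis unfolding s by (auto simp: algebra_simps)
  qed
  have "A $$ (0, 0) * A $$ (1, 1) - A $$ (0, 1) * A $$ (1, 0) = a * b" using det det_2x2[OF A] by simp
  from ring[OF tr this] show ?thesis
    using A C by (intro mat_eq_2x2) (simp_all add: index_mult_2x2 del: index_mult_mat(1))
qed

text \<open>Classical adjoint. For determinant 1 it is the inverse, and unlike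
  \<open>mat_inv\<close> it is visibly polynomial in the entries and applies to symbols and to power
  series alike.\<close>

definition adj2 :: "'a :: comm_ring_1 mat \<Rightarrow> 'a mat" where
  "adj2 A = mat_of_rows_list 2 [[A $$ (1, 1), - A $$ (0, 1)], [- A $$ (1, 0), A $$ (0, 0)]]"

section \<open>Matrix symbols of size two\<close>

text \<open>Polynomial dependence on \<open>t = 1/z\<close>. The point \<open>z = 0\<close> can be
  included because \<open>1 / 0 = 0\<close>: there the formula returns the value at
  infinity.\<close>

definition invpoly_mat :: "nat \<Rightarrow> (complex \<Rightarrow> complex mat) \<Rightarrow> bool" where
  "invpoly_mat d F \<longleftrightarrow> (\<forall>z. F z \<in> carrier_mat 2 2) \<and>
     (\<forall>i<2. \<forall>j<2. \<exists>p. degree p \<le> d \<and> (\<forall>z. F z $$ (i, j) = poly p (1 / z)))"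

lemma invpoly_mat_carrier: "invpoly_mat d F \<Longrightarrow> F z \<in> carrier_mat 2 2"
  by (simp add: invpoly_mat_def)

lemma invpoly_matE:
  assumes "invpoly_mat d F" "i < 2" "j < 2"
  obtains p where "degree p \<le> d" "\<And>z. F z $$ (i, j) = poly p (1 / z)"
proof -
  have "\<exists>p. degree p \<le> d \<and> (\<forall>z. F z $$ (i, j) = poly p (1 / z))"
    using assms unfolding invpoly_mat_def by blast
  then show thesis using that by blast
qed

lemma invpoly_mat_one: "invpoly_mat 0 (\<lambda>_. 1\<^sub>m 2)"
  unfolding invpoly_mat_def
proof (intro conjI allI impI)
  fix i j :: nat assume "i < 2" "j < 2"
  then show "\<exists>p. degree p \<le> 0 \<and> (\<forall>z. (1\<^sub>m 2 :: complex mat) $$ (i, j) = poly p (1 / z))"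
    by (intro exI[of _ "[:of_bool (i = j):]"]) auto
qed simp

lemma invpoly_mat_mult:
  assumes F: "invpoly_mat d F" and G: "invpoly_mat e G"
  shows "invpoly_mat (d + e) (\<lambda>z. F z * G z)"
  unfolding invpoly_mat_def
proof (intro conjI allI impI)
  fix z show "F z * G z \<in> carrier_mat 2 2"
    using F G by (intro mult_carrier_mat[of _ 2 2]) (simp_all add: invpoly_mat_def)
next
  fix i j :: nat assume ij: "i < 2" "j < 2"
  obtain p0 where p0: "degree p0 \<le> d" "\<And>z. F z $$ (i, 0) = poly p0 (1 / z)"
    by (rule invpoly_matE[OF F ij(1), of 0]) auto
  obtain p1 where p1: "degree p1 \<le> d" "\<And>z. F z $$ (i, 1) = poly p1 (1 / z)"
    by (rule invpoly_matE[OF F ij(1), of 1]) auto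
  obtain q0 where q0: "degree q0 \<le> e" "\<And>z. G z $$ (0, j) = poly q0 (1 / z)"
    by (rule invpoly_matE[OF G _ ij(2), of 0]) auto
  obtain q1 where q1: "degree q1 \<le> e" "\<And>z. G z $$ (1, j) = poly q1 (1 / z)"
    by (rule invpoly_matE[OF G _ ij(2), of 1]) auto
  have "degree (p0 * q0) \<le> d + e" "degree (p1 * q1) \<le> d + e"
    using p0(1) p1(1) q0(1) q1(1) degree_mult_le[of p0 q0] degree_mult_le[of p1 q1] by linarith+
  then have "degree (p0 * q0 + p1 * q1) \<le> d + e" by (intro degree_add_le)
  moreover have "(F z * G z) $$ (i, j) = poly (p0 * q0 + p1 * q1) (1 / z)" for z
    unfolding index_mult_2x2[OF invpoly_mat_carrier[OF F] invpoly_mat_carrier[OF G] ij] p0 p1 q0 q1 by simp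
  ultimately show "\<exists>p. degree p \<le> d + e \<and> (\<forall>z. (F z * G z) $$ (i, j) = poly p (1 / z))" by blast
qed

lemma invpoly_mat_power:
  assumes "invpoly_mat d F"
  shows "invpoly_mat (d * q) (\<lambda>z. F z ^\<^sub>m q)"
proof (induction q)
  case 0
  have "F z ^\<^sub>m 0 = 1\<^sub>m 2" for z using invpoly_mat_carrier[OF assms, of z] by simp
  then show ?case using invpoly_mat_one by (simp del: pow_mat.simps)
next
  case (Suc q)
  then show ?case using invpoly_mat_mult[OF Suc.IH assms] by (simp add: algebra_simps)
qed

lemma adj2_carrier: "adj2 A \<in> carrier_mat 2 2"
  unfolding adj2_def by (rule mat_of_rows_list_2_carrier)

lemma adj2_index [simp]:
  "adj2 A $$ (0, 0) = A $$ (1, 1)" "adj2 A $$ (0, Suc 0) = - A $$ (0, 1)"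
  "adj2 A $$ (Suc 0, 0) = - A $$ (1, 0)" "adj2 A $$ (Suc 0, Suc 0) = A $$ (0, 0)"
  by (simp_all add: adj2_def)

lemma adj2_mult:
  fixes A :: "'a :: comm_ring_1 mat"
  assumes "A \<in> carrier_mat 2 2"
  shows "A * adj2 A = Determinant.det A \<cdot>\<^sub>m 1\<^sub>m 2" "adj2 A * A = Determinant.det A \<cdot>\<^sub>m 1\<^sub>m 2"
  using assms adj2_carrier[of A]
  by (intro mat_eq_2x2; simp add: index_mult_2x2 det_2x2 algebra_simps del: index_mult_mat(1))+

lemma adj2_smult:
  fixes A :: "'a :: comm_ring_1 mat"
  assumes "A \<in> carrier_mat 2 2"
  shows "adj2 (c \<cdot>\<^sub>m A) = c \<cdot>\<^sub>m adj2 A"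
  using assms adj2_carrier[of A] adj2_carrier[of "c \<cdot>\<^sub>m A"] by (intro mat_eq_2x2) simp_all

lemma less_2_cases': "i < 2 \<Longrightarrow> (i = 0 \<Longrightarrow> P) \<Longrightarrow> (i = Suc 0 \<Longrightarrow> P) \<Longrightarrow> P" for i :: nat
  by (metis One_nat_def less_2_cases)

lemma invpoly_mat_adj2:
  assumes "invpoly_mat d F"
  shows "invpoly_mat d (\<lambda>z. adj2 (F z))"
  unfolding invpoly_mat_def
proof (intro conjI allI impI)
  fix i j :: nat assume ij: "i < 2" "j < 2"
  have *: "\<exists>p. degree p \<le> d \<and> (\<forall>z. s * F z $$ (i, j) = poly p (1 / z))" if ij: "i < 2" "j < 2" for i j s
  proof -
    obtain p where "degree p \<le> d" "\<And>z. F z $$ (i, j) = poly p (1 / z)"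
      by (rule invpoly_matE[OF assms ij]) auto
    then show ?thesis by (intro exI[of _ "Polynomial.smult s p"]) (auto intro: order_trans[OF degree_smult_le])
  qed
  show "\<exists>p. degree p \<le> d \<and> (\<forall>z. adj2 (F z) $$ (i, j) = poly p (1 / z))"
    using ij *[of 1 1 1] *[of 0 1 "-1"] *[of 1 0 "-1"] *[of 0 0 1] by (elim less_2_cases') simp_all
qed (rule adj2_carrier)

lemma smult_pow_mat:
  fixes A :: "'a :: comm_ring_1 mat"
  assumes "A \<in> carrier_mat n n"
  shows "(c \<cdot>\<^sub>m A) ^\<^sub>m q = c ^ q \<cdot>\<^sub>m (A ^\<^sub>m q)"
proof (induction q)
  case 0
  then show ?case using assms by (intro eq_matI) auto
next
  case (Suc q)
  have "A ^\<^sub>m q \<in> carrier_mat n n" using assms by simp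
  then show ?case using assms Suc by (intro eq_matI) (auto simp: mult_ac)
qed

lemma pow_mat_Suc_left:
  fixes A :: "'a :: comm_ring_1 mat"
  assumes A: "A \<in> carrier_mat n n"
  shows "A ^\<^sub>m Suc q = A * A ^\<^sub>m q"
proof (induction q)
  case 0
  then show ?case using A by simp
next
  case (Suc q)
  have "A ^\<^sub>m Suc (Suc q) = A * A ^\<^sub>m q * A" using Suc by simp
  also have "\<dots> = A * (A ^\<^sub>m q * A)" using A by (intro assoc_mult_mat[of _ n n _ n _ n]) auto
  finally show ?case by simp
qed

text \<open>Integer powers without negative exponents: \<open>B\<close> plays the inverse of
  \<open>A\<close>, and the cases are the sign of \<open>a - b\<close>.\<close>

lemma pow_mat_cancel:
  fixes A B :: "'a :: comm_ring_1 mat"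
  assumes carr: "A \<in> carrier_mat n n" "B \<in> carrier_mat n n" and AB: "A * B = 1\<^sub>m n"
  shows "A ^\<^sub>m a * B ^\<^sub>m b = (if b \<le> a then A ^\<^sub>m (a - b) else B ^\<^sub>m (b - a))"
proof (induction a arbitrary: b)
  case 0
  then show ?case using carr by simp
next
  case (Suc a)
  have pc: "A ^\<^sub>m q \<in> carrier_mat n n" "B ^\<^sub>m q \<in> carrier_mat n n" for q using carr by auto
  show ?case
  proof (cases b)
    case 0
    then show ?thesis using carr pc(1)[of "Suc a"] by (simp del: pow_mat.simps(2)) 
  next
    case (Suc b')
    have B: "B ^\<^sub>m Suc b' = B * B ^\<^sub>m b'"
      by (rule pow_mat_Suc_left[OF carr(2)])
    have "A ^\<^sub>m Suc a * B ^\<^sub>m Suc b' = A ^\<^sub>m a * (A * B) * B ^\<^sub>m b'"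
      unfolding B using carr pc by (simp add: assoc_mult_mat[of _ n n _ n _ n])
    also have "\<dots> = A ^\<^sub>m a * B ^\<^sub>m b'" using carr pc by (simp add: AB)
    finally show ?thesis using Suc Suc.IH[of b'] by (simp del: pow_mat.simps)
  qed
qed

text \<open>Expansion at infinity in \<open>t = 1/z\<close>. Since \<open>1 / 0 = 0\<close>, the
  value at \<open>t = 0\<close> is \<open>F 0\<close>, which for the symbols here is the value at
  infinity, so no point has to be excepted.\<close>

definition mat_expansion :: "(complex \<Rightarrow> complex mat) \<Rightarrow> complex fps mat \<Rightarrow> bool" where
  "mat_expansion F M \<longleftrightarrow> (\<forall>z. F z \<in> carrier_mat 2 2) \<and> M \<in> carrier_mat 2 2 \<and>
     (\<forall>i<2. \<forall>j<2. (\<lambda>t. F (1 / t) $$ (i, j)) has_fps_expansion M $$ (i, j))"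

lemma mat_expansion_one: "mat_expansion (\<lambda>_. 1\<^sub>m 2) (1\<^sub>m 2)"
  by (auto simp: mat_expansion_def)

lemma mat_expansion_mult:
  assumes "mat_expansion F M" "mat_expansion G M'"
  shows "mat_expansion (\<lambda>z. F z * G z) (M * M')"
  unfolding mat_expansion_def
proof (intro conjI allI impI)
  fix i j :: nat assume ij: "i < 2" "j < 2"
  have eq: "(\<lambda>t. (F (1 / t) * G (1 / t)) $$ (i, j)) =
      (\<lambda>t. F (1 / t) $$ (i, 0) * G (1 / t) $$ (0, j) + F (1 / t) $$ (i, 1) * G (1 / t) $$ (1, j))"
    using assms ij by (simp add: mat_expansion_def index_mult_2x2 del: index_mult_mat(1))
  have eq': "(M * M') $$ (i, j) = M $$ (i, 0) * M' $$ (0, j) + M $$ (i, 1) * M' $$ (1, j)"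
    using assms ij by (simp add: mat_expansion_def index_mult_2x2 del: index_mult_mat(1))
  show "(\<lambda>t. (F (1 / t) * G (1 / t)) $$ (i, j)) has_fps_expansion (M * M') $$ (i, j)"
    unfolding eq eq' using assms ij
    by (intro has_fps_expansion_add has_fps_expansion_mult) (auto simp: mat_expansion_def)
qed (use assms in \<open>auto simp: mat_expansion_def intro!: mult_carrier_mat[of _ 2 2]\<close>)

lemma mat_expansion_power:
  assumes "mat_expansion F M"
  shows "mat_expansion (\<lambda>z. F z ^\<^sub>m q) (M ^\<^sub>m q)"
proof (induction q)
  case 0
  have "F z ^\<^sub>m 0 = 1\<^sub>m 2" "M ^\<^sub>m 0 = 1\<^sub>m 2" for z using assms
    by (auto simp: mat_expansion_def carrier_matD(1)[of _ 2 2])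
  then show ?case using mat_expansion_one by (simp del: pow_mat.simps)
next
  case (Suc q)
  then show ?case using mat_expansion_mult[OF Suc.IH assms] by simp
qed

lemma mat_expansion_adj2:
  assumes "mat_expansion F M"
  shows "mat_expansion (\<lambda>z. adj2 (F z)) (adj2 M)"
  unfolding mat_expansion_def
proof (intro conjI allI impI)
  fix i j :: nat assume ij: "i < 2" "j < 2"
  then show "(\<lambda>t. adj2 (F (1 / t)) $$ (i, j)) has_fps_expansion adj2 M $$ (i, j)"
    using assms by (elim less_2_cases') (auto simp: mat_expansion_def intro!: has_fps_expansion_minus)
qed (auto simp: adj2_carrier)

lemma mat_expansion_smult:
  assumes "mat_expansion F M" "(\<lambda>t. c (1 / t)) has_fps_expansion C"
  shows "mat_expansion (\<lambda>z. c z \<cdot>\<^sub>m F z) (C \<cdot>\<^sub>m M)"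
proof -
  have carr: "F z \<in> carrier_mat 2 2" "M \<in> carrier_mat 2 2" for z using assms by (auto simp: mat_expansion_def)
  show ?thesis
    using assms unfolding mat_expansion_def
    by (auto simp: carrier_matD[OF carr(1)] carrier_matD[OF carr(2)] intro!: has_fps_expansion_mult)
qed

lemma mat_expansion_unique:
  assumes "mat_expansion F M" "mat_expansion G M'" "\<forall>\<^sub>F t in nhds 0. F (1 / t) = G (1 / t)"
  shows "M = M'"
proof (rule eq_matI)
  fix i j assume ij: "i < dim_row M'" "j < dim_col M'"
  have 1: "(\<lambda>t. F (1 / t) $$ (i, j)) has_fps_expansion M $$ (i, j)"
    and 2: "(\<lambda>t. G (1 / t) $$ (i, j)) has_fps_expansion M' $$ (i, j)"
    using assms(1,2) ij by (auto simp: mat_expansion_def)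
  have "(\<lambda>t. F (1 / t) $$ (i, j)) has_fps_expansion M' $$ (i, j)"
    by (rule has_fps_expansion_cong[THEN iffD2, OF _ refl 2]) (use assms(3) in eventually_elim, simp)
  with 1 show "M $$ (i, j) = M' $$ (i, j)" by (rule fps_expansion_unique_complex)
qed (use assms(1,2) in \<open>auto simp: mat_expansion_def\<close>)

lemma foldr_mat_mult:
  fixes As :: "'a :: comm_ring_1 mat list"
  assumes "\<And>A. A \<in> set As \<Longrightarrow> A \<in> carrier_mat n n" "B \<in> carrier_mat n n"
  shows "foldr (*) As B = foldr (*) As (1\<^sub>m n) * B" "foldr (*) As B \<in> carrier_mat n n"
proof -
  have c: "foldr (*) As C \<in> carrier_mat n n" if "C \<in> carrier_mat n n" for C
    using assms(1) that by (induction As) (auto intro!: mult_carrier_mat[of _ n n])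
  show "foldr (*) As B \<in> carrier_mat n n" by (rule c[OF assms(2)])
  show "foldr (*) As B = foldr (*) As (1\<^sub>m n) * B"
    using assms(1)
  proof (induction As)
    case (Cons A As)
    have A: "A \<in> carrier_mat n n" using Cons.prems by simp
    have "foldr (*) As (1\<^sub>m n) \<in> carrier_mat n n"
      using Cons.prems by (induction As) (auto intro!: mult_carrier_mat[of _ n n])
    then show ?case using Cons A assms(2) by (simp add: assoc_mult_mat[of _ n n _ n _ n])
  qed (use assms(2) in simp)
qed

lemma fps_mat_prod_add:
  assumes "\<And>p. F p \<in> carrier_mat 2 2"
  shows "fps_mat_prod F p (d + e) = fps_mat_prod F p d * fps_mat_prod F (p + d) e"
proof (induction e)
  case 0
  then show ?case using fps_mat_prod_carrier[of F p d, OF assms] by simp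
next
  case (Suc e)
  have "fps_mat_prod F p (d + Suc e) = fps_mat_prod F p d * fps_mat_prod F (p + d) e * F (Suc (p + d + e))"
    using Suc by (simp add: add.assoc)
  also have "\<dots> = fps_mat_prod F p d * fps_mat_prod F (p + d) (Suc e)"
    using assoc_mult_mat[OF fps_mat_prod_carrier[of F p d, OF assms] fps_mat_prod_carrier[of F "p + d" e, OF assms]
        assms[of "Suc (p + d + e)"]] by simp
  finally show ?case .
qed

text \<open>Periodicity is asked from step 1 on: steps are numbered from 1, and
  \<open>periodic_ext\<close> need not be periodic at index 0, where natural subtraction
  truncates.\<close>

lemma fps_mat_prod_periodic:
  assumes carr: "\<And>p. F p \<in> carrier_mat 2 2" and per: "\<And>p. p \<ge> 1 \<Longrightarrow> F (p + c) = F p"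
  shows "fps_mat_prod F (c * a) (c * d) = fps_mat_prod F 0 c ^\<^sub>m d"
proof -
  have sh: "fps_mat_prod F (p + c) d = fps_mat_prod F p d" for p d
  proof (induction d)
    case (Suc d)
    have "F (Suc (p + c + d)) = F (Suc (p + d))" using per[of "Suc (p + d)"] by (simp add: ac_simps)
    then show ?case using Suc by simp
  qed simp
  have sh': "fps_mat_prod F (c * a) d = fps_mat_prod F 0 d" for a d
    by (induction a) (use sh[of "c * _"] in \<open>simp_all add: add.commute\<close>)
  show ?thesis
  proof (induction d)
    case 0
    then show ?case using fps_mat_prod_carrier[of F 0 c, OF carr] by simp
  next
    case (Suc d)
    have "fps_mat_prod F (c * a) (c * Suc d) = fps_mat_prod F (c * a) (c * d) * fps_mat_prod F (c * (a + d)) c"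
      using fps_mat_prod_add[of F "c * a" "c * d" c, OF carr] by (simp add: algebra_simps)
    then show ?case using Suc sh' by simp
  qed
qed

lemma bernoulli_mat_carrier: "bernoulli_mat a c z \<in> carrier_mat 2 2"
  unfolding bernoulli_mat_def by (rule mat_of_rows_list_2_carrier)

lemma geometric_mat_carrier: "geometric_mat b z \<in> carrier_mat 2 2"
  unfolding geometric_mat_def by (rule mat_of_rows_list_2_carrier)

lemma det_bernoulli_geometric:
  assumes "a > 0" "b > 0" "c > 0"
  shows "Determinant.det (bernoulli_mat a c z * geometric_mat b z) = (1 - 1 / z)\<^sup>2"
proof -
  have "Determinant.det (bernoulli_mat a c z) = 1 - 1 / z"
    using assms by (simp add: det_2x2 bernoulli_mat_carrier) (simp add: bernoulli_mat_def)
  moreover have "Determinant.det (geometric_mat b z) = 1 - 1 / z"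
    using assms by (simp add: det_2x2 geometric_mat_carrier) (simp add: geometric_mat_def)
  ultimately show ?thesis
    by (simp add: Determinant.det_mult[OF bernoulli_mat_carrier geometric_mat_carrier] power2_eq_square)
qed

lemma invpoly_mat_bernoulli_geometric:
  "invpoly_mat 1 (\<lambda>z. bernoulli_mat a c z * geometric_mat b z)"
  unfolding invpoly_mat_def
proof (intro conjI allI impI)
  fix z show "bernoulli_mat a c z * geometric_mat b z \<in> carrier_mat 2 2"
    by (rule mult_carrier_mat[OF bernoulli_mat_carrier geometric_mat_carrier])
next
  fix i j :: nat assume ij: "i < 2" "j < 2"
  define A B C :: complex where "A = of_real a" and "B = of_real b" and "C = of_real c"
  define p where "p = (if i = 0 then if j = 0 then [:C, A / B:] else [:0, C * B + A:]
     else if j = 0 then [:1 / A + 1 / (C * B):] else [:1 / C, B / A:])"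
  have "degree p \<le> 1" by (auto simp: p_def)
  moreover have "(bernoulli_mat a c z * geometric_mat b z) $$ (i, j) = poly p (1 / z)" for z
    unfolding index_mult_2x2[OF bernoulli_mat_carrier geometric_mat_carrier ij]
    using ij by (elim less_2_cases')
      (simp_all add: bernoulli_mat_def geometric_mat_def p_def A_def B_def C_def divide_inverse algebra_simps)
  ultimately show "\<exists>p. degree p \<le> 1 \<and> (\<forall>z. (bernoulli_mat a c z * geometric_mat b z) $$ (i, j) = poly p (1 / z))"
    by blast
qed

text \<open>Positivity of the numerator at \<open>z = 1\<close> makes its trace nonzero there, which
  keeps the spectral projection bounded at the pole of the symbol.\<close>

definition pos_entries :: "complex mat \<Rightarrow> bool" where
  "pos_entries A \<longleftrightarrow> A \<in> carrier_mat 2 2 \<and> (\<forall>i<2. \<forall>j<2. \<exists>x>0. A $$ (i, j) = of_real x)"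

lemma pos_entries_mult:
  assumes "pos_entries A" "pos_entries B"
  shows "pos_entries (A * B)"
  unfolding pos_entries_def
proof (intro conjI allI impI)
  have c: "A \<in> carrier_mat 2 2" "B \<in> carrier_mat 2 2" using assms by (auto simp: pos_entries_def)
  then show "A * B \<in> carrier_mat 2 2" by (rule mult_carrier_mat)
  fix i j :: nat assume ij: "i < 2" "j < 2"
  have ex: "\<exists>x>0. A $$ (i, l) = of_real x" "\<exists>x>0. B $$ (l, j) = of_real x" if "l < 2" for l
    using assms ij that unfolding pos_entries_def by blast+
  obtain x0 x1 y0 y1 where "x0 > 0" "x1 > 0" "y0 > 0" "y1 > 0" "A $$ (i, 0) = of_real x0" "A $$ (i, 1) = of_real x1"
    "B $$ (0, j) = of_real y0" "B $$ (1, j) = of_real y1"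
    using ex[of 0] ex[of 1] by auto
  then show "\<exists>x>0. (A * B) $$ (i, j) = of_real x"
    unfolding index_mult_2x2[OF c ij] by (intro exI[of _ "x0 * y0 + x1 * y1"]) (auto intro: add_pos_pos)
qed

lemma pos_entries_bernoulli_geometric:
  assumes "a > 0" "b > 0" "c > 0"
  shows "pos_entries (bernoulli_mat a c 1 * geometric_mat b 1)"
proof (rule pos_entries_mult)
  show "pos_entries (bernoulli_mat a c 1)" unfolding pos_entries_def
  proof (intro conjI allI impI)
    fix i j :: nat assume "i < 2" "j < 2"
    then show "\<exists>x>0. bernoulli_mat a c 1 $$ (i, j) = of_real x"
      by (intro exI[of _ "if i = 0 then if j = 0 then c else a else if j = 0 then 1 / a else 1 / c"])
        (use assms in \<open>elim less_2_cases'; simp add: bernoulli_mat_def\<close>)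
  qed (rule bernoulli_mat_carrier)
  show "pos_entries (geometric_mat b 1)" unfolding pos_entries_def
  proof (intro conjI allI impI)
    fix i j :: nat assume "i < 2" "j < 2"
    then show "\<exists>x>0. geometric_mat b 1 $$ (i, j) = of_real x"
      by (intro exI[of _ "if i = j then 1 else if i = 0 then b else 1 / b"])
        (use assms in \<open>elim less_2_cases'; simp add: geometric_mat_def\<close>)
  qed (rule geometric_mat_carrier)
qed

section \<open>Determinant, inverse and expansion at infinity of the matrix symbol\<close>

context positive_weights
begin

text \<open>The product without its scalar denominator, cut after \<open>q\<close> factors so that
  inductions over the factors are possible.\<close>

definition numer :: "nat \<Rightarrow> complex \<Rightarrow> complex mat" where
  "numer q z = foldr (*) (map (\<lambda>m. bernoulli_mat (\<alpha> m) (\<gamma> m) z * geometric_mat (\<beta> m) z) [1..<Suc q]) (1\<^sub>m 2)"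

abbreviation "\<Phi> \<equiv> Phi k \<alpha> \<beta> \<gamma>"

lemma Phi_numer: "\<Phi> z = (1 / (1 - 1 / z) ^ k) \<cdot>\<^sub>m numer k z"
  by (simp add: Phi_def numer_def)

lemma numer_0: "numer 0 z = 1\<^sub>m 2"
  by (simp add: numer_def)

lemma numer_Suc: "numer (Suc q) z = numer q z * (bernoulli_mat (\<alpha> (Suc q)) (\<gamma> (Suc q)) z * geometric_mat (\<beta> (Suc q)) z)"
proof -
  let ?f = "\<lambda>m. bernoulli_mat (\<alpha> m) (\<gamma> m) z * geometric_mat (\<beta> m) z"
  have c: "?f m \<in> carrier_mat 2 2" for m by (rule mult_carrier_mat[OF bernoulli_mat_carrier geometric_mat_carrier])
  have "numer (Suc q) z = foldr (*) (map ?f [1..<Suc q]) (?f (Suc q) * 1\<^sub>m 2)"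
    by (simp add: numer_def)
  also have "?f (Suc q) * 1\<^sub>m 2 = ?f (Suc q)" by (rule right_mult_one_mat[OF c])
  also have "foldr (*) (map ?f [1..<Suc q]) (?f (Suc q)) = numer q z * ?f (Suc q)"
    unfolding numer_def by (rule foldr_mat_mult(1)) (use c in auto)
  finally show ?thesis .
qed

lemma numer_invpoly: "invpoly_mat q (numer q)"
proof (induction q)
  case 0
  have "numer 0 = (\<lambda>_. 1\<^sub>m 2)" by (simp add: fun_eq_iff numer_0)
  then show ?case by (simp add: invpoly_mat_one)
next
  case (Suc q)
  have "numer (Suc q) = (\<lambda>z. numer q z * (bernoulli_mat (\<alpha> (Suc q)) (\<gamma> (Suc q)) z * geometric_mat (\<beta> (Suc q)) z))"
    by (rule ext) (rule numer_Suc)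
  then show ?case using invpoly_mat_mult[OF Suc invpoly_mat_bernoulli_geometric] by simp
qed

lemmas numer_carrier = invpoly_mat_carrier[OF numer_invpoly]

lemma det_numer: "q \<le> k \<Longrightarrow> Determinant.det (numer q z) = (1 - 1 / z) ^ (2 * q)"
proof (induction q)
  case (Suc q)
  have "Determinant.det (bernoulli_mat (\<alpha> (Suc q)) (\<gamma> (Suc q)) z * geometric_mat (\<beta> (Suc q)) z) = (1 - 1 / z)\<^sup>2"
    using Suc.prems pos by (intro det_bernoulli_geometric) auto
  then show ?case
    using Suc by (simp add: numer_Suc Determinant.det_mult[OF numer_carrier mult_carrier_mat[OF bernoulli_mat_carrier geometric_mat_carrier]]
        power_add power2_eq_square)
qed (simp add: numer_0)

lemma pos_entries_numer: "1 \<le> q \<Longrightarrow> q \<le> k \<Longrightarrow> pos_entries (numer q 1)"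
proof (induction q rule: nat_induct_at_least)
  case base
  then show ?case using pos_entries_bernoulli_geometric[OF pos(1,2,3), of 1 1 1]
    numer_Suc[of 0 1] left_mult_one_mat[OF mult_carrier_mat[OF bernoulli_mat_carrier geometric_mat_carrier]]
    by (simp add: numer_0)
next
  case (Suc q)
  then show ?case unfolding numer_Suc using pos
    by (intro pos_entries_mult[OF _ pos_entries_bernoulli_geometric]) auto
qed

lemma Phi_carrier: "\<Phi> z \<in> carrier_mat 2 2"
  unfolding Phi_numer using numer_carrier by simp

lemma det_Phi:
  assumes "z \<noteq> 1"
  shows "Determinant.det (\<Phi> z) = 1"
proof -
  show ?thesis
    using assms unfolding Phi_numer by (simp add: Determinant.det_smult det_numer power_divide
      carrier_matD[OF numer_carrier] power_mult[symmetric] mult.commute)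
qed

lemma Phi_adj2:
  assumes "z \<noteq> 1"
  shows "\<Phi> z * adj2 (\<Phi> z) = 1\<^sub>m 2" "adj2 (\<Phi> z) * \<Phi> z = 1\<^sub>m 2"
  using adj2_mult[OF Phi_carrier, of z] det_Phi[OF assms] by (auto intro!: eq_matI)

lemma mat_inv_Phi:
  assumes "z \<noteq> 1"
  shows "mat_inv (\<Phi> z) = adj2 (\<Phi> z)"
proof (cases "mat_inverse (\<Phi> z)")
  case None
  have "\<Phi> z \<in> Units (ring_mat TYPE(complex) 2 ())"
    using Phi_adj2[OF assms] Phi_carrier[of z] adj2_carrier[of "\<Phi> z"] by (auto simp: Units_def ring_mat_def)
  then show ?thesis using mat_inverse(1)[OF Phi_carrier None, of "()"] by simp
next
  case (Some B)
  from mat_inverse(2)[OF Phi_carrier Some] have B: "\<Phi> z * B = 1\<^sub>m 2" "B \<in> carrier_mat 2 2" by auto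
  have "B = adj2 (\<Phi> z) * \<Phi> z * B" using Phi_adj2[OF assms] B by simp
  also have "\<dots> = adj2 (\<Phi> z) * (\<Phi> z * B)" by (rule assoc_mult_mat[OF adj2_carrier Phi_carrier B(2)])
  also have "\<dots> = adj2 (\<Phi> z)" using B(1) adj2_carrier[of "\<Phi> z"] by simp
  finally show ?thesis using Some by (simp add: mat_inv_def)
qed

definition Phi_fps :: "complex fps mat" where
  "Phi_fps = fps_mat_prod (step_fps k \<alpha> \<beta> \<gamma>) 0 (2 * k)"

lemma step_symbol_mat_expansion: "mat_expansion (step_symbol k \<alpha> \<beta> \<gamma> p) (step_fps k \<alpha> \<beta> \<gamma> p)"
  unfolding mat_expansion_def
  using step_symbol_expansion step_fps_carrier bernoulli_mat_carrier geometric_mat_carrier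
  by (auto simp: step_symbol_def Let_def)

lemma Phi_mat_expansion: "mat_expansion \<Phi> Phi_fps"
proof -
  have "mat_expansion (\<lambda>z. (1 / (1 - 1 / z) ^ q) \<cdot>\<^sub>m numer q z) (fps_mat_prod (step_fps k \<alpha> \<beta> \<gamma>) 0 (2 * q))"
    if "q \<le> k" for q
    using that
  proof (induction q)
    case 0
    have "(1 / (1 - 1 / z) ^ 0) \<cdot>\<^sub>m numer 0 z = 1\<^sub>m 2" for z by (intro eq_matI) (auto simp: numer_0)
    then show ?case using mat_expansion_one by (simp del: power_0)
  next
    case (Suc q)
    have ext: "periodic_ext k a (Suc q) = a (Suc q)" for a using Suc.prems by (simp add: periodic_ext_def)
    have odd: "step_symbol k \<alpha> \<beta> \<gamma> (Suc (2 * q)) z = bernoulli_mat (\<alpha> (Suc q)) (\<gamma> (Suc q)) z"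
      and even: "step_symbol k \<alpha> \<beta> \<gamma> (Suc (Suc (2 * q))) z = (1 / (1 - 1 / z)) \<cdot>\<^sub>m geometric_mat (\<beta> (Suc q)) z" for z
      by (simp_all add: step_symbol_def Let_def ext)
    have "(1 / (1 - 1 / z) ^ q) \<cdot>\<^sub>m numer q z * step_symbol k \<alpha> \<beta> \<gamma> (Suc (2 * q)) z * step_symbol k \<alpha> \<beta> \<gamma> (Suc (Suc (2 * q))) z
       = (1 / (1 - 1 / z) ^ Suc q) \<cdot>\<^sub>m numer (Suc q) z" for z
    proof -
      let ?B = "bernoulli_mat (\<alpha> (Suc q)) (\<gamma> (Suc q)) z" and ?G = "geometric_mat (\<beta> (Suc q)) z"
      note c = numer_carrier[of q z] bernoulli_mat_carrier[of "\<alpha> (Suc q)" "\<gamma> (Suc q)" z] geometric_mat_carrier[of "\<beta> (Suc q)" z]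
      have "(1 / (1 - 1 / z) ^ q) \<cdot>\<^sub>m numer q z * ?B * ((1 / (1 - 1 / z)) \<cdot>\<^sub>m ?G) =
          (1 / (1 - 1 / z)) \<cdot>\<^sub>m ((1 / (1 - 1 / z) ^ q) \<cdot>\<^sub>m (numer q z * ?B * ?G))"
        using c by (simp add: mult_smult_assoc_mat[of _ 2 2 _ 2] mult_smult_distrib[of _ 2 2 _ 2])
      also have "\<dots> = (1 / (1 - 1 / z) ^ Suc q) \<cdot>\<^sub>m (numer q z * ?B * ?G)"
        by (intro eq_matI) (auto simp: mult.assoc)
      also have "numer q z * ?B * ?G = numer (Suc q) z"
        unfolding numer_Suc using c by (rule assoc_mult_mat)
      finally show ?thesis unfolding odd even .
    qed
    then show ?case
      using mat_expansion_mult[OF mat_expansion_mult[OF Suc.IH step_symbol_mat_expansion[of "Suc (2 * q)"]]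
          step_symbol_mat_expansion[of "Suc (Suc (2 * q))"]] Suc.prems by (simp del: power_Suc)
  qed
  from this[of k] show ?thesis unfolding Phi_fps_def by (simp add: Phi_numer[abs_def])
qed

lemma Phi_fps_carrier: "Phi_fps \<in> carrier_mat 2 2"
  using Phi_mat_expansion by (simp add: mat_expansion_def)

text \<open>The identities hold for the functions near infinity and pass to the series because
  expansions are multiplicative and unique.\<close>

lemma Phi_fps_adj2: "Phi_fps * adj2 Phi_fps = 1\<^sub>m 2" "adj2 Phi_fps * Phi_fps = 1\<^sub>m 2"
proof -
  have ev: "\<forall>\<^sub>F t in nhds 0. (t :: complex) \<noteq> 1"
    by (rule t1_space_nhds) auto
  have *: "1 / t \<noteq> 1" if "t \<noteq> 1" for t :: complex using that by (cases "t = 0") (auto simp: field_simps)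
  have ev1: "\<forall>\<^sub>F t in nhds 0. \<Phi> (1 / t) * adj2 (\<Phi> (1 / t)) = 1\<^sub>m 2"
    using ev by eventually_elim (intro Phi_adj2 *)
  have ev2: "\<forall>\<^sub>F t in nhds 0. adj2 (\<Phi> (1 / t)) * \<Phi> (1 / t) = 1\<^sub>m 2"
    using ev by eventually_elim (intro Phi_adj2 *)
  show "Phi_fps * adj2 Phi_fps = 1\<^sub>m 2"
    by (rule mat_expansion_unique[OF mat_expansion_mult[OF Phi_mat_expansion mat_expansion_adj2[OF Phi_mat_expansion]] mat_expansion_one ev1])
  show "adj2 Phi_fps * Phi_fps = 1\<^sub>m 2"
    by (rule mat_expansion_unique[OF mat_expansion_mult[OF mat_expansion_adj2[OF Phi_mat_expansion] Phi_mat_expansion] mat_expansion_one ev2])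
qed

lemma step_fps_periodic: "p \<ge> 1 \<Longrightarrow> step_fps k \<alpha> \<beta> \<gamma> (p + 2 * k) = step_fps k \<alpha> \<beta> \<gamma> p"
proof -
  assume p: "p \<ge> 1"
  have per: "periodic_ext k a ((p + 2 * k + 1) div 2) = periodic_ext k a ((p + 1) div 2)" for a
  proof -
    have "(p + 2 * k + 1) div 2 - 1 = ((p + 1) div 2 - 1) + k" using p by auto
    then show ?thesis by (simp only: periodic_ext_def mod_add_self2)
  qed
  show ?thesis unfolding step_fps_def Let_def per by simp
qed

lemma fps_mat_prod_step_fps:
  "fps_mat_prod (step_fps k \<alpha> \<beta> \<gamma>) (2 * k * a) (2 * k * d) = Phi_fps ^\<^sub>m d"
  unfolding Phi_fps_def
  by (rule fps_mat_prod_periodic[where c = "2 * k"]) (auto simp: step_fps_carrier step_fps_periodic)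

end

section \<open>Spectral projection of the symbol\<close>

lemma invpoly_mat_holomorphic:
  assumes "invpoly_mat d F" "i < 2" "j < 2"
  shows "(\<lambda>z. F z $$ (i, j)) holomorphic_on - {0}"
proof -
  obtain p where "degree p \<le> d" and p: "\<And>z. F z $$ (i, j) = poly p (1 / z)" by (rule invpoly_matE[OF assms]) auto
  show ?thesis unfolding p by (intro holomorphic_intros) auto
qed

lemma invpoly_mat_tendsto:
  assumes "invpoly_mat d F" "i < 2" "j < 2" "a \<noteq> 0"
  shows "((\<lambda>z. F z $$ (i, j)) \<longlongrightarrow> F a $$ (i, j)) (at a)"
proof -
  obtain p where "degree p \<le> d" and p: "\<And>z. F z $$ (i, j) = poly p (1 / z)" by (rule invpoly_matE[OF assms(1-3)]) auto
  show ?thesis unfolding p by (intro tendsto_intros assms(4))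
qed

text \<open>With \<open>J\<close> the Joukowsky map,
  \<open>(x - y) (x y - 1) = x y (J x - J y)\<close>, and \<open>x y\<close> cannot be 1 inside the
  unit disc.\<close>

lemma joukowsky_inj_on: "inj_on (\<lambda>\<rho> :: complex. \<rho> + 1 / \<rho>) (ball 0 1 - {0})"
proof (rule inj_onI)
  fix x y :: complex
  assume x: "x \<in> ball 0 1 - {0}" and y: "y \<in> ball 0 1 - {0}" and eq: "x + 1 / x = y + 1 / y"
  have "(x - y) * (x * y - 1) = x * y * ((x + 1 / x) - (y + 1 / y))"
    using x y by (simp add: field_simps)
  then have "x = y \<or> x * y = 1" using eq by simp
  moreover have "norm (x * y) < 1"
    using x y mult_strict_mono[of "norm x" 1 "norm y" 1] by (auto simp: norm_mult)
  ultimately show "x = y" by (metis less_irrefl norm_one)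
qed

locale spectral = positive_weights +
  fixes \<rho>1 \<rho>2 :: "complex \<Rightarrow> complex"
  assumes branches: "eigenvalue_branches \<Phi> \<rho>1 \<rho>2"
begin

abbreviation "slit \<equiv> - \<real>\<^sub>\<le>\<^sub>0 - {1 :: complex}"

lemma open_slit: "open slit"
  by (intro open_Diff) (auto simp: open_Compl)

lemma eigenvalue_sum_prod:
  assumes "z \<noteq> 0" "z \<noteq> 1"
  shows "\<Phi> z $$ (0, 0) + \<Phi> z $$ (1, 1) = \<rho>1 z + \<rho>2 z" "\<rho>1 z * \<rho>2 z = 1"
proof -
  have "[:1, - (\<Phi> z $$ (0, 0) + \<Phi> z $$ (1, 1)), 1:] = [:- \<rho>1 z, 1:] * [:- \<rho>2 z, 1:]"
    using branches assms char_poly_2x2[OF Phi_carrier, of z] det_Phi[OF assms(2)]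
    by (simp add: eigenvalue_branches_def)
  then show "\<Phi> z $$ (0, 0) + \<Phi> z $$ (1, 1) = \<rho>1 z + \<rho>2 z" "\<rho>1 z * \<rho>2 z = 1"
    by (simp_all add: algebra_simps)
qed

lemma slit_nonzero: "z \<in> slit \<Longrightarrow> z \<noteq> 0" "z \<in> slit \<Longrightarrow> z \<noteq> 1"
  by auto

lemma norm_rho2:
  assumes "z \<in> slit"
  shows "norm (\<rho>2 z) < 1" "\<rho>2 z \<noteq> 0" "\<rho>1 z = 1 / \<rho>2 z" "\<rho>1 z \<noteq> \<rho>2 z"
proof -
  have less: "norm (\<rho>2 z) < norm (\<rho>1 z)" using branches assms by (simp add: eigenvalue_branches_def)
  have prod: "\<rho>1 z * \<rho>2 z = 1" using eigenvalue_sum_prod slit_nonzero[OF assms] by blast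
  then show nz: "\<rho>2 z \<noteq> 0" by auto
  show "\<rho>1 z = 1 / \<rho>2 z" using prod nz by (simp add: field_simps)
  show "\<rho>1 z \<noteq> \<rho>2 z" using less by auto
  have "norm (\<rho>1 z) * norm (\<rho>2 z) = 1" using prod by (metis norm_mult norm_one)
  then show "norm (\<rho>2 z) < 1" using less
    by (smt (verit, best) mult_le_cancel_left1 mult_less_cancel_left1 norm_ge_zero zero_less_norm_iff mult.commute nz)
qed

lemma Phi_entry_holomorphic:
  assumes "i < 2" "j < 2"
  shows "(\<lambda>z. \<Phi> z $$ (i, j)) holomorphic_on - {0, 1}"
proof -
  have eq: "\<Phi> z $$ (i, j) = 1 / (1 - 1 / z) ^ k * numer k z $$ (i, j)" for z
    unfolding Phi_numer using assms carrier_matD[OF numer_carrier] by simp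
  show ?thesis unfolding eq
    by (intro holomorphic_intros holomorphic_on_subset[OF invpoly_mat_holomorphic[OF numer_invpoly assms]])
      (auto simp: field_simps)
qed

text \<open>As \<open>\<rho>1 * \<rho>2 = 1\<close> and \<open>\<bar>\<rho>2\<bar> < 1\<close>, \<open>\<rho>2\<close> is the trace of \<open>\<Phi>\<close> followed by the inverse of the Joukowsky map.\<close>

lemma rho2_holomorphic: "\<rho>2 holomorphic_on slit"
proof -
  let ?J = "\<lambda>\<rho> :: complex. \<rho> + 1 / \<rho>"
  let ?T = "\<lambda>z. \<Phi> z $$ (0, 0) + \<Phi> z $$ (1, 1)"
  have J: "?J holomorphic_on ball 0 1 - {0}" by (intro holomorphic_intros) auto
  obtain g where g: "g holomorphic_on ?J ` (ball 0 1 - {0})" "\<And>x. x \<in> ball 0 1 - {0} \<Longrightarrow> g (?J x) = x"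
  proof -
    have "open (ball 0 1 - {0 :: complex})" by (intro open_Diff) auto
    then show thesis
    proof (rule holomorphic_has_inverse[OF J _ joukowsky_inj_on])
      fix g assume "g holomorphic_on ?J ` (ball 0 1 - {0})" "\<And>z. z \<in> ball 0 1 - {0} \<Longrightarrow> g (?J z) = z"
      then show thesis by (rule that)
    qed
  qed
  have T: "?T z = ?J (\<rho>2 z)" "\<rho>2 z \<in> ball 0 1 - {0}" if "z \<in> slit" for z
    using eigenvalue_sum_prod(1)[OF slit_nonzero[OF that]] norm_rho2[OF that] by auto
  have "?T holomorphic_on slit"
    by (intro holomorphic_on_add holomorphic_on_subset[OF Phi_entry_holomorphic]) auto
  then have "(g \<circ> ?T) holomorphic_on slit"
    by (rule holomorphic_on_compose_gen[OF _ g(1)]) (use T in auto)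
  then show ?thesis
    by (rule holomorphic_transform) (use T g(2) in auto)
qed

lemma rho1_holomorphic: "\<rho>1 holomorphic_on slit"
proof -
  have "(\<lambda>z. 1 / \<rho>2 z) holomorphic_on slit" by (intro holomorphic_intros rho2_holomorphic norm_rho2(2))
  then show ?thesis by (rule holomorphic_transform) (use norm_rho2(3) in auto)
qed

text \<open>Spectral projection for \<rho>1 written without eigenvectors. While \<open>E\<close> may
  be chosen independently from point to point, this expression is holomorphic on the slit plane and
  open to Cauchy's theorem.\<close>

definition proj :: "complex \<Rightarrow> complex mat" where
  "proj z = (1 / (\<rho>1 z - \<rho>2 z)) \<cdot>\<^sub>m (\<Phi> z - \<rho>2 z \<cdot>\<^sub>m 1\<^sub>m 2)"

lemma proj_carrier: "proj z \<in> carrier_mat 2 2"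
  unfolding proj_def by (intro smult_carrier_mat minus_carrier_mat one_carrier_mat)

lemma proj_index:
  assumes "i < 2" "j < 2"
  shows "proj z $$ (i, j) = (\<Phi> z $$ (i, j) - (if i = j then \<rho>2 z else 0)) / (\<rho>1 z - \<rho>2 z)"
  unfolding proj_def using assms carrier_matD[OF Phi_carrier] by (simp add: divide_inverse)

lemma proj_mult_Phi:
  assumes "z \<in> slit"
  shows "proj z * \<Phi> z = \<rho>1 z \<cdot>\<^sub>m proj z"
proof -
  note nz = slit_nonzero[OF assms]
  have "Determinant.det (\<Phi> z) = \<rho>1 z * \<rho>2 z" using eigenvalue_sum_prod(2)[OF nz] det_Phi[OF nz(2)] by simp
  from cayley_hamilton_2x2[OF Phi_carrier eigenvalue_sum_prod(1)[OF nz] this]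
  have *: "(\<Phi> z - \<rho>2 z \<cdot>\<^sub>m 1\<^sub>m 2) * \<Phi> z = \<rho>1 z \<cdot>\<^sub>m (\<Phi> z - \<rho>2 z \<cdot>\<^sub>m 1\<^sub>m 2)" .
  have C: "\<Phi> z - \<rho>2 z \<cdot>\<^sub>m 1\<^sub>m 2 \<in> carrier_mat 2 2"
    by (intro minus_carrier_mat smult_carrier_mat one_carrier_mat)
  show ?thesis unfolding proj_def
    by (subst mult_smult_assoc_mat[OF C Phi_carrier], subst *) (intro eq_matI, auto)
qed

lemma proj_mult_Phi_power:
  assumes "z \<in> slit"
  shows "proj z * \<Phi> z ^\<^sub>m q = \<rho>1 z ^ q \<cdot>\<^sub>m proj z"
proof (induction q)
  case 0
  show ?case using proj_carrier[of z] carrier_matD[OF Phi_carrier, of z] by (intro eq_matI) auto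
next
  case (Suc q)
  have c: "\<Phi> z ^\<^sub>m q \<in> carrier_mat 2 2" using Phi_carrier by simp
  have "proj z * \<Phi> z ^\<^sub>m Suc q = proj z * \<Phi> z ^\<^sub>m q * \<Phi> z"
    using assoc_mult_mat[OF proj_carrier c Phi_carrier] by simp
  also have "\<dots> = \<rho>1 z ^ q \<cdot>\<^sub>m (proj z * \<Phi> z)"
    unfolding Suc by (rule mult_smult_assoc_mat[OF proj_carrier Phi_carrier])
  also have "\<dots> = \<rho>1 z ^ Suc q \<cdot>\<^sub>m proj z"
    unfolding proj_mult_Phi[OF assms] by (intro eq_matI) auto
  finally show ?case .
qed

lemma proj_mult_adj2_power:
  assumes "z \<in> slit"
  shows "proj z * adj2 (\<Phi> z) ^\<^sub>m q = \<rho>2 z ^ q \<cdot>\<^sub>m proj z"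
proof -
  have 1: "z \<noteq> 1" using assms by auto
  have inv: "\<Phi> z ^\<^sub>m q * adj2 (\<Phi> z) ^\<^sub>m q = 1\<^sub>m 2"
    using pow_mat_cancel[OF Phi_carrier adj2_carrier Phi_adj2(1)[OF 1], of q q] carrier_matD[OF Phi_carrier] by simp
  have c: "\<Phi> z ^\<^sub>m q \<in> carrier_mat 2 2" "adj2 (\<Phi> z) ^\<^sub>m q \<in> carrier_mat 2 2"
    by (rule pow_carrier_mat, rule Phi_carrier, rule pow_carrier_mat, rule adj2_carrier)
  have "proj z = proj z * (\<Phi> z ^\<^sub>m q * adj2 (\<Phi> z) ^\<^sub>m q)" unfolding inv by (rule right_mult_one_mat[OF proj_carrier, symmetric])
  also have "\<dots> = proj z * \<Phi> z ^\<^sub>m q * adj2 (\<Phi> z) ^\<^sub>m q"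
    by (rule assoc_mult_mat[OF proj_carrier c, symmetric])
  also have "\<dots> = \<rho>1 z ^ q \<cdot>\<^sub>m (proj z * adj2 (\<Phi> z) ^\<^sub>m q)"
    unfolding proj_mult_Phi_power[OF assms] by (rule mult_smult_assoc_mat[OF proj_carrier c(2)])
  finally have eq: "proj z = \<rho>1 z ^ q \<cdot>\<^sub>m (proj z * adj2 (\<Phi> z) ^\<^sub>m q)" .
  have "\<rho>2 z ^ q \<cdot>\<^sub>m proj z = \<rho>2 z ^ q \<cdot>\<^sub>m (\<rho>1 z ^ q \<cdot>\<^sub>m (proj z * adj2 (\<Phi> z) ^\<^sub>m q))"
    using eq by (rule arg_cong)
  also have "\<dots> = (\<rho>1 z * \<rho>2 z) ^ q \<cdot>\<^sub>m (proj z * adj2 (\<Phi> z) ^\<^sub>m q)"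
    by (intro eq_matI) (auto simp: power_mult_distrib)
  also have "\<dots> = proj z * adj2 (\<Phi> z) ^\<^sub>m q"
    using eigenvalue_sum_prod(2)[OF slit_nonzero[OF assms]] by (intro eq_matI) auto
  finally show ?thesis by simp
qed

text \<open>The decomposition \<open>\<Phi> = \<rho>1 \<pi> + \<rho>2 (1 - \<pi>)\<close> raised to
  a power. It trades powers of \<rho>1 for powers of \<Phi> and \<rho>2, which is how
  \<open>row_upper\<close> splits its integrand.\<close>

lemma Phi_power_spectral:
  assumes z: "z \<in> slit" and ij: "i < 2" "j < 2"
  shows "(\<Phi> z ^\<^sub>m q) $$ (i, j) = \<rho>1 z ^ q * proj z $$ (i, j) +
    \<rho>2 z ^ q * ((if i = j then 1 else 0) - proj z $$ (i, j))"
  using ij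
proof (induction q arbitrary: j)
  case 0
  then show ?case using carrier_matD[OF Phi_carrier, of z] by simp
next
  case (Suc q)
  have c: "\<Phi> z ^\<^sub>m q \<in> carrier_mat 2 2" using Phi_carrier by simp
  have d: "\<rho>1 z - \<rho>2 z \<noteq> 0" using norm_rho2(4)[OF z] by simp
  have Phi: "\<Phi> z $$ (a, b) = (\<rho>1 z - \<rho>2 z) * proj z $$ (a, b) + (if a = b then \<rho>2 z else 0)" if "a < 2" "b < 2" for a b
    using proj_index[OF that, of z] d by (auto simp: field_simps)
  have idem: "proj z $$ (i, 0) * \<Phi> z $$ (0, j) + proj z $$ (i, 1) * \<Phi> z $$ (1, j) = \<rho>1 z * proj z $$ (i, j)"
    using proj_mult_Phi[OF z] index_mult_2x2[OF proj_carrier Phi_carrier Suc.prems, of z z]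
      carrier_matD[OF proj_carrier] Suc.prems by simp
  have "(\<Phi> z ^\<^sub>m Suc q) $$ (i, j) = (\<Phi> z ^\<^sub>m q) $$ (i, 0) * \<Phi> z $$ (0, j) + (\<Phi> z ^\<^sub>m q) $$ (i, 1) * \<Phi> z $$ (1, j)"
    using index_mult_2x2[OF c Phi_carrier Suc.prems, of z] by simp
  also have "\<dots> = \<rho>1 z ^ q * (proj z $$ (i, 0) * \<Phi> z $$ (0, j) + proj z $$ (i, 1) * \<Phi> z $$ (1, j)) +
      \<rho>2 z ^ q * (\<Phi> z $$ (i, j) - (proj z $$ (i, 0) * \<Phi> z $$ (0, j) + proj z $$ (i, 1) * \<Phi> z $$ (1, j)))"
  proof -
    have e0: "(\<Phi> z ^\<^sub>m q) $$ (i, 0) = \<rho>1 z ^ q * proj z $$ (i, 0) + \<rho>2 z ^ q * ((if i = 0 then 1 else 0) - proj z $$ (i, 0))"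
      and e1: "(\<Phi> z ^\<^sub>m q) $$ (i, 1) = \<rho>1 z ^ q * proj z $$ (i, 1) + \<rho>2 z ^ q * ((if i = 1 then 1 else 0) - proj z $$ (i, 1))"
      using Suc.IH[of 0] Suc.IH[of 1] Suc.prems(1) by auto
    have "i = 0 \<or> i = 1" using Suc.prems(1) by auto
    then show ?thesis unfolding e0 e1 by (elim disjE) (simp_all add: ring_distribs mult.assoc)
  qed
  also have "\<dots> = \<rho>1 z ^ Suc q * proj z $$ (i, j) + \<rho>2 z ^ Suc q * ((if i = j then 1 else 0) - proj z $$ (i, j))"
    unfolding idem Phi[OF Suc.prems] by (simp add: algebra_simps)
  finally show ?case .
qed

lemma proj_holomorphic:
  assumes "i < 2" "j < 2"
  shows "(\<lambda>z. proj z $$ (i, j)) holomorphic_on slit"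
proof -
  have "(\<lambda>z. if i = j then \<rho>2 z else 0) holomorphic_on slit"
    by (cases "i = j") (auto intro: rho2_holomorphic)
  moreover have "(\<lambda>z. \<Phi> z $$ (i, j)) holomorphic_on slit"
    by (rule holomorphic_on_subset[OF Phi_entry_holomorphic[OF assms]]) auto
  ultimately show ?thesis unfolding proj_index[OF assms]
    by (intro holomorphic_on_divide holomorphic_on_diff rho1_holomorphic rho2_holomorphic)
      (use norm_rho2(4) in auto)
qed

lemma eventually_slit: "\<forall>\<^sub>F z in at 1. z \<in> slit"
proof -
  have "open (- \<real>\<^sub>\<le>\<^sub>0 :: complex set)" by (simp add: open_Compl)
  then have "\<forall>\<^sub>F z in at 1. z \<in> (- \<real>\<^sub>\<le>\<^sub>0 :: complex set)" by (intro eventually_at_in_open') auto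
  then show ?thesis using eventually_neq_at_within[of 1 1 UNIV] by eventually_elim auto
qed

text \<open>Both \<Phi> and \<rho>1 are unbounded near 1. Multiplying through by
  \<open>(1 - 1 / z) ^ k\<close> turns entries of \<Phi> into entries of \<open>numer k\<close>, and
  the difference of the eigenvalues into the trace of \<open>numer k\<close> minus a term that tends
  to 0, as \<rho>2 has modulus below 1. The trace is positive at 1, so the quotient has a
  limit.\<close>

lemma proj_bounded:
  assumes ij: "i < 2" "j < 2"
  shows "(\<lambda>z. proj z $$ (i, j)) \<in> O[at 1](\<lambda>_. 1)"
proof -
  let ?u = "\<lambda>z :: complex. (1 - 1 / z) ^ k"
  let ?t = "\<lambda>z. numer k z $$ (0, 0) + numer k z $$ (1, 1)"
  have u0: "(?u \<longlongrightarrow> 0) (at 1)"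
    using k by (auto intro!: tendsto_eq_intros)
  have ur: "((\<lambda>z. ?u z * \<rho>2 z) \<longlongrightarrow> 0) (at 1)"
  proof (rule Lim_null_comparison)
    show "\<forall>\<^sub>F z in at 1. norm (?u z * \<rho>2 z) \<le> norm (?u z)"
      using eventually_slit
    proof eventually_elim
      case (elim z)
      then show ?case using norm_rho2(1)[OF elim] by (auto simp: norm_mult intro!: mult_left_le)
    qed
    show "((\<lambda>z. norm (?u z)) \<longlongrightarrow> 0) (at 1)" using tendsto_norm[OF u0] by simp
  qed
  have "pos_entries (numer k 1)" using pos_entries_numer[of k] k by simp
  then obtain x y where "x > 0" "y > 0" "numer k 1 $$ (0, 0) = of_real x" "numer k 1 $$ (1, 1) = of_real y"
    unfolding pos_entries_def by (metis one_less_numeral_iff pos2 semiring_norm(76))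
  then have t1: "?t 1 \<noteq> 0" by (metis add_pos_pos less_irrefl of_real_add of_real_eq_0_iff)
  have "((\<lambda>z. (numer k z $$ (i, j) - (if i = j then ?u z * \<rho>2 z else 0)) / (?t z - 2 * (?u z * \<rho>2 z))) \<longlongrightarrow>
      (numer k 1 $$ (i, j) - (if i = j then 0 else 0)) / (?t 1 - 2 * 0)) (at 1)"
  proof (intro tendsto_divide tendsto_diff tendsto_add tendsto_mult tendsto_const ur invpoly_mat_tendsto[OF numer_invpoly])
    show "((\<lambda>z. if i = j then ?u z * \<rho>2 z else 0) \<longlongrightarrow> (if i = j then 0 else 0)) (at 1)"
      using ur by (cases "i = j") simp_all
  qed (use ij t1 in auto)
  moreover have "\<forall>\<^sub>F z in at 1. (numer k z $$ (i, j) - (if i = j then ?u z * \<rho>2 z else 0)) / (?t z - 2 * (?u z * \<rho>2 z)) = proj z $$ (i, j)"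
    using eventually_slit
  proof eventually_elim
    case (elim z)
    have u: "?u z \<noteq> 0" using elim by auto
    have num: "numer k z $$ (a, b) = ?u z * \<Phi> z $$ (a, b)" if "a < 2" "b < 2" for a b
      unfolding Phi_numer using that u carrier_matD[OF numer_carrier] by simp
    have "?t z - 2 * (?u z * \<rho>2 z) = ?u z * (\<rho>1 z - \<rho>2 z)"
      using eigenvalue_sum_prod(1)[OF slit_nonzero[OF elim]] num[of 0 0] num[of 1 1] by (simp add: algebra_simps flip: distrib_left)
    moreover have "numer k z $$ (i, j) - (if i = j then ?u z * \<rho>2 z else 0) =
        ?u z * (\<Phi> z $$ (i, j) - (if i = j then \<rho>2 z else 0))"
      using num[OF ij] by (simp add: algebra_simps)
    ultimately show ?case unfolding proj_index[OF ij]
      by (simp only: mult_divide_mult_cancel_left[OF u])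
  qed
  ultimately have "((\<lambda>z. proj z $$ (i, j)) \<longlongrightarrow> (numer k 1 $$ (i, j) - (if i = j then 0 else 0)) / (?t 1 - 2 * 0)) (at 1)"
    by (rule Lim_transform_eventually)
  then show ?thesis by (intro bigoI_tendsto[where c = "(numer k 1 $$ (i, j) - (if i = j then 0 else 0)) / (?t 1 - 2 * 0)"]) auto
qed

lemma contour_integral_rho2_proj:
  assumes ij: "i < 2" "j < 2"
    and c: "valid_path c" "pathfinish c = pathstart c" "path_image c \<subseteq> slit"
  shows "contour_integral c (\<lambda>w. w powi a * \<rho>2 w ^ q * proj w $$ (i, j)) = 0"
    "contour_integral c (\<lambda>w. w powi a * \<rho>2 w ^ q * ((if i = j then 1 else 0) - proj w $$ (i, j))) = 0"
proof -
  have "((\<lambda>w::complex. w powi a) \<longlongrightarrow> 1 powi a) (at 1)" by (intro tendsto_intros) auto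
  then have w: "(\<lambda>w::complex. w powi a) \<in> O[at 1](\<lambda>_. 1)" by (intro bigoI_tendsto[where c = 1]) auto
  have r: "(\<lambda>w. \<rho>2 w ^ q) \<in> O[at 1](\<lambda>_. 1)"
  proof (rule bigoI[where c = 1])
    show "\<forall>\<^sub>F z in at 1. norm (\<rho>2 z ^ q) \<le> 1 * norm (1 :: complex)"
      using eventually_slit 
    proof eventually_elim
      case (elim z)
      then show ?case using power_le_one[OF norm_ge_zero less_imp_le[OF norm_rho2(1)[OF elim]]] by (simp add: norm_power)
    qed
  qed
  have p': "(\<lambda>w. (if i = j then 1 else 0) - proj w $$ (i, j)) \<in> O[at 1](\<lambda>_. 1)"
    by (intro sum_in_bigo proj_bounded ij) auto
  have hw: "(\<lambda>w::complex. w powi a) holomorphic_on slit" by (intro holomorphic_intros) auto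
  show "contour_integral c (\<lambda>w. w powi a * \<rho>2 w ^ q * proj w $$ (i, j)) = 0"
    by (intro contour_integral_slit_bounded c holomorphic_intros hw rho2_holomorphic proj_holomorphic ij
        landau_o.big.mult_in_1 w r proj_bounded)
  show "contour_integral c (\<lambda>w. w powi a * \<rho>2 w ^ q * ((if i = j then 1 else 0) - proj w $$ (i, j))) = 0"
    by (intro contour_integral_slit_bounded c holomorphic_intros hw rho2_holomorphic proj_holomorphic ij
        landau_o.big.mult_in_1 w r p')
qed

text \<open>For any diagonalization, \<open>Q R = 1\<close> and \<open>Q D R = \<Phi>\<close> are
  linear in the two rank-one products of columns of \<open>Q\<close> with rows of \<open>R\<close>;
  since the eigenvalues differ, they determine the first product.\<close>

lemma spectral_projection_eq:
  assumes z: "z \<in> slit" and sim: "similar_mat_wit (\<Phi> z) (mat2 (\<rho>1 z) 0 0 (\<rho>2 z)) Q R"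
  shows "Q * mat2 1 0 0 0 * R = proj z"
proof -
  have c: "Q \<in> carrier_mat 2 2" "R \<in> carrier_mat 2 2" and QR: "Q * R = 1\<^sub>m 2" and P: "\<Phi> z = Q * mat2 (\<rho>1 z) 0 0 (\<rho>2 z) * R"
    using sim carrier_matD[OF Phi_carrier, of z] by (auto simp: similar_mat_wit_def Let_def)
  have c3: "mat2 a b c d \<in> carrier_mat 2 2" for a b c d by (rule mat_of_rows_list_2_carrier)
  have d: "\<rho>1 z - \<rho>2 z \<noteq> 0" using norm_rho2(4)[OF z] by simp
  have idx: "(Q * mat2 a 0 0 b * R) $$ (i, j) = a * (Q $$ (i, 0) * R $$ (0, j)) + b * (Q $$ (i, 1) * R $$ (1, j))"
    if ij: "i < 2" "j < 2" for i j a b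
    unfolding index_mult_2x2[OF mult_carrier_mat[OF c(1) c3] c(2) ij]
    using ij by (simp add: index_mult_2x2[OF c(1) c3])
  have one: "Q $$ (i, 0) * R $$ (0, j) + Q $$ (i, 1) * R $$ (1, j) = (if i = j then 1 else 0)" if ij: "i < 2" "j < 2" for i j
    using index_mult_2x2[OF c(1,2) ij] QR ij by simp
  show ?thesis
  proof (rule eq_matI)
    fix i j assume "i < dim_row (proj z)" "j < dim_col (proj z)"
    then have ij: "i < 2" "j < 2" using carrier_matD[OF proj_carrier] by auto
    have "\<Phi> z $$ (i, j) = \<rho>1 z * (Q $$ (i, 0) * R $$ (0, j)) + \<rho>2 z * (Q $$ (i, 1) * R $$ (1, j))"
      by (subst P) (rule idx[OF ij])
    moreover have "(if i = j then \<rho>2 z else 0) = \<rho>2 z * (Q $$ (i, 0) * R $$ (0, j) + Q $$ (i, 1) * R $$ (1, j))"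
      unfolding one[OF ij] by simp
    ultimately have "\<Phi> z $$ (i, j) - (if i = j then \<rho>2 z else 0) = (\<rho>1 z - \<rho>2 z) * (Q $$ (i, 0) * R $$ (0, j))"
      by (simp only: algebra_simps)
    then have "proj z $$ (i, j) = Q $$ (i, 0) * R $$ (0, j)" using d by (simp add: proj_index[OF ij])
    then show "(Q * mat2 1 0 0 0 * R) $$ (i, j) = proj z $$ (i, j)" by (simp add: idx[OF ij])
  qed (use c carrier_matD[OF proj_carrier] in auto)
qed

end

section \<open>Solution of the block Toeplitz system\<close>

lemma has_fps_expansion_fps_of_poly: "(\<lambda>t. poly p t) has_fps_expansion fps_of_poly (p :: complex poly)"
proof (induction p)
  case (pCons a p)
  have "(\<lambda>t. a + t * poly p t) has_fps_expansion fps_const a + fps_X * fps_of_poly p"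
    by (intro has_fps_expansion_add has_fps_expansion_mult has_fps_expansion_const has_fps_expansion_fps_X pCons.IH)
  then show ?case by (simp add: fps_of_poly_pCons mult.commute)
qed simp

lemma poly_inverse_argument:
  fixes p :: "complex poly"
  assumes "degree p \<le> d" "w \<noteq> 0"
  shows "(\<Sum>r\<le>d. coeff p r * w ^ (d - r)) = w ^ d * poly p (1 / w)"
proof -
  have "poly p (1 / w) = (\<Sum>r\<le>d. coeff p r * (1 / w) ^ r)"
    unfolding poly_altdef using assms(1) by (intro sum.mono_neutral_left) (auto simp: coeff_eq_0)
  then have "w ^ d * poly p (1 / w) = (\<Sum>r\<le>d. coeff p r * (w ^ d * (1 / w) ^ r))"
    by (simp add: sum_distrib_left mult_ac)
  also have "\<dots> = (\<Sum>r\<le>d. coeff p r * w ^ (d - r))"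
    using assms(2) by (intro sum.cong refl) (auto simp: power_diff power_one_over)
  finally show ?thesis ..
qed

text \<open>One polynomial serves as series entry and as function away from 1, so that degree bounds
  on series can be used under contour integrals.\<close>

lemma fps_entry_of_invpoly_mat:
  assumes F: "invpoly_mat d F" and G: "mat_expansion G M" and eq: "\<And>z. z \<noteq> 1 \<Longrightarrow> G z = F z"
    and ij: "i < 2" "j < 2"
  obtains p where "degree p \<le> d" "M $$ (i, j) = fps_of_poly p" "\<And>z. z \<noteq> 1 \<Longrightarrow> G z $$ (i, j) = poly p (1 / z)"
proof -
  obtain p where p: "degree p \<le> d" "\<And>z. F z $$ (i, j) = poly p (1 / z)"
    by (rule invpoly_matE[OF F ij]) auto
  have ev: "\<forall>\<^sub>F t in nhds 0. (t :: complex) \<noteq> 1" by (rule t1_space_nhds) auto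
  have "(\<lambda>t. G (1 / t) $$ (i, j)) has_fps_expansion fps_of_poly p"
  proof (rule has_fps_expansion_cong[THEN iffD2, OF _ refl has_fps_expansion_fps_of_poly])
    show "\<forall>\<^sub>F t in nhds 0. G (1 / t) $$ (i, j) = poly p t"
      using ev
    proof eventually_elim
      case (elim t)
      then have "1 / t \<noteq> 1" by (cases "t = 0") auto
      then show ?case using p(2)[of "1 / t"] by (simp add: eq)
    qed
  qed
  moreover have "(\<lambda>t. G (1 / t) $$ (i, j)) has_fps_expansion M $$ (i, j)"
    using G ij by (simp add: mat_expansion_def)
  ultimately have "M $$ (i, j) = fps_of_poly p" using fps_expansion_unique_complex by blast
  then show thesis using that[of p] p eq by simp
qed

text \<open>The loops enter through winding numbers and the sets they avoid; the slit keeps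
  \<open>c1\<close> where the eigenvalues are holomorphic.\<close>

locale aztec_contours = aztec + spectral +
  fixes c1 c01 :: "real \<Rightarrow> complex"
  assumes c1: "valid_path c1" "pathfinish c1 = pathstart c1" "path_image c1 \<subseteq> slit" "winding_number c1 1 = 1"
    and c01: "valid_path c01" "pathfinish c01 = pathstart c01" "0 \<notin> path_image c01" "1 \<notin> path_image c01"
      "winding_number c01 0 = 1" "winding_number c01 1 = 1"
    and c1_c01: "\<And>w. w \<in> path_image c1 \<Longrightarrow> w \<notin> path_image c01"
      "\<And>w. w \<in> path_image c1 \<Longrightarrow> winding_number c01 w = 1"
begin

abbreviation "h \<equiv> N div 2"

lemma N_h: "N = 2 * h" "L = k * h"
  using N by auto

lemma c01_coeff:
  fixes F :: "complex fps"
  assumes "f holomorphic_on - {0, 1}" "(\<lambda>t. f (1 / t)) has_fps_expansion F"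
  shows "contour_integral c01 (\<lambda>z. z powi (d - 1) * f z) = 2 * of_real pi * \<i> * (if d < 0 then 0 else F $ nat d)"
  by (rule contour_integral_coeff_at_infinity[where K = "{0, 1}", OF _ _ assms(1) c01(1,2) _ _ assms(2)])
    (use c01 in auto)

lemma Phi_power_expansion: "mat_expansion (\<lambda>z. \<Phi> z ^\<^sub>m q) (Phi_fps ^\<^sub>m q)"
  by (rule mat_expansion_power[OF Phi_mat_expansion])

lemma adj2_Phi: "adj2 (\<Phi> z) = (1 / (1 - 1 / z) ^ k) \<cdot>\<^sub>m adj2 (numer k z)"
  unfolding Phi_numer by (rule adj2_smult[OF numer_carrier])

lemma smult_power_holomorphic:
  assumes F: "invpoly_mat d F" and ij: "i < 2" "j < 2"
  shows "(\<lambda>z. (((1 / (1 - 1 / z) ^ k) \<cdot>\<^sub>m F z) ^\<^sub>m q) $$ (i, j)) holomorphic_on - {0, 1}"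
proof -
  have eq: "(((1 / (1 - 1 / z) ^ k) \<cdot>\<^sub>m F z) ^\<^sub>m q) $$ (i, j) = (1 / (1 - 1 / z) ^ k) ^ q * (F z ^\<^sub>m q) $$ (i, j)" for z
    using smult_pow_mat[OF invpoly_mat_carrier[OF F], of "1 / (1 - 1 / z) ^ k" z q]
      carrier_matD[OF invpoly_mat_carrier[OF invpoly_mat_power[OF F]]] ij by simp
  show ?thesis unfolding eq
    by (intro holomorphic_intros holomorphic_on_subset[OF invpoly_mat_holomorphic[OF invpoly_mat_power[OF F] ij]])
      (auto simp: field_simps)
qed

lemma Phi_power_holomorphic:
  assumes "i < 2" "j < 2"
  shows "(\<lambda>z. (\<Phi> z ^\<^sub>m q) $$ (i, j)) holomorphic_on - {0, 1}"
    "(\<lambda>z. (adj2 (\<Phi> z) ^\<^sub>m q) $$ (i, j)) holomorphic_on - {0, 1}"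
  unfolding Phi_numer adj2_smult[OF numer_carrier]
  by (intro smult_power_holomorphic[OF numer_invpoly assms] smult_power_holomorphic[OF invpoly_mat_adj2[OF numer_invpoly] assms])+

text \<open>The exponent \<open>L = k * h\<close> is the order of the denominator of the
  \<open>h\<close>-th power, so the scalar factor clears it. Multiplication by
  \<open>\<Phi>^N\<close> turns \<open>lower_fps\<close> into \<open>upper_fps\<close>.\<close>

definition lower_fps :: "complex fps mat" where
  "lower_fps = (1 - fps_X) ^ L \<cdot>\<^sub>m adj2 Phi_fps ^\<^sub>m h"

definition upper_fps :: "complex fps mat" where
  "upper_fps = (1 - fps_X) ^ L \<cdot>\<^sub>m Phi_fps ^\<^sub>m h"

lemma one_minus_expansion: "(\<lambda>t :: complex. (1 - 1 / (1 / t)) ^ q) has_fps_expansion (1 - fps_X) ^ q"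
  by (simp, intro fps_expansion_intros)

lemma lower_expansion: "mat_expansion (\<lambda>z. (1 - 1 / z) ^ L \<cdot>\<^sub>m adj2 (\<Phi> z) ^\<^sub>m h) lower_fps"
  unfolding lower_fps_def
  by (rule mat_expansion_smult[OF mat_expansion_power[OF mat_expansion_adj2[OF Phi_mat_expansion]] one_minus_expansion])

lemma upper_expansion: "mat_expansion (\<lambda>z. (1 - 1 / z) ^ L \<cdot>\<^sub>m \<Phi> z ^\<^sub>m h) upper_fps"
  unfolding upper_fps_def
  by (rule mat_expansion_smult[OF Phi_power_expansion one_minus_expansion])

lemma clear_denominator:
  fixes A :: "complex mat"
  assumes A: "A \<in> carrier_mat 2 2" and z: "z \<noteq> 1"
  shows "(1 - 1 / z) ^ L \<cdot>\<^sub>m ((1 / (1 - 1 / z) ^ k) \<cdot>\<^sub>m A) ^\<^sub>m h = A ^\<^sub>m h"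
proof -
  have u: "(1 - 1 / z) ^ (k * h) * (1 / (1 - 1 / z) ^ k) ^ h = 1"
    using z by (simp only: power_mult power_one_over) simp
  show ?thesis unfolding N_h(2) smult_pow_mat[OF A]
    by (intro eq_matI) (simp_all add: u mult.assoc[symmetric] del: mult_eq_1_iff)
qed

lemma lower_entry:
  assumes "i < 2" "j < 2"
  obtains p where "degree p \<le> L" "lower_fps $$ (i, j) = fps_of_poly p"
    "\<And>z. z \<noteq> 1 \<Longrightarrow> ((1 - 1 / z) ^ L \<cdot>\<^sub>m adj2 (\<Phi> z) ^\<^sub>m h) $$ (i, j) = poly p (1 / z)"
proof -
  have "invpoly_mat L (\<lambda>z. adj2 (numer k z) ^\<^sub>m h)"
    using invpoly_mat_power[OF invpoly_mat_adj2[OF numer_invpoly]] unfolding N_h(2) .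
  then show thesis
    by (rule fps_entry_of_invpoly_mat[OF _ lower_expansion _ assms])
      (use that in \<open>auto simp: adj2_Phi clear_denominator[OF adj2_carrier]\<close>)
qed

lemma upper_entry:
  assumes "i < 2" "j < 2"
  obtains p where "degree p \<le> L" "upper_fps $$ (i, j) = fps_of_poly p"
    "\<And>z. z \<noteq> 1 \<Longrightarrow> ((1 - 1 / z) ^ L \<cdot>\<^sub>m \<Phi> z ^\<^sub>m h) $$ (i, j) = poly p (1 / z)"
proof -
  have "invpoly_mat L (\<lambda>z. numer k z ^\<^sub>m h)"
    using invpoly_mat_power[OF numer_invpoly] unfolding N_h(2) .
  then show thesis
    by (rule fps_entry_of_invpoly_mat[OF _ upper_expansion _ assms])
      (use that in \<open>auto simp: Phi_numer clear_denominator[OF numer_carrier]\<close>)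
qed

text \<open>The factor \<open>(z / (z - 1)) ^ (k * q)\<close> absorbs the pole of the numerator at
  0, so 1 is the only singularity and both loops give its residue.\<close>

lemma Phi_power_c1_c01:
  assumes ij: "i < 2" "j < 2"
  shows "contour_integral c1 (\<lambda>z. z ^ a * (\<Phi> z ^\<^sub>m q) $$ (i, j)) = contour_integral c01 (\<lambda>z. z ^ a * (\<Phi> z ^\<^sub>m q) $$ (i, j))"
proof -
  obtain p where p: "degree p \<le> k * q" "\<And>z. (numer k z ^\<^sub>m q) $$ (i, j) = poly p (1 / z)"
    by (rule invpoly_matE[OF invpoly_mat_power[OF numer_invpoly] ij]) auto
  define f where "f z = z ^ a * (\<Sum>r\<le>k * q. coeff p r * z ^ (k * q - r)) / (z - 1) ^ (k * q)" for z
  have hol: "f holomorphic_on - {1}" unfolding f_def by (intro holomorphic_intros) auto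
  have eq: "z ^ a * (\<Phi> z ^\<^sub>m q) $$ (i, j) = f z" if z: "z \<noteq> 0" "z \<noteq> 1" for z
  proof -
    have "(\<Phi> z ^\<^sub>m q) $$ (i, j) = (1 / (1 - 1 / z) ^ k) ^ q * (numer k z ^\<^sub>m q) $$ (i, j)"
      unfolding Phi_numer using smult_pow_mat[OF numer_carrier] ij
        carrier_matD[OF invpoly_mat_carrier[OF invpoly_mat_power[OF numer_invpoly]]] by simp
    also have "(1 / (1 - 1 / z) ^ k) ^ q = z ^ (k * q) / (z - 1) ^ (k * q)"
    proof -
      have "1 - 1 / z = (z - 1) / z" using z by (simp add: field_simps)
      then show ?thesis by (simp add: power_divide power_mult)
    qed
    finally show ?thesis unfolding f_def poly_inverse_argument[OF p(1) z(1)] p(2) by simp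
  qed
  have "contour_integral c1 (\<lambda>z. z ^ a * (\<Phi> z ^\<^sub>m q) $$ (i, j)) = contour_integral c1 f"
    by (rule contour_integral_eq, rule eq) (use c1(3) in auto)
  also have "\<dots> = contour_integral c01 f"
    by (rule contour_integral_same_residue[OF hol c1(1,2) _ c1(4) c01(1,2,4,6)]) (use c1(3) in auto)
  also have "\<dots> = contour_integral c01 (\<lambda>z. z ^ a * (\<Phi> z ^\<^sub>m q) $$ (i, j))"
    by (rule contour_integral_eq, rule eq[symmetric]) (use c01(3,4) in auto)
  finally show ?thesis .
qed

text \<open>The \<open>w\<close>-dependent factor of the double integral, with \<open>proj\<close>
  in place of the eigenvectors and without the Cauchy kernel.\<close>

definition row_fn :: "nat \<Rightarrow> nat \<Rightarrow> int \<Rightarrow> nat \<Rightarrow> complex \<Rightarrow> complex" where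
  "row_fn i m' \<xi>' l w = w powi \<xi>' / (1 - 1 / w) ^ L * \<rho>1 w powi (int h - int m') * proj w $$ (i, l)"

text \<open>Expansion at infinity of the Cauchy integral of \<open>row_fn\<close> against
  \<open>1 / (z - w)\<close>, which is the principal part at 1. This integral vanishes at infinity,
  hence the constant term 0.\<close>

definition row_fps :: "nat \<Rightarrow> nat \<Rightarrow> int \<Rightarrow> nat \<Rightarrow> complex fps" where
  "row_fps i m' \<xi>' l = Abs_fps (\<lambda>e. if e = 0 then 0 else
     contour_integral c1 (\<lambda>w. row_fn i m' \<xi>' l w * w ^ (e - 1)) / (2 * of_real pi * \<i>))"

lemma rho1_nonzero: "z \<in> slit \<Longrightarrow> \<rho>1 z \<noteq> 0"
  using norm_rho2(2,3) by simp

lemma row_fn_holomorphic: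
  assumes "i < 2" "l < 2"
  shows "row_fn i m' \<xi>' l holomorphic_on slit"
proof -
  have "(\<lambda>w. \<rho>1 w powi (int h - int m')) holomorphic_on slit"
    by (intro holomorphic_intros rho1_holomorphic) (use rho1_nonzero in auto)
  moreover have "(\<lambda>w::complex. w powi \<xi>' / (1 - 1 / w) ^ L) holomorphic_on slit"
    by (intro holomorphic_intros) (auto simp: field_simps)
  ultimately show ?thesis unfolding row_fn_def
    by (intro holomorphic_on_mult proj_holomorphic assms)
qed

lemma slit_integrable: "f holomorphic_on slit \<Longrightarrow> f contour_integrable_on c1"
  by (rule contour_integrable_holomorphic_simple[OF _ open_slit c1(1,3)])

text \<open>The zero constant term of the row shifts degrees: coefficient \<open>d + 1\<close> of
  the product uses the coefficients of \<open>B\<close> up to \<open>d\<close> only.\<close>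

lemma row_fps_mult:
  fixes B :: "complex fps"
  assumes il: "i < 2" "l < 2"
  shows "(row_fps i m' \<xi>' l * B) $ Suc d =
    contour_integral c1 (\<lambda>w. row_fn i m' \<xi>' l w * (\<Sum>e\<le>d. fps_nth B e * w ^ (d - e))) / (2 * of_real pi * \<i>)"
proof -
  let ?f = "row_fn i m' \<xi>' l"
  have int: "(\<lambda>w. ?f w * w ^ e) contour_integrable_on c1" for e
    by (intro slit_integrable holomorphic_intros row_fn_holomorphic il)
  have "(row_fps i m' \<xi>' l * B) $ Suc d = (\<Sum>e\<le>Suc d. fps_nth B e * row_fps i m' \<xi>' l $ (Suc d - e))"
    by (subst mult.commute) (simp add: fps_mult_nth atLeast0AtMost)
  also have "\<dots> = (\<Sum>e\<le>d. fps_nth B e * row_fps i m' \<xi>' l $ (Suc d - e))"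
    by (simp add: row_fps_def)
  also have "\<dots> = (\<Sum>e\<le>d. fps_nth B e * contour_integral c1 (\<lambda>w. ?f w * w ^ (d - e))) / (2 * of_real pi * \<i>)"
    unfolding sum_divide_distrib by (intro sum.cong refl) (auto simp: row_fps_def Suc_diff_le)
  also have "(\<Sum>e\<le>d. fps_nth B e * contour_integral c1 (\<lambda>w. ?f w * w ^ (d - e))) =
      contour_integral c1 (\<lambda>w. \<Sum>e\<le>d. fps_nth B e * (?f w * w ^ (d - e)))"
    using int by (subst contour_integral_sum) (auto intro!: contour_integrable_lmul simp: contour_integral_lmul)
  also have "(\<lambda>w. \<Sum>e\<le>d. fps_nth B e * (?f w * w ^ (d - e))) = (\<lambda>w. ?f w * (\<Sum>e\<le>d. fps_nth B e * w ^ (d - e)))"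
    by (simp add: sum_distrib_left sum_distrib_right mult_ac)
  finally show ?thesis .
qed

text \<open>Once \<open>d\<close> reaches the degree, the truncated sum is the whole polynomial, and
  the coefficient is an integral of \<open>row_fn\<close> times the function itself. Then
  \<open>proj\<close> can be multiplied with powers of the symbol under the integral.\<close>

lemma row_fps_mult_poly:
  fixes B :: "nat \<Rightarrow> complex fps"
  assumes i: "i < 2" and p: "\<And>l. l < 2 \<Longrightarrow> degree (p l) \<le> d" "\<And>l. l < 2 \<Longrightarrow> B l = fps_of_poly (p l)"
  shows "(\<Sum>l<2. row_fps i m' \<xi>' l * B l) $ Suc d =
    contour_integral c1 (\<lambda>w. \<Sum>l<2. row_fn i m' \<xi>' l w * (w ^ d * poly (p l) (1 / w))) / (2 * of_real pi * \<i>)"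
proof -
  have hol: "(\<lambda>w. row_fn i m' \<xi>' l w * (w ^ d * poly (p l) (1 / w))) holomorphic_on slit" if "l < 2" for l
    by (intro holomorphic_intros row_fn_holomorphic i that) auto
  have "(row_fps i m' \<xi>' l * B l) $ Suc d =
      contour_integral c1 (\<lambda>w. row_fn i m' \<xi>' l w * (w ^ d * poly (p l) (1 / w))) / (2 * of_real pi * \<i>)"
    if l: "l < 2" for l
  proof -
    have "contour_integral c1 (\<lambda>w. row_fn i m' \<xi>' l w * (\<Sum>e\<le>d. fps_nth (B l) e * w ^ (d - e))) =
        contour_integral c1 (\<lambda>w. row_fn i m' \<xi>' l w * (w ^ d * poly (p l) (1 / w)))"
    proof (rule contour_integral_eq)
      fix w assume "w \<in> path_image c1"
      then have "w \<noteq> 0" using c1(3) by auto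
      then show "row_fn i m' \<xi>' l w * (\<Sum>e\<le>d. fps_nth (B l) e * w ^ (d - e)) = row_fn i m' \<xi>' l w * (w ^ d * poly (p l) (1 / w))"
        using poly_inverse_argument[OF p(1)[OF l], of w] p(2)[OF l] by simp
    qed
    then show ?thesis unfolding row_fps_mult[OF i l] by simp
  qed
  then have "(\<Sum>l<2. row_fps i m' \<xi>' l * B l) $ Suc d =
      (\<Sum>l<2. contour_integral c1 (\<lambda>w. row_fn i m' \<xi>' l w * (w ^ d * poly (p l) (1 / w)))) / (2 * of_real pi * \<i>)"
    by (simp add: fps_sum_nth sum_divide_distrib)
  also have "(\<Sum>l<2. contour_integral c1 (\<lambda>w. row_fn i m' \<xi>' l w * (w ^ d * poly (p l) (1 / w)))) =
      contour_integral c1 (\<lambda>w. \<Sum>l<2. row_fn i m' \<xi>' l w * (w ^ d * poly (p l) (1 / w)))"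
    by (rule contour_integral_sum[symmetric]) (auto intro!: slit_integrable hol)
  finally show ?thesis .
qed

definition sol :: "nat \<Rightarrow> nat \<Rightarrow> int \<Rightarrow> nat \<Rightarrow> complex fps" where
  "sol i m' \<xi>' t = (\<Sum>l<2. row_fps i m' \<xi>' l * lower_fps $$ (l, t))"

lemma sum_row_fn_mult:
  assumes w: "w \<in> slit" and it: "i < 2" "t < 2" and A: "A \<in> carrier_mat 2 2" and PA: "proj w * A = s \<cdot>\<^sub>m proj w"
  shows "(\<Sum>l<2. row_fn i m' \<xi>' l w * (w ^ d * ((1 - 1 / w) ^ L \<cdot>\<^sub>m A) $$ (l, t))) =
    w powi (\<xi>' + int d) * (\<rho>1 w powi (int h - int m') * s) * proj w $$ (i, t)"
proof -
  define u where "u = (1 - 1 / w) ^ L"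
  have u: "u \<noteq> 0" using w by (auto simp: field_simps u_def)
  have w0: "w \<noteq> 0" using w by auto
  have "(\<Sum>l<2. row_fn i m' \<xi>' l w * (w ^ d * ((1 - 1 / w) ^ L \<cdot>\<^sub>m A) $$ (l, t))) =
      w powi \<xi>' * w ^ d * \<rho>1 w powi (int h - int m') * (proj w * A) $$ (i, t)"
    unfolding index_mult_2x2[OF proj_carrier A it] row_fn_def u_def[symmetric] using A it u
    by (simp add: numeral_2_eq_2 algebra_simps)
  also have "(proj w * A) $$ (i, t) = s * proj w $$ (i, t)"
    unfolding PA using it carrier_matD[OF proj_carrier] by simp
  finally show ?thesis using w0 by (simp add: power_int_add)
qed

text \<open>Above degree \<open>L\<close> the coefficient is an integral in which multiplying the
  projection by \<open>\<Phi>^(-h)\<close> leaves a nonnegative power of \<rho>2; it vanishes by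
  boundedness at 1. Degree 0 is empty because \<open>row_fps\<close> has no constant term.\<close>

lemma sol_support:
  assumes it: "i < 2" "t < 2" and e: "e = 0 \<or> e > L"
  shows "sol i m' \<xi>' t $ e = 0"
proof (cases e)
  case 0
  then show ?thesis by (simp add: sol_def fps_sum_nth fps_mult_nth row_fps_def)
next
  case (Suc d)
  then have d: "L \<le> d" using e by auto
  have "\<exists>p. degree p \<le> d \<and> lower_fps $$ (l, t) = fps_of_poly p \<and>
      (\<forall>z. z \<noteq> 1 \<longrightarrow> ((1 - 1 / z) ^ L \<cdot>\<^sub>m adj2 (\<Phi> z) ^\<^sub>m h) $$ (l, t) = poly p (1 / z))" if "l < 2" for l
    by (rule lower_entry[OF that it(2)]) (use d in fastforce)
  then obtain p where p: "\<And>l. l < 2 \<Longrightarrow> degree (p l) \<le> d" "\<And>l. l < 2 \<Longrightarrow> lower_fps $$ (l, t) = fps_of_poly (p l)"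
     "\<And>l z. l < 2 \<Longrightarrow> z \<noteq> 1 \<Longrightarrow> ((1 - 1 / z) ^ L \<cdot>\<^sub>m adj2 (\<Phi> z) ^\<^sub>m h) $$ (l, t) = poly (p l) (1 / z)"
    by metis
  have "sol i m' \<xi>' t $ e =
      contour_integral c1 (\<lambda>w. \<Sum>l<2. row_fn i m' \<xi>' l w * (w ^ d * poly (p l) (1 / w))) / (2 * of_real pi * \<i>)"
    unfolding Suc sol_def by (rule row_fps_mult_poly[OF it(1) p(1,2)])
  also have "contour_integral c1 (\<lambda>w. \<Sum>l<2. row_fn i m' \<xi>' l w * (w ^ d * poly (p l) (1 / w))) =
      contour_integral c1 (\<lambda>w. w powi (\<xi>' + int d) * \<rho>2 w ^ m' * proj w $$ (i, t))"
  proof (rule contour_integral_eq)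
    fix w assume "w \<in> path_image c1"
    then have w: "w \<in> slit" using c1(3) by auto
    have "(\<Sum>l<2. row_fn i m' \<xi>' l w * (w ^ d * poly (p l) (1 / w))) =
        (\<Sum>l<2. row_fn i m' \<xi>' l w * (w ^ d * ((1 - 1 / w) ^ L \<cdot>\<^sub>m adj2 (\<Phi> w) ^\<^sub>m h) $$ (l, t)))"
      using w by (intro sum.cong refl) (subst p(3), auto)
    also have "\<dots> = w powi (\<xi>' + int d) * (\<rho>1 w powi (int h - int m') * \<rho>2 w ^ h) * proj w $$ (i, t)"
      by (rule sum_row_fn_mult[OF w it pow_carrier_mat[OF adj2_carrier] proj_mult_adj2_power[OF w]])
    \<comment> \<open>Since \<open>\<rho>1 = 1 / \<rho>2\<close>, the exponents of \<rho>2 add up to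
      \<open>m' - h + h\<close>.\<close>
    also have "\<rho>1 w powi (int h - int m') * \<rho>2 w ^ h = \<rho>2 w ^ m'"
      using norm_rho2(2)[OF w] unfolding norm_rho2(3)[OF w] by (simp add: power_int_diff power_int_divide_distrib field_simps)
    finally show "(\<Sum>l<2. row_fn i m' \<xi>' l w * (w ^ d * poly (p l) (1 / w))) = w powi (\<xi>' + int d) * \<rho>2 w ^ m' * proj w $$ (i, t)" .
  qed
  also have "\<dots> = 0" by (rule contour_integral_rho2_proj(1)[OF it c1(1-3)])
  finally show ?thesis by simp
qed

text \<open>Multiplying the projection by \<open>\<Phi>^h\<close> gives \<open>\<rho>1^(N - m')
  \<pi> = \<Phi>^(N - m') - \<rho>2^(N - m') (1 - \<pi>)\<close>. The last term integrates to 0. The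
  other one has no pole at 0 because the exponent of \<open>w\<close> is nonnegative, so it can be
  moved to \<open>c01\<close>, where the integral is a coefficient of the series.\<close>

lemma row_upper:
  assumes it: "i < 2" "t < 2" and d: "L \<le> d" and m': "m' \<le> N" and \<xi>': "0 \<le> \<xi>' + int d"
  shows "(\<Sum>l<2. row_fps i m' \<xi>' l * upper_fps $$ (l, t)) $ Suc d = (Phi_fps ^\<^sub>m (N - m')) $$ (i, t) $ nat (\<xi>' + int d + 1)"
proof -
  define a where "a = nat (\<xi>' + int d)"
  have a: "\<xi>' + int d = int a" using \<xi>' by (simp add: a_def)
  let ?F = "\<lambda>w. (\<Phi> w ^\<^sub>m (N - m')) $$ (i, t)"
  let ?G = "\<lambda>w. w powi int a * \<rho>2 w ^ (N - m') * ((if i = t then 1 else 0) - proj w $$ (i, t))"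
  have "\<exists>p. degree p \<le> d \<and> upper_fps $$ (l, t) = fps_of_poly p \<and>
      (\<forall>z. z \<noteq> 1 \<longrightarrow> ((1 - 1 / z) ^ L \<cdot>\<^sub>m \<Phi> z ^\<^sub>m h) $$ (l, t) = poly p (1 / z))" if "l < 2" for l
    by (rule upper_entry[OF that it(2)]) (use d in fastforce)
  then obtain p where p: "\<And>l. l < 2 \<Longrightarrow> degree (p l) \<le> d" "\<And>l. l < 2 \<Longrightarrow> upper_fps $$ (l, t) = fps_of_poly (p l)"
     "\<And>l z. l < 2 \<Longrightarrow> z \<noteq> 1 \<Longrightarrow> ((1 - 1 / z) ^ L \<cdot>\<^sub>m \<Phi> z ^\<^sub>m h) $$ (l, t) = poly (p l) (1 / z)"
    by metis
  have 1: "(\<Sum>l<2. row_fps i m' \<xi>' l * upper_fps $$ (l, t)) $ Suc d =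
      contour_integral c1 (\<lambda>w. \<Sum>l<2. row_fn i m' \<xi>' l w * (w ^ d * poly (p l) (1 / w))) / (2 * of_real pi * \<i>)"
    by (rule row_fps_mult_poly[OF it(1) p(1,2)])
  have 2: "contour_integral c1 (\<lambda>w. \<Sum>l<2. row_fn i m' \<xi>' l w * (w ^ d * poly (p l) (1 / w))) =
      contour_integral c1 (\<lambda>w. w ^ a * ?F w - ?G w)"
  proof (rule contour_integral_eq)
    fix w assume "w \<in> path_image c1"
    then have w: "w \<in> slit" using c1(3) by auto
    have "(\<Sum>l<2. row_fn i m' \<xi>' l w * (w ^ d * poly (p l) (1 / w))) =
        (\<Sum>l<2. row_fn i m' \<xi>' l w * (w ^ d * ((1 - 1 / w) ^ L \<cdot>\<^sub>m \<Phi> w ^\<^sub>m h) $$ (l, t)))"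
      using w by (intro sum.cong refl) (subst p(3), auto)
    also have "\<dots> = w powi (\<xi>' + int d) * (\<rho>1 w powi (int h - int m') * \<rho>1 w ^ h) * proj w $$ (i, t)"
      by (rule sum_row_fn_mult[OF w it pow_carrier_mat[OF Phi_carrier] proj_mult_Phi_power[OF w]])
    also have "\<rho>1 w powi (int h - int m') * \<rho>1 w ^ h = \<rho>1 w ^ (N - m')"
    proof -
      have "\<rho>1 w powi (int h - int m') * \<rho>1 w powi int h = \<rho>1 w powi (int h - int m' + int h)"
        by (rule power_int_add[symmetric]) (use rho1_nonzero[OF w] in simp)
      also have "int h - int m' + int h = int (N - m')" using m' N_h(1) by simp
      finally show ?thesis by (simp only: power_int_of_nat)
    qed
    also have "w powi (\<xi>' + int d) * \<rho>1 w ^ (N - m') * proj w $$ (i, t) = w ^ a * ?F w - ?G w"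
      unfolding Phi_power_spectral[OF w it] a by (simp add: algebra_simps)
    finally show "(\<Sum>l<2. row_fn i m' \<xi>' l w * (w ^ d * poly (p l) (1 / w))) = w ^ a * ?F w - ?G w" .
  qed
  have 3: "contour_integral c1 (\<lambda>w. w ^ a * ?F w - ?G w) = contour_integral c1 (\<lambda>w. w ^ a * ?F w) - contour_integral c1 ?G"
  proof (rule contour_integral_diff)
    show "(\<lambda>w. w ^ a * ?F w) contour_integrable_on c1"
      by (intro slit_integrable holomorphic_intros holomorphic_on_subset[OF Phi_power_holomorphic(1)[OF it]]) auto
    show "?G contour_integrable_on c1"
      by (intro slit_integrable holomorphic_intros rho2_holomorphic proj_holomorphic it) auto
  qed
  have 4: "contour_integral c1 ?G = 0" by (rule contour_integral_rho2_proj(2)[OF it c1(1-3)])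
  have 5: "contour_integral c1 (\<lambda>w. w ^ a * ?F w) = contour_integral c01 (\<lambda>w. w powi (int (Suc a) - 1) * ?F w)"
    unfolding Phi_power_c1_c01[OF it] by simp
  have 6: "contour_integral c01 (\<lambda>w. w powi (int (Suc a) - 1) * ?F w) = 2 * of_real pi * \<i> * (Phi_fps ^\<^sub>m (N - m')) $$ (i, t) $ Suc a"
    using c01_coeff[OF Phi_power_holomorphic(1)[OF it], of "N - m'" "(Phi_fps ^\<^sub>m (N - m')) $$ (i, t)" "int (Suc a)"]
      Phi_power_expansion[of "N - m'"] it by (simp add: mat_expansion_def del: of_nat_Suc)
  have 7: "nat (\<xi>' + int d + 1) = Suc a" using a by simp
  show ?thesis unfolding 1 2 3 4 5 6 7 by simp
qed

end

section \<open>The correlation kernel\<close>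

lemma int_double_add:
  assumes "i < 2"
  shows "(2 * a + int i) div 2 = a" "nat ((2 * a + int i) mod 2) = i"
  using assms by (elim less_2_cases'; simp)+

context aztec_contours
begin

text \<open>The coefficient of \<open>t^a\<close> is attached to start block \<open>n - a\<close>,
  so that moving from there to the block of \<open>v\<close> makes up the total degree
  \<open>n - v div 2\<close>. All terms of the Cauchy product are present because degrees 1 to
  \<open>L\<close> fit into the \<open>n\<close> start blocks.\<close>

lemma row_toeplitz:
  fixes X :: "nat \<Rightarrow> complex fps"
  assumes X: "\<And>t e. t < 2 \<Longrightarrow> e = 0 \<or> e > L \<Longrightarrow> X t $ e = 0" and v: "v div 2 \<le> int n"
  shows "(\<Sum>j<r. X (j mod 2) $ (n - j div 2) * block_toeplitz A (int j) v) =
    (\<Sum>t<2. X t * A $$ (t, nat (v mod 2))) $ nat (int n - v div 2)"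
proof -
  define e where "e = nat (int n - v div 2)"
  define s where "s = nat (v mod 2)"
  have e: "v div 2 = int n - int e" using v by (simp add: e_def)
  let ?f = "\<lambda>t a. if a \<le> e then X t $ a * A $$ (t, s) $ (e - a) else 0"
  have "(\<Sum>j<r. X (j mod 2) $ (n - j div 2) * block_toeplitz A (int j) v) =
      (\<Sum>z\<in>{..<2} \<times> {1..n}. ?f (fst z) (snd z))"
  proof (rule sum.reindex_bij_witness[of _ "\<lambda>z. 2 * (n - snd z) + fst z" "\<lambda>j. (j mod 2, n - j div 2)"])
    fix j assume j: "j \<in> {..<r}"
    then have jn: "j div 2 < n" by auto
    show "2 * (n - snd (j mod 2, n - j div 2)) + fst (j mod 2, n - j div 2) = j" using jn by simp
    show "(j mod 2, n - j div 2) \<in> {..<2} \<times> {1..n}" using jn by auto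
    have nat2: "nat (int j mod 2) = j mod 2" by (simp add: nat_mod_distrib)
    have "int n - int e \<le> int (j div 2) \<longleftrightarrow> n - j div 2 \<le> e" using jn by linarith
    moreover have "nat (int (j div 2) - (int n - int e)) = e - (n - j div 2)" using jn by linarith
    ultimately show "?f (fst (j mod 2, n - j div 2)) (snd (j mod 2, n - j div 2)) =
        X (j mod 2) $ (n - j div 2) * block_toeplitz A (int j) v"
      unfolding block_toeplitz_def e nat2 s_def[symmetric] by (simp add: zdiv_int)
  next
    fix z :: "nat \<times> nat" assume "z \<in> {..<2} \<times> {1..n}"
    then obtain t a where z: "z = (t, a)" "t < 2" "1 \<le> a" "a \<le> n" by auto
    then have "(2 * (n - a) + t) div 2 = n - a" "(2 * (n - a) + t) mod 2 = t" by auto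
    then show "((2 * (n - snd z) + fst z) mod 2, n - (2 * (n - snd z) + fst z) div 2) = z"
      using z by simp
    show "2 * (n - snd z) + fst z \<in> {..<r}" using z by auto
  qed
  also have "\<dots> = (\<Sum>t<2. \<Sum>a=1..n. ?f t a)" by (simp add: sum.cartesian_product split_def)
  also have "\<dots> = (\<Sum>t<2. \<Sum>a=0..e. X t $ a * A $$ (t, s) $ (e - a))"
  proof (rule sum.cong[OF refl])
    fix t :: nat assume t: "t \<in> {..<2}"
    \<comment> \<open>Index 0 and indices beyond \<open>n \<ge> L\<close> contribute nothing, so
      both ranges can be compared with the one up to \<open>n + e\<close>.\<close>
    have "(\<Sum>a=1..n. ?f t a) = (\<Sum>a=0..n + e. ?f t a)"
      by (rule sum.mono_neutral_left) (use X[of t] t n in \<open>auto simp: Suc_le_eq\<close>)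
    also have "\<dots> = (\<Sum>a=0..e. X t $ a * A $$ (t, s) $ (e - a))"
      by (rule sum.mono_neutral_cong_right) auto
    finally show "(\<Sum>a=1..n. ?f t a) = (\<Sum>a=0..e. X t $ a * A $$ (t, s) $ (e - a))" .
  qed
  finally show ?thesis by (simp add: fps_sum_nth fps_mult_nth e_def s_def)
qed

lemma lower_mult_Phi:
  "lower_fps * Phi_fps ^\<^sub>m q = (1 - fps_X) ^ L \<cdot>\<^sub>m (adj2 Phi_fps ^\<^sub>m h * Phi_fps ^\<^sub>m q)"
  unfolding lower_fps_def
  by (rule mult_smult_assoc_mat[OF pow_carrier_mat[OF adj2_carrier] pow_carrier_mat[OF Phi_fps_carrier]])

lemma lower_mult_Phi_N:
  assumes "N > 0"
  shows "lower_fps * Phi_fps ^\<^sub>m N = upper_fps"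
proof -
  have "N - h = h" "\<not> N \<le> h" using N_h(1) assms by linarith+
  then show ?thesis
    unfolding lower_mult_Phi upper_fps_def pow_mat_cancel[OF adj2_carrier Phi_fps_carrier Phi_fps_adj2(2)] by simp
qed

lemma sol_mult_Phi:
  assumes j: "j < 2"
  shows "(\<Sum>t<2. sol i m' \<xi>' t * (Phi_fps ^\<^sub>m q) $$ (t, j)) =
    (\<Sum>l<2. row_fps i m' \<xi>' l * (lower_fps * Phi_fps ^\<^sub>m q) $$ (l, j))"
proof -
  have c: "lower_fps \<in> carrier_mat 2 2" using lower_expansion by (simp add: mat_expansion_def)
  have "(lower_fps * Phi_fps ^\<^sub>m q) $$ (l, j) = (\<Sum>t<2. lower_fps $$ (l, t) * (Phi_fps ^\<^sub>m q) $$ (t, j))" if "l < 2" for l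
    using index_mult_2x2[OF c pow_carrier_mat[OF Phi_fps_carrier] that j] by (simp add: numeral_2_eq_2)
  then have "(\<Sum>l<2. row_fps i m' \<xi>' l * (lower_fps * Phi_fps ^\<^sub>m q) $$ (l, j)) =
      (\<Sum>l<2. \<Sum>t<2. row_fps i m' \<xi>' l * (lower_fps $$ (l, t) * (Phi_fps ^\<^sub>m q) $$ (t, j)))"
    by (simp add: sum_distrib_left)
  also have "\<dots> = (\<Sum>t<2. sol i m' \<xi>' t * (Phi_fps ^\<^sub>m q) $$ (t, j))"
    by (subst sum.swap) (simp add: sol_def sum_distrib_right mult.assoc)
  finally show ?thesis ..
qed

lemma U_block_toeplitz:
  assumes "x \<in> S" "y \<in> S" "a \<le> b"
  shows "U (2 * k * a, x) (2 * k * b, y) = block_toeplitz (Phi_fps ^\<^sub>m (b - a)) x y"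
proof -
  have eq: "2 * k * b = 2 * k * a + 2 * k * (b - a)" using assms(3) by (simp add: algebra_simps flip: distrib_left)
  show ?thesis
    unfolding propagator_def fst_conv snd_conv eq
      path_sum_block_toeplitz[OF step_fps_carrier transition_eq_block_toeplitz assms(1,2)] fps_mat_prod_step_fps ..
qed

lemma U_backwards: "a > b \<Longrightarrow> U (2 * k * a, x) (2 * k * b, y) = 0"
  unfolding propagator_def using k by (intro path_sum_backwards) simp

lemma two_xi_in_S:
  assumes "\<xi> \<in> {- int L..-1}" "i < 2"
  shows "2 * (\<xi> + int n) + int i \<in> S"
  using assms by auto

text \<open>End point \<open>l\<close> asks for coefficient \<open>n + L - l div 2\<close>, which
  exceeds \<open>L\<close> as \<open>l div 2 < n\<close>; this puts every equation into the range of
  \<open>row_upper\<close>. Its other condition, \<open>0 \<le> \<xi>' + d\<close>, follows from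
  \<open>\<xi>' \<ge> - L\<close>.\<close>

lemma sol_solves:
  assumes i: "i < 2" and m': "m' < N" and \<xi>': "\<xi>' \<in> {- int L..-1}" and l: "l < r"
  shows "(\<Sum>j<r. sol i m' \<xi>' (j mod 2) $ (n - j div 2) * G j l) =
    U (2 * k * m', 2 * (\<xi>' + int n) + int i) (M, final (l + 1))"
proof -
  define v where "v = int l - 2 * int L"
  define e where "e = n + L - l div 2"
  define d where "d = e - 1"
  have ln: "l div 2 < n" using l by auto
  have int_kN: "int (k * N) = 2 * int L" using twice_L by (metis of_nat_mult of_nat_numeral)
  have final: "final (l + 1) = v" using l int_kN by (simp add: final_def v_def)
  have v: "v \<in> S" using l n by (auto simp: v_def)
  have dm: "(a - 2 * b) div 2 = a div 2 - b" "(a - 2 * b) mod 2 = a mod 2" for a b :: int by presburger+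
  have vdiv: "v div 2 = int (l div 2) - int L" unfolding v_def dm by (simp add: zdiv_int)
  have e: "nat (int n - v div 2) = e" unfolding vdiv e_def by linarith
  have d: "e = Suc d" "L \<le> d" using ln by (auto simp: d_def e_def)
  have s2: "nat (v mod 2) < 2" by auto
  have "(\<Sum>j<r. sol i m' \<xi>' (j mod 2) $ (n - j div 2) * G j l) =
      (\<Sum>j<r. sol i m' \<xi>' (j mod 2) $ (n - j div 2) * block_toeplitz (Phi_fps ^\<^sub>m N) (int j) v)"
  proof (rule sum.cong[OF refl])
    fix j assume j: "j \<in> {..<r}"
    have st: "start (j + 1) = int j" using j by (simp add: start_def)
    have jS: "int j \<in> S" using j by auto
    have "U (0, int j) (M, v) = block_toeplitz (Phi_fps ^\<^sub>m N) (int j) v"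
      using U_block_toeplitz[OF jS v, of 0 N] by simp
    then have "G j l = block_toeplitz (Phi_fps ^\<^sub>m N) (int j) v"
      by (simp only: G_def final st)
    then show "sol i m' \<xi>' (j mod 2) $ (n - j div 2) * G j l =
        sol i m' \<xi>' (j mod 2) $ (n - j div 2) * block_toeplitz (Phi_fps ^\<^sub>m N) (int j) v" by simp
  qed
  also have "\<dots> = (\<Sum>t<2. sol i m' \<xi>' t * (Phi_fps ^\<^sub>m N) $$ (t, nat (v mod 2))) $ Suc d"
    using row_toeplitz[of "sol i m' \<xi>'" v, OF sol_support[OF i]] ln unfolding e d(1) by (simp add: vdiv)
  also have "\<dots> = (\<Sum>l<2. row_fps i m' \<xi>' l * upper_fps $$ (l, nat (v mod 2))) $ Suc d"
    unfolding sol_mult_Phi[OF s2] using m' by (simp add: lower_mult_Phi_N)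
  also have "\<dots> = (Phi_fps ^\<^sub>m (N - m')) $$ (i, nat (v mod 2)) $ nat (\<xi>' + int d + 1)"
    using m' \<xi>' d(2) by (intro row_upper i s2) auto
  also have "\<dots> = block_toeplitz (Phi_fps ^\<^sub>m (N - m')) (2 * (\<xi>' + int n) + int i) v"
  proof -
    have x: "(2 * (\<xi>' + int n) + int i) div 2 = \<xi>' + int n" "nat ((2 * (\<xi>' + int n) + int i) mod 2) = i"
      by (rule int_double_add[OF i])+
    have de: "int d = int n + int L - int (l div 2) - 1" using ln by (simp add: d_def e_def)
    have eq: "\<xi>' + int d + 1 = \<xi>' + int n - v div 2" unfolding vdiv de by simp
    have "v div 2 \<le> \<xi>' + int n" using \<xi>' ln unfolding vdiv by auto
    then show ?thesis unfolding block_toeplitz_def x eq by simp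
  qed
  also have "\<dots> = U (2 * k * m', 2 * (\<xi>' + int n) + int i) (2 * k * N, v)"
    using U_block_toeplitz[OF two_xi_in_S[OF \<xi>' i] v, of m' N] m' by simp
  finally show ?thesis unfolding final .
qed

lemma mat_powi_Phi:
  assumes "z \<noteq> 1"
  shows "mat_powi (\<Phi> z) (int m - int q) = adj2 (\<Phi> z) ^\<^sub>m q * \<Phi> z ^\<^sub>m m"
  unfolding pow_mat_cancel[OF adj2_carrier Phi_carrier Phi_adj2(2)[OF assms]] mat_powi_def mat_inv_Phi[OF assms]
  by (auto simp: nat_diff_distrib' le_antisym)
    (metis carrier_matD(1) pow_mat.simps(1) Phi_carrier adj2_carrier)

lemma single_integral:
  assumes ij: "i < 2" "j < 2" and m: "m' \<le> m"
  shows "contour_integral c01 (\<lambda>z. ((z powi (\<xi>' - \<xi>) / z) \<cdot>\<^sub>m mat_powi (\<Phi> z) (int m - int m')) $$ (i, j)) =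
    2 * of_real pi * \<i> * block_toeplitz (Phi_fps ^\<^sub>m (m - m')) (2 * (\<xi>' + int n) + int i) (2 * (\<xi> + int n) + int j)"
proof -
  let ?F = "\<lambda>z. (\<Phi> z ^\<^sub>m (m - m')) $$ (i, j)"
  have "contour_integral c01 (\<lambda>z. ((z powi (\<xi>' - \<xi>) / z) \<cdot>\<^sub>m mat_powi (\<Phi> z) (int m - int m')) $$ (i, j)) =
      contour_integral c01 (\<lambda>z. z powi (\<xi>' - \<xi> - 1) * ?F z)"
  proof (rule contour_integral_eq)
    fix z assume "z \<in> path_image c01"
    then have z: "z \<noteq> 0" using c01(3) by auto
    have "mat_powi (\<Phi> z) (int m - int m') = \<Phi> z ^\<^sub>m (m - m')"
      using m by (simp add: mat_powi_def nat_diff_distrib')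
    then show "((z powi (\<xi>' - \<xi>) / z) \<cdot>\<^sub>m mat_powi (\<Phi> z) (int m - int m')) $$ (i, j) = z powi (\<xi>' - \<xi> - 1) * ?F z"
      using z ij carrier_matD[OF Phi_carrier] by (simp add: power_int_diff)
  qed
  also have "\<dots> = 2 * of_real pi * \<i> * (if \<xi>' - \<xi> < 0 then 0 else (Phi_fps ^\<^sub>m (m - m')) $$ (i, j) $ nat (\<xi>' - \<xi>))"
    by (rule c01_coeff[OF Phi_power_holomorphic(1)[OF ij]])
      (use Phi_power_expansion[of "m - m'"] ij in \<open>simp add: mat_expansion_def\<close>)
  also have "(if \<xi>' - \<xi> < 0 then 0 else (Phi_fps ^\<^sub>m (m - m')) $$ (i, j) $ nat (\<xi>' - \<xi>)) =
      block_toeplitz (Phi_fps ^\<^sub>m (m - m')) (2 * (\<xi>' + int n) + int i) (2 * (\<xi> + int n) + int j)"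
    unfolding block_toeplitz_def int_double_add[OF ij(1)] int_double_add[OF ij(2)] by auto
  finally show ?thesis .
qed

text \<open>The inner integral is evaluated by expansion at infinity, the Cauchy kernel supplying
  powers of \<open>w\<close>; the outer one then has the form of a coefficient of
  \<open>row_fps\<close> times a series. Each integral contributes one factor
  \<open>2 pi i\<close>.\<close>

lemma double_integral:
  assumes ij: "i < 2" "j < 2" and \<xi>: "\<xi> \<le> -1"
    and simple: "simple_path c1" and E: "eigenvector_matrix \<Phi> \<rho>1 \<rho>2 E"
  shows "contour_integral c1 (\<lambda>w. contour_integral c01 (\<lambda>z.
      ((w powi \<xi>' / z powi (\<xi> + 1) * ((1 - 1 / z) ^ L / (1 - 1 / w) ^ L) * \<rho>1 w powi (int h - int m') / (z - w)) \<cdot>\<^sub>m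
        (E w * mat2 1 0 0 0 * mat_inv (E w) * mat_powi (\<Phi> z) (int m - int h))) $$ (i, j))) =
    (2 * of_real pi * \<i>)\<^sup>2 * (\<Sum>t<2. sol i m' \<xi>' t * (Phi_fps ^\<^sub>m m) $$ (t, j)) $ nat (- \<xi>)"
proof -
  \<comment> \<open>As \<open>\<xi> \<le> -1\<close>, the power of \<open>z\<close> in the integrand
    is \<open>z ^ d\<close> with natural \<open>d\<close>, and the coefficient wanted is number
    \<open>d + 1\<close>.\<close>
  define d where "d = nat (- \<xi> - 1)"
  have d: "\<xi> + 1 = - int d" "nat (- \<xi>) = Suc d" using \<xi> by (auto simp: d_def)
  define B where "B l = (lower_fps * Phi_fps ^\<^sub>m m) $$ (l, j)" for l
  define b where "b l z = ((1 - 1 / z) ^ L \<cdot>\<^sub>m (adj2 (\<Phi> z) ^\<^sub>m h * \<Phi> z ^\<^sub>m m)) $$ (l, j)" for l z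
  have ac: "adj2 (\<Phi> z) ^\<^sub>m h \<in> carrier_mat 2 2" for z by (rule pow_carrier_mat[OF adj2_carrier])
  have pc: "\<Phi> z ^\<^sub>m m \<in> carrier_mat 2 2" for z by (rule pow_carrier_mat[OF Phi_carrier])
  note apc = mult_carrier_mat[OF ac pc]
  have b_exp: "(\<lambda>t. b l (1 / t)) has_fps_expansion B l" if "l < 2" for l
    using mat_expansion_smult[OF mat_expansion_mult[OF mat_expansion_power[OF mat_expansion_adj2[OF Phi_mat_expansion], of h]
        Phi_power_expansion[of m]] one_minus_expansion[of L]] that ij(2)
    unfolding b_def B_def lower_mult_Phi mat_expansion_def by blast
  have b_eq: "b l z = (1 - 1 / z) ^ L * ((adj2 (\<Phi> z) ^\<^sub>m h) $$ (l, 0) * (\<Phi> z ^\<^sub>m m) $$ (0, j) +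
      (adj2 (\<Phi> z) ^\<^sub>m h) $$ (l, 1) * (\<Phi> z ^\<^sub>m m) $$ (1, j))" if "l < 2" for l z
    using index_mult_2x2[OF ac pc that ij(2), of z] carrier_matD[OF apc[of z]] that ij(2)
    by (simp add: b_def del: index_mult_mat(1))
  have b_hol: "b l holomorphic_on - {0, 1}" if "l < 2" for l
    unfolding b_eq[OF that, abs_def]
    by (intro holomorphic_intros Phi_power_holomorphic ij that) auto
  define A where "A = {z. \<not> similar_mat_wit (\<Phi> z) (mat2 (\<rho>1 z) 0 0 (\<rho>2 z)) (E z) (mat_inv (E z))}"
  have A: "finite A" using E by (simp add: A_def eigenvector_matrix_def)
  let ?g = "\<lambda>w. \<Sum>l<2. row_fn i m' \<xi>' l w * (2 * of_real pi * \<i> * (\<Sum>e\<le>d. fps_nth (B l) e * w ^ (d - e)))"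
  let ?I = "\<lambda>w z. ((w powi \<xi>' / z powi (\<xi> + 1) * ((1 - 1 / z) ^ L / (1 - 1 / w) ^ L) * \<rho>1 w powi (int h - int m') / (z - w)) \<cdot>\<^sub>m
        (E w * mat2 1 0 0 0 * mat_inv (E w) * mat_powi (\<Phi> z) (int m - int h))) $$ (i, j)"
  have inner: "contour_integral c01 (?I w) = ?g w" if w: "w \<in> path_image c1 - A" for w
  proof -
    have ws: "w \<in> slit" using w c1(3) by auto
    have proj: "E w * mat2 1 0 0 0 * mat_inv (E w) = proj w"
      by (rule spectral_projection_eq[OF ws]) (use w in \<open>simp add: A_def\<close>)
    have wn: "w \<notin> path_image c01" "winding_number c01 w = 1" using c1_c01 w by auto
    have int: "(\<lambda>z. z ^ d * b l z / (z - w)) contour_integrable_on c01" if "l < 2" for l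
    proof (rule contour_integrable_holomorphic_simple[where S = "- {0, 1, w}"])
      show "(\<lambda>z. z ^ d * b l z / (z - w)) holomorphic_on - {0, 1, w}"
        by (intro holomorphic_intros holomorphic_on_subset[OF b_hol[OF that]]) auto
    qed (use c01 wn in \<open>auto simp: open_Compl finite_imp_closed\<close>)
    have "contour_integral c01 (?I w) = contour_integral c01 (\<lambda>z. \<Sum>l<2. row_fn i m' \<xi>' l w * (z ^ d * b l z / (z - w)))"
    proof (rule contour_integral_eq)
      fix z assume "z \<in> path_image c01"
      then have z: "z \<noteq> 0" "z \<noteq> 1" using c01(3,4) by auto
      have zp: "1 / z powi (\<xi> + 1) = z ^ d" unfolding d(1) by (simp add: power_int_minus divide_inverse)
      have idx: "(proj w * (adj2 (\<Phi> z) ^\<^sub>m h * \<Phi> z ^\<^sub>m m)) $$ (i, j) * (1 - 1 / z) ^ L =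
          proj w $$ (i, 0) * b 0 z + proj w $$ (i, 1) * b 1 z"
        unfolding index_mult_2x2[OF proj_carrier apc ij] using carrier_matD[OF apc[of z]] ij(2)
        by (simp add: b_def algebra_simps del: index_mult_mat(1))
      have "?I w z = (w powi \<xi>' / z powi (\<xi> + 1) * ((1 - 1 / z) ^ L / (1 - 1 / w) ^ L) * \<rho>1 w powi (int h - int m') / (z - w)) *
          (proj w * (adj2 (\<Phi> z) ^\<^sub>m h * \<Phi> z ^\<^sub>m m)) $$ (i, j)"
        unfolding proj mat_powi_Phi[OF z(2)] using ij carrier_matD[OF mult_carrier_mat[OF proj_carrier apc]]
        by (simp del: index_mult_mat(1))
      also have "\<dots> = (w powi \<xi>' / (1 - 1 / w) ^ L * \<rho>1 w powi (int h - int m')) * (1 / z powi (\<xi> + 1)) *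
          ((proj w * (adj2 (\<Phi> z) ^\<^sub>m h * \<Phi> z ^\<^sub>m m)) $$ (i, j) * (1 - 1 / z) ^ L) / (z - w)"
        by (simp only: divide_inverse mult_ac mult_1)
      also have "\<dots> = (\<Sum>l<2. row_fn i m' \<xi>' l w * (z ^ d * b l z / (z - w)))"
        unfolding zp idx row_fn_def by (simp add: numeral_2_eq_2 divide_inverse algebra_simps)
      finally show "?I w z = (\<Sum>l<2. row_fn i m' \<xi>' l w * (z ^ d * b l z / (z - w)))" .
    qed
    also have "\<dots> = (\<Sum>l<2. contour_integral c01 (\<lambda>z. row_fn i m' \<xi>' l w * (z ^ d * b l z / (z - w))))"
      by (rule contour_integral_sum) (use int in \<open>auto intro!: contour_integrable_lmul simp del: times_divide_eq_right\<close>)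
    also have "\<dots> = (\<Sum>l<2. row_fn i m' \<xi>' l w * contour_integral c01 (\<lambda>z. z ^ d * b l z / (z - w)))"
      by (intro sum.cong refl contour_integral_lmul int) simp
    also have "\<dots> = ?g w"
    proof (rule sum.cong[OF refl])
      fix l :: nat assume "l \<in> {..<2}"
      then have l: "l < 2" by simp
      have "contour_integral c01 (\<lambda>z. z ^ d * b l z / (z - w)) = 2 * of_real pi * \<i> * (\<Sum>e\<le>d. fps_nth (B l) e * w ^ (d - e))"
        by (rule contour_integral_coeff_cauchy_kernel[where K = "{0, 1}", OF _ _ b_hol[OF l] c01(1,2) _ wn(1) _ wn(2) b_exp[OF l]])
          (use c01 in auto)
      then show "row_fn i m' \<xi>' l w * contour_integral c01 (\<lambda>z. z ^ d * b l z / (z - w)) =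
          row_fn i m' \<xi>' l w * (2 * of_real pi * \<i> * (\<Sum>e\<le>d. fps_nth (B l) e * w ^ (d - e)))" by simp
    qed
    finally show ?thesis .
  qed
  \<comment> \<open>At the finitely many points of \<open>A\<close> the matrix \<open>E\<close> is
    arbitrary, but a simple path passes through them at finitely many parameters, so they do not
    affect the integral.\<close>
  have "contour_integral c1 (\<lambda>w. contour_integral c01 (?I w)) = contour_integral c1 ?g"
    by (rule contour_integral_spike_finite_simple_path[OF A simple refl inner])
  also have "\<dots> = contour_integral c1 (\<lambda>w. \<Sum>l<2. (2 * of_real pi * \<i>) * (row_fn i m' \<xi>' l w * (\<Sum>e\<le>d. fps_nth (B l) e * w ^ (d - e))))"
    by (simp add: mult_ac)
  also have "\<dots> = (\<Sum>l<2. (2 * of_real pi * \<i>) * contour_integral c1 (\<lambda>w. row_fn i m' \<xi>' l w * (\<Sum>e\<le>d. fps_nth (B l) e * w ^ (d - e))))"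
  proof -
    have "(\<lambda>w. row_fn i m' \<xi>' l w * (\<Sum>e\<le>d. fps_nth (B l) e * w ^ (d - e))) contour_integrable_on c1" if "l < 2" for l
      by (intro slit_integrable holomorphic_intros row_fn_holomorphic ij that)
    then show ?thesis
      by (subst contour_integral_sum) (auto intro!: contour_integrable_lmul simp: contour_integral_lmul)
  qed
  also have "\<dots> = (\<Sum>l<2. (2 * of_real pi * \<i>)\<^sup>2 * (row_fps i m' \<xi>' l * B l) $ Suc d)"
    by (intro sum.cong refl) (simp add: row_fps_mult[OF ij(1)] power2_eq_square)
  also have "\<dots> = (2 * of_real pi * \<i>)\<^sup>2 * (\<Sum>t<2. sol i m' \<xi>' t * (Phi_fps ^\<^sub>m m) $$ (t, j)) $ nat (- \<xi>)"
    unfolding sol_mult_Phi[OF ij(2)] d(2) by (simp add: B_def fps_sum_nth sum_distrib_left)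
  finally show ?thesis .
qed

end


theorem theorem1p1:
  fixes k N n :: nat
    and \<alpha> \<beta> \<gamma> :: "nat \<Rightarrow> real"
    and \<rho>1 \<rho>2 :: "complex \<Rightarrow> complex"
    and E :: "complex \<Rightarrow> complex mat"
    and c1 c01 :: "real \<Rightarrow> complex"
  assumes "k \<ge> 1" and "N \<ge> 2" and "even N"
    and "\<And>m. m \<in> {1..k} \<Longrightarrow> \<alpha> m > 0 \<and> \<beta> m > 0 \<and> \<gamma> m > 0"
    and "n \<ge> k * N div 2"
    and "eigenvalue_branches (Phi k \<alpha> \<beta> \<gamma>) \<rho>1 \<rho>2"
    and "eigenvector_matrix (Phi k \<alpha> \<beta> \<gamma>) \<rho>1 \<rho>2 E"
    and "pos_simple_loop c1" and "card (path_image c1 \<inter> \<real>) = 2"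
    and "1 \<in> inside (path_image c1)" and "0 \<in> outside (path_image c1)"
    and "pos_simple_loop c01" and "card (path_image c01 \<inter> \<real>) = 2"
    and "0 \<in> inside (path_image c01)" and "path_image c1 \<subseteq> inside (path_image c01)"
  shows "prob_space (aztec_process k \<alpha> \<beta> \<gamma> N n) \<and>
    (\<exists>K. correlation_kernel (aztec_process k \<alpha> \<beta> \<gamma> N n) (shifted_points k N n)
           ({0..2*k*N} \<times> UNIV) K \<and>
      (\<forall>m m' \<xi> \<xi>'. 0 < m \<and> m < N \<and> 0 < m' \<and> m' < N \<and>
          \<xi> \<in> {- int (k * N div 2)..-1} \<and> \<xi>' \<in> {- int (k * N div 2)..-1} \<longrightarrow>
        kernel_block K (2 * k * m) \<xi> (2 * k * m') \<xi>' =
          (- of_bool (m > m') / (2 * of_real pi * \<i>)) \<cdot>\<^sub>m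
            contour_integral_mat2 c01 (\<lambda>z.
              (z powi (\<xi>' - \<xi>) / z) \<cdot>\<^sub>m mat_powi (Phi k \<alpha> \<beta> \<gamma> z) (int m - int m'))
          + (1 / (2 * of_real pi * \<i>)\<^sup>2) \<cdot>\<^sub>m
            contour_integral_mat2 c1 (\<lambda>w. contour_integral_mat2 c01 (\<lambda>z.
              (w powi \<xi>' / z powi (\<xi> + 1)
                * ((1 - 1 / z) ^ (k * N div 2) / (1 - 1 / w) ^ (k * N div 2))
                * \<rho>1 w powi (int (N div 2) - int m') / (z - w)) \<cdot>\<^sub>m
              (E w * mat2 1 0 0 0 * mat_inv (E w)
                * mat_powi (Phi k \<alpha> \<beta> \<gamma> z) (int m - int (N div 2)))))))"
proof -
  from assms(4) have wpos: "\<And>m. m \<in> {1..k} \<Longrightarrow> \<alpha> m > 0" "\<And>m. m \<in> {1..k} \<Longrightarrow> \<beta> m > 0" "\<And>m. m \<in> {1..k} \<Longrightarrow> \<gamma> m > 0"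
    by auto
  note loop1 = assms(8)[unfolded pos_simple_loop_def] and loop01 = assms(12)[unfolded pos_simple_loop_def]
  have comp: "compact (path_image c01)" "connected (path_image c01)"
    using loop01 by (auto intro: compact_path_image connected_path_image valid_path_imp_path)
  \<comment> \<open>Needed for the winding number of \<open>c01\<close> around the pole at 1, as the
    hypotheses locate 1 relative to \<open>c1\<close> only.\<close>
  have one_in: "1 \<in> inside (path_image c01)"
    by (rule inside_inside_loop[OF comp assms(15,10)])
  have not_on: "z \<notin> path_image c" if "z \<in> inside (path_image c)" for z :: complex and c
    using that inside_no_overlap[of "path_image c"] by blast
  interpret aztec_contours k \<alpha> \<beta> \<gamma> N n \<rho>1 \<rho>2 c1 c01
  proof unfold_locales
    show "path_image c1 \<subseteq> - \<real>\<^sub>\<le>\<^sub>0 - {1}"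
      using loop_avoids_nonpos_Reals[OF assms(10,11,9)] not_on[OF assms(10)] by blast
    show "w \<notin> path_image c01" "winding_number c01 w = 1" if "w \<in> path_image c1" for w
    proof -
      have w: "w \<in> inside (path_image c01)" using assms(15) that by blast
      show "w \<notin> path_image c01" by (rule not_on[OF w])
      show "winding_number c01 w = 1" using loop01 w by blast
    qed
  qed (use assms(1-3,5,6) wpos loop1 loop01 assms(10,14) one_in not_on in blast)+
  obtain K where K: "correlation_kernel (aztec_process k \<alpha> \<beta> \<gamma> N n) (shifted_points k N n) ({0..M} \<times> UNIV) K"
    and KX: "\<And>p p' x x' X. p \<le> M \<Longrightarrow> p' \<le> M \<Longrightarrow> x \<in> S \<Longrightarrow> x' \<in> S \<Longrightarrow>
       (\<And>l. l < r \<Longrightarrow> (\<Sum>j<r. X j * G j l) = U (p', x') (M, final (l + 1))) \<Longrightarrow>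
       K (p, x - 2 * int n) (p', x' - 2 * int n) =
         (if (p, x) = (p', x') then 1 else 0) - U (p', x') (p, x) + (\<Sum>j<r. X j * U (0, start (j + 1)) (p, x))"
    using exists_correlation_kernel by blast
  have main: "kernel_block K (2 * k * m) \<xi> (2 * k * m') \<xi>' =
          (- of_bool (m > m') / (2 * of_real pi * \<i>)) \<cdot>\<^sub>m
            contour_integral_mat2 c01 (\<lambda>z.
              (z powi (\<xi>' - \<xi>) / z) \<cdot>\<^sub>m mat_powi (Phi k \<alpha> \<beta> \<gamma> z) (int m - int m'))
          + (1 / (2 * of_real pi * \<i>)\<^sup>2) \<cdot>\<^sub>m
            contour_integral_mat2 c1 (\<lambda>w. contour_integral_mat2 c01 (\<lambda>z.
              (w powi \<xi>' / z powi (\<xi> + 1)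
                * ((1 - 1 / z) ^ (k * N div 2) / (1 - 1 / w) ^ (k * N div 2))
                * \<rho>1 w powi (int (N div 2) - int m') / (z - w)) \<cdot>\<^sub>m
              (E w * mat2 1 0 0 0 * mat_inv (E w)
                * mat_powi (Phi k \<alpha> \<beta> \<gamma> z) (int m - int (N div 2)))))" (is "_ = ?A1 + ?A2")
    if m: "0 < m" "m < N" "0 < m'" "m' < N" and \<xi>: "\<xi> \<in> {- int L..-1}" and \<xi>': "\<xi>' \<in> {- int L..-1}"
    for m m' :: nat and \<xi> \<xi>' :: int
  proof (rule eq_matI)
    show "dim_row (kernel_block K (2 * k * m) \<xi> (2 * k * m') \<xi>') = dim_row (?A1 + ?A2)"
      "dim_col (kernel_block K (2 * k * m) \<xi> (2 * k * m') \<xi>') = dim_col (?A1 + ?A2)"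
      by (simp_all add: kernel_block_def contour_integral_mat2_def)
    fix i j assume "i < dim_row (?A1 + ?A2)" "j < dim_col (?A1 + ?A2)"
    then have ij: "i < 2" "j < 2" by (simp_all add: contour_integral_mat2_def)
    \<comment> \<open>The column index \<open>j\<close> belongs to the first position and the row
      index \<open>i\<close> to the second, in accordance with \<open>kernel_block\<close>.\<close>
    define x where "x = 2 * (\<xi> + int n) + int j"
    define x' where "x' = 2 * (\<xi>' + int n) + int i"
    have xS: "x \<in> S" "x' \<in> S" unfolding x_def x'_def by (rule two_xi_in_S; use \<xi> \<xi>' ij in simp)+
    have pM: "2 * k * m \<le> M" "2 * k * m' \<le> M" using m by auto
    define s where "s = (\<Sum>t<2. sol i m' \<xi>' t * (Phi_fps ^\<^sub>m m) $$ (t, j)) $ nat (- \<xi>)"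
    have row: "(\<Sum>l<r. sol i m' \<xi>' (l mod 2) $ (n - l div 2) * U (0, start (l + 1)) (2 * k * m, x)) = s"
    proof -
      have "(\<Sum>l<r. sol i m' \<xi>' (l mod 2) $ (n - l div 2) * U (0, start (l + 1)) (2 * k * m, x)) =
          (\<Sum>l<r. sol i m' \<xi>' (l mod 2) $ (n - l div 2) * block_toeplitz (Phi_fps ^\<^sub>m m) (int l) x)"
      proof (rule sum.cong[OF refl])
        fix l assume l: "l \<in> {..<r}"
        have st: "start (l + 1) = int l" using l by (simp add: start_def)
        have "int l \<in> S" using l by auto
        then have "U (0, int l) (2 * k * m, x) = block_toeplitz (Phi_fps ^\<^sub>m m) (int l) x"
          using U_block_toeplitz[OF _ xS(1), of "int l" 0 m] by simp
        then show "sol i m' \<xi>' (l mod 2) $ (n - l div 2) * U (0, start (l + 1)) (2 * k * m, x) =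
            sol i m' \<xi>' (l mod 2) $ (n - l div 2) * block_toeplitz (Phi_fps ^\<^sub>m m) (int l) x"
          by (simp only: st)
      qed
      also have "\<dots> = (\<Sum>t<2. sol i m' \<xi>' t * (Phi_fps ^\<^sub>m m) $$ (t, nat (x mod 2))) $ nat (int n - x div 2)"
      proof (rule row_toeplitz[OF sol_support[OF ij(1)]])
        show "x div 2 \<le> int n" unfolding x_def int_double_add[OF ij(2)] using \<xi> by simp
      qed
      finally show ?thesis unfolding s_def x_def int_double_add[OF ij(2)] by simp
    qed
    have "K (2 * k * m, 2 * \<xi> + int j) (2 * k * m', 2 * \<xi>' + int i) =
        (if (2 * k * m, x) = (2 * k * m', x') then 1 else 0) - U (2 * k * m', x') (2 * k * m, x) + s"
    proof -
      have "x - 2 * int n = 2 * \<xi> + int j" "x' - 2 * int n = 2 * \<xi>' + int i" by (simp_all add: x_def x'_def)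
      then show ?thesis
        using KX[OF pM xS, of "\<lambda>l. sol i m' \<xi>' (l mod 2) $ (n - l div 2)"]
          sol_solves[OF ij(1) m(4) \<xi>', folded x'_def] unfolding row by simp
    qed
    also have "(if (2 * k * m, x) = (2 * k * m', x') then 1 else 0) - U (2 * k * m', x') (2 * k * m, x) =
        (- of_bool (m > m') / (2 * of_real pi * \<i>)) *
          contour_integral c01 (\<lambda>z. ((z powi (\<xi>' - \<xi>) / z) \<cdot>\<^sub>m mat_powi (\<Phi> z) (int m - int m')) $$ (i, j))"
    proof -
      \<comment> \<open>For \<open>m < m'\<close> there is neither a coincidence nor a path between
        the points, for \<open>m = m'\<close> the identity cancels the propagator, and for
        \<open>m' < m\<close> only the propagator remains.\<close>
      consider "m < m'" | "m = m'" | "m' < m" by linarith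
      then show ?thesis
      proof cases
        case 1
        then show ?thesis using U_backwards[OF 1] k by simp
      next
        case 2
        then show ?thesis by (auto simp: propagator_def path_sum_same_level)
      next
        case 3
        then have "2 * k * m \<noteq> 2 * k * m'" using k by auto
        moreover have "U (2 * k * m', x') (2 * k * m, x) = block_toeplitz (Phi_fps ^\<^sub>m (m - m')) x' x"
          using U_block_toeplitz[OF xS(2,1), of m' m] 3 by simp
        ultimately show ?thesis
          using 3 single_integral[OF ij less_imp_le[OF 3], of \<xi>' \<xi>] by (simp add: x_def x'_def)
      qed
    qed
    also have "s = (1 / (2 * of_real pi * \<i>)\<^sup>2) * contour_integral c1 (\<lambda>w. contour_integral c01 (\<lambda>z.
      ((w powi \<xi>' / z powi (\<xi> + 1) * ((1 - 1 / z) ^ L / (1 - 1 / w) ^ L) * \<rho>1 w powi (int h - int m') / (z - w)) \<cdot>\<^sub>m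
        (E w * mat2 1 0 0 0 * mat_inv (E w) * mat_powi (\<Phi> z) (int m - int h))) $$ (i, j)))"
      using \<xi> loop1 by (subst double_integral[OF ij _ _ assms(7)]) (auto simp: s_def)
    finally show "kernel_block K (2 * k * m) \<xi> (2 * k * m') \<xi>' $$ (i, j) = (?A1 + ?A2) $$ (i, j)"
      using ij by (simp add: kernel_block_def contour_integral_mat2_def)
  qed
  show ?thesis
    using prob_space_process K main by (intro conjI exI[of _ K]) auto
qed

end
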